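(* Let $-\tfrac12\le\nu<\tfrac52$ and $z\in\mathbb{C}\setminus(-\infty,0]$. Then $$\int_0^\infty c\,J_\nu(cz)\left[e^{i(\nu+1)\pi/2}K_{2\nu}\left(2e^{i\pi/4}\sqrt{c}\right)+e^{-i(\nu+1)\pi/2}K_{2\nu}\left(2e^{-i\pi/4}\sqrt{c}\right)\right]dc=\frac{1}{z^3}\,K_\nu\left(\frac1z\right).$$
   Context: $J_\nu:\mathbb{C}\setminus(-\infty,0]\to\mathbb{C}$ is the Bessel function of the first kind and $K_\nu:\mathbb{C}\setminus(-\infty,0]\to\mathbb{C}$ is the modified Bessel function of the second kind, of order $\nu$.
   Formalization: For non-real z the integral diverges, so the identity is stated whenever the integral exists (with absolute convergence for all z > 0), and for all z in the slit plane through the analytic continuation of the integral from z > 0. *)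

theory Defs
  imports "HOL-Analysis.Analysis"
begin

text \<open>
  Bessel functions of real order \<open>\<nu>\<close>, used only for arguments off the non-positive real axis.
  Complex \<open>powr\<close> is the principal branch, and \<open>rGamma\<close> is the entire function \<open>1 / Gamma\<close>, so
  terms at the poles of \<open>Gamma\<close> vanish as they should.
\<close>

definition Bessel_J :: "real \<Rightarrow> complex \<Rightarrow> complex" where
  "Bessel_J \<nu> z = (z / 2) powr (of_real \<nu>) *
     (\<Sum>k. (-1) ^ k * rGamma (of_real \<nu> + of_nat k + 1) / fact k * (z / 2) ^ (2 * k))"

definition Bessel_I :: "real \<Rightarrow> complex \<Rightarrow> complex" where
  "Bessel_I \<nu> z = (z / 2) powr (of_real \<nu>) *
     (\<Sum>k. rGamma (of_real \<nu> + of_nat k + 1) / fact k * (z / 2) ^ (2 * k))"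

text \<open>
  At integer order the quotient is \<open>0 / 0\<close> and, as usual, \<open>K\<close> is defined by continuity in the
  order; \<open>at \<nu>\<close> is the punctured neighbourhood filter and integers are isolated, so only
  non-integer orders enter the limit.
\<close>

definition Bessel_K :: "real \<Rightarrow> complex \<Rightarrow> complex" where
  "Bessel_K \<nu> z =
     (let Q = (\<lambda>\<mu>. of_real (pi / 2) * (Bessel_I (- \<mu>) z - Bessel_I \<mu> z) / of_real (sin (\<mu> * pi)))
      in if \<nu> \<notin> \<int> then Q \<nu> else Lim (at \<nu>) Q)"

text \<open>
  For \<open>z\<close> off the real axis \<open>J\<^sub>\<nu> (c z)\<close> grows like \<open>exp (c * \<bar>Im z\<bar>)\<close> as \<open>c\<close> tends to
  infinity, while the bracket below only decays like \<open>exp (- sqrt (2 * c))\<close>, so the integral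
  over \<open>c > 0\<close> diverges.  Hence the integral formula has to be read as an equality wherever the
  integral exists (which includes all \<open>z > 0\<close>), and on the rest of the slit plane through the
  analytic continuation of the integral from \<open>z > 0\<close>.
\<close>

definition Bessel_JK_integrand :: "real \<Rightarrow> complex \<Rightarrow> real \<Rightarrow> complex" where
  "Bessel_JK_integrand \<nu> z c =
     of_real c * Bessel_J \<nu> (of_real c * z) *
       (exp (\<i> * of_real ((\<nu> + 1) * pi / 2)) *
          Bessel_K (2 * \<nu>) (2 * exp (\<i> * of_real (pi / 4)) * of_real (sqrt c))
      + exp (- \<i> * of_real ((\<nu> + 1) * pi / 2)) *
          Bessel_K (2 * \<nu>) (2 * exp (- \<i> * of_real (pi / 4)) * of_real (sqrt c)))"

end

theory Submission
  imports Defs "HOL-Complex_Analysis.Complex_Analysis" "HOL-Real_Asymp.Real_Asymp"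
begin

text \<open>
  For \<open>x > 0\<close> and \<open>\<omega> = exp (i \<pi> / 4)\<close>, write
  \<open>K\<^bsub>2\<nu>\<^esub>(2 \<omega> \<surd>c) = 1/2 c\<^sup>\<nu> \<integral> exp (- \<omega> e\<^sup>t - \<omega> c e\<^bsup>-t\<^esup> - 2 \<nu> t) dt\<close> over the real line.
  Fubini reduces the \<open>c\<close>-integral to the Laplace transform of \<open>c\<^bsup>\<nu>+1\<^esup> J\<^sub>\<nu>(c x)\<close>, a multiple of
  \<open>p (p\<^sup>2 + x\<^sup>2)\<^bsup>-\<nu>-3/2\<^esup>\<close> at \<open>p = \<omega> e\<^bsup>-t\<^esup>\<close>.  Writing this power as a Gamma integral in a variable
  \<open>v\<close> and swapping again, the \<open>t\<close>-integral becomes a Gaussian integral along the ray of direction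
  \<open>\<omega>\<close>; rotating it to the imaginary axis and adding the complex conjugate gives a multiple of
  \<open>v\<^bsup>-3/2\<^esup> exp (- 1 / (4 x\<^sup>2 v))\<close>.  The remaining \<open>v\<close>-integral is the same
  representation of \<open>K\<^sub>\<nu>(1 / x)\<close>.

  For \<open>z\<close> off the real axis \<open>J\<^sub>\<nu>(c z)\<close> grows like \<open>c\<^bsup>-1/2\<^esup> exp (c \<bar>Im z\<bar>)\<close>, so the
  integrals over suitable unit intervals are unbounded and the integral does not exist.
\<close>

section \<open>Parameter integrals and Laplace transforms of powers\<close>

text \<open>The definitions give K as a quotient of series, at integer order as a limit, while the
  computation needs K as an integral. The bridge is a uniqueness argument for a first-order system
  singular at 0. It is run only for orders in (-1, 0), where both candidates are continuous up to 0
  and agree there; differentiation then reaches the higher non-integer orders, evenness the lower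
  ones, and continuity in the order the integers. The branch factor
  \<open>(z / 2) powr \<nu>\<close> is split off, which leaves an entire function. The bound
  \<open>- 1 / 2 \<le> \<nu>\<close> keeps that entire function bounded along the negative axis, by
  the Poisson integral; this boundedness justifies the first Fubini exchange. The integral for K
  covers only the right half-plane, but 1 / z ranges over the slit plane. Holomorphy of K there
  comes from the series, at integer order through derivatives in the order. Off the real axis
  cancellation might still produce a conditionally convergent integral, so its non-existence needs a
  leading term with nonzero constant and control of its phase, not just a growth bound.\<close>

theorem
  fixes f :: "complex \<Rightarrow> 'a \<Rightarrow> complex"
  assumes A: "open A"
    and meas: "\<And>z. z \<in> A \<Longrightarrow> f z \<in> borel_measurable M"
    and hol: "\<And>x. x \<in> space M \<Longrightarrow> (\<lambda>z. f z x) holomorphic_on A"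
    and dom: "\<And>z. z \<in> A \<Longrightarrow> \<exists>r>0. \<exists>h::'a \<Rightarrow> real. integrable M h \<and>
                (\<forall>w\<in>ball z r \<inter> A. \<forall>x\<in>space M. norm (f w x) \<le> h x)"
  shows has_field_derivative_integral:
      "z \<in> A \<Longrightarrow> ((\<lambda>z. \<integral>x. f z x \<partial>M) has_field_derivative (\<integral>x. deriv (\<lambda>z. f z x) z \<partial>M)) (at z)"
    and holomorphic_integral: "(\<lambda>z. \<integral>x. f z x \<partial>M) holomorphic_on A"
proof -
  show main: "((\<lambda>z. \<integral>x. f z x \<partial>M) has_field_derivative (\<integral>x. deriv (\<lambda>z. f z x) z \<partial>M)) (at z)"
    if z: "z \<in> A" for z
  proof -
    obtain r0 h where r0: "r0 > 0" and h: "integrable M h"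
      and bd0: "\<And>w x. w \<in> ball z r0 \<inter> A \<Longrightarrow> x \<in> space M \<Longrightarrow> norm (f w x) \<le> h x"
      using dom[OF z] by blast
    obtain r1 where r1: "r1 > 0" "ball z r1 \<subseteq> A" using A z open_contains_ball by blast
    \<comment> \<open>A third leaves room: closed discs of radius \<open>r\<close> about points of
      \<open>ball z r\<close> stay in \<open>ball z (3 * r)\<close>, where both holomorphy and the
      majorant are available.\<close>
    define r where "r = min r0 r1 / 3"
    have r: "r > 0" using r0 r1 by (simp add: r_def)
    have bd: "norm (f w x) \<le> h x" if "w \<in> ball z (3 * r)" "x \<in> space M" for w x
      using that r1 bd0 by (auto simp: r_def)
    have sub: "ball z (3 * r) \<subseteq> A" using r1 by (auto simp: r_def)
    have int: "integrable M (f w)" if "w \<in> ball z (3 * r)" for w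
      by (rule Bochner_Integration.integrable_bound[OF h])
         (use that bd sub meas order_trans[OF bd abs_ge_self] in \<open>auto intro!: AE_I2\<close>)
    \<comment> \<open>Only values of \<open>f\<close> are dominated, not derivatives. Cauchy's
      inequality on discs of radius \<open>r\<close> bounds the derivative by
      \<open>h x / r\<close>, and the mean value inequality turns this into a majorant for the
      difference quotients.\<close>
    have lip: "norm (f w x - f z x) \<le> h x / r * norm (w - z)"
      if w: "w \<in> ball z r" and x: "x \<in> space M" for w x
    proof (rule field_differentiable_bound[of "ball z r" "\<lambda>w. f w x" "deriv (\<lambda>w. f w x)"])
      have hol': "(\<lambda>w. f w x) holomorphic_on ball z (3 * r)"
        using hol[OF x] sub holomorphic_on_subset by blast
      show "((\<lambda>w. f w x) has_field_derivative deriv (\<lambda>w. f w x) u) (at u within ball z r)"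
        if "u \<in> ball z r" for u
        using hol' that r by (intro DERIV_subset[OF holomorphic_derivI[OF hol']]) auto
      show "norm (deriv (\<lambda>w. f w x) u) \<le> h x / r" if u: "u \<in> ball z r" for u
      proof -
        have s: "cball u r \<subseteq> ball z (3 * r)"
        proof
          fix v assume "v \<in> cball u r"
          then have "dist z v \<le> dist z u + r" using dist_triangle[of z v u] by auto
          then show "v \<in> ball z (3 * r)" using u r by auto
        qed
        have "norm ((deriv ^^ 1) (\<lambda>w. f w x) u) \<le> fact 1 * h x / r ^ 1"
        proof (rule Cauchy_inequality)
          show "(\<lambda>w. f w x) holomorphic_on ball u r"
            using hol' s ball_subset_cball holomorphic_on_subset by blast
          show "continuous_on (cball u r) (\<lambda>w. f w x)"
            using hol' s holomorphic_on_imp_continuous_on continuous_on_subset by blast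
          show "norm (f v x) \<le> h x" if "norm (u - v) = r" for v
            using bd[OF _ x] s that by (auto simp: dist_norm)
        qed (use r in auto)
        then show ?thesis by simp
      qed
    qed (use w r in auto)
    show ?thesis
      unfolding has_field_derivative_iff tendsto_at_iff_sequentially
    proof (intro allI impI)
      fix X :: "nat \<Rightarrow> complex"
      assume X: "\<forall>i. X i \<in> UNIV - {z}" "X \<longlonglongrightarrow> z"
      obtain N where N: "\<And>n. n \<ge> N \<Longrightarrow> X n \<in> ball z r"
        using X(2) r by (metis lim_sequentially mem_ball dist_commute)
      define Y where "Y n = X (n + N)" for n
      have Y: "Y n \<in> ball z r" "Y n \<noteq> z" for n using N X by (auto simp: Y_def)
      have Ylim: "Y \<longlonglongrightarrow> z" unfolding Y_def using X(2) LIMSEQ_ignore_initial_segment by blast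
      have at: "filterlim Y (at z) sequentially"
        using Ylim Y by (auto simp: filterlim_at)
      have lim: "(\<lambda>n. (f (Y n) x - f z x) / (Y n - z)) \<longlonglongrightarrow> deriv (\<lambda>z. f z x) z" if "x \<in> space M" for x
      proof -
        have "((\<lambda>z. f z x) has_field_derivative deriv (\<lambda>z. f z x) z) (at z)"
          using hol[OF that] A z holomorphic_derivI by blast
        then show ?thesis unfolding has_field_derivative_iff
          using filterlim_compose[OF _ at] by blast
      qed
      have meas': "(\<lambda>x. (f (Y n) x - f z x) / (Y n - z)) \<in> borel_measurable M" for n
      proof -
        have "Y n \<in> ball z (3 * r)" using Y(1)[of n] r by auto
        then have "Y n \<in> A" using sub by blast
        then show ?thesis
          using meas[OF z] meas[of "Y n"] by (intro borel_measurable_divide borel_measurable_diff) auto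
      qed
      have "(\<lambda>n. \<integral>x. (f (Y n) x - f z x) / (Y n - z) \<partial>M) \<longlonglongrightarrow> (\<integral>x. deriv (\<lambda>z. f z x) z \<partial>M)"
      proof (rule integral_dominated_convergence[where w = "\<lambda>x. h x / r"])
        show "(\<lambda>x. deriv (\<lambda>z. f z x) z) \<in> borel_measurable M"
          by (rule borel_measurable_LIMSEQ_metric[where f = "\<lambda>n x. (f (Y n) x - f z x) / (Y n - z)", OF meas']) (use lim in auto)
        show "AE x in M. norm ((f (Y n) x - f z x) / (Y n - z)) \<le> h x / r" for n
          using lip[OF Y(1)[of n]] Y(2)[of n] by (auto simp: norm_divide divide_simps mult_ac)
      qed (use meas' lim h in auto)
      also have "(\<lambda>n. \<integral>x. (f (Y n) x - f z x) / (Y n - z) \<partial>M) =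
                 (\<lambda>n. ((\<lambda>y. ((\<integral>x. f y x \<partial>M) - (\<integral>x. f z x \<partial>M)) / (y - z)) \<circ> X) (n + N))"
      proof
        fix n
        have "Y n \<in> ball z (3 * r)" "z \<in> ball z (3 * r)" using Y(1)[of n] r by auto
        then show "(\<integral>x. (f (Y n) x - f z x) / (Y n - z) \<partial>M) =
            ((\<lambda>y. ((\<integral>x. f y x \<partial>M) - (\<integral>x. f z x \<partial>M)) / (y - z)) \<circ> X) (n + N)"
          using int by (simp add: Y_def)
      qed
      finally show "((\<lambda>y. ((\<integral>x. f y x \<partial>M) - (\<integral>x. f z x \<partial>M)) / (y - z)) \<circ> X)
          \<longlonglongrightarrow> (\<integral>x. deriv (\<lambda>z. f z x) z \<partial>M)"
        using LIMSEQ_offset by blast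
    qed
  qed
  show "(\<lambda>z. \<integral>x. f z x \<partial>M) holomorphic_on A"
    using main A by (meson field_differentiable_at_within field_differentiable_def holomorphic_on_def)
qed

text \<open>Identity theorem in the form used repeatedly below: a rescaling or a power series
  settles an identity for real parameters, and holomorphy carries it to a complex domain. The
  midpoint of the interval serves as the limit point of the agreement set.\<close>

lemma holomorphic_eq_on_real_interval:
  assumes "f holomorphic_on A" "g holomorphic_on A" "open A" "connected A" "a < b"
    and eq: "\<And>x. a < x \<Longrightarrow> x < b \<Longrightarrow> complex_of_real x \<in> A \<and> f (of_real x) = g (of_real x)"
    and "w \<in> A"
  shows "f w = g w"
proof -
  define m where "m = (a + b) / 2"
  have m: "a < m" "m < b" using \<open>a < b\<close> by (auto simp: m_def)
  have "m islimpt {a<..<b}"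
    using m by (intro open_imp_islimpt) (auto simp: )
  then have lim: "complex_of_real m islimpt (of_real ` {a<..<b})"
    unfolding islimpt_sequential
    by (elim exE conjE, rule_tac x="of_real \<circ> f" in exI) (auto intro!: tendsto_of_real simp: o_def)
  have "f w - g w = 0"
    by (rule analytic_continuation[of "\<lambda>z. f z - g z" A "of_real ` {a<..<b}" "of_real m"])
       (use assms m lim in \<open>auto intro!: holomorphic_intros\<close>)
  then show ?thesis by simp
qed

lemma open_connected_right_half_plane: "open {z. Re z > 0}" "connected {z. Re z > 0}"
  by (auto intro: open_halfspace_Re_gt convex_connected convex_halfspace_Re_gt)

section \<open>Lebesgue measure on the positive half-line\<close>

text \<open>A restricted measure rather than an indicator in the integrand, so that it is a
  sigma-finite measure in its own right and can be a factor of the product measures in the Fubini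
  arguments.\<close>

abbreviation halfline :: "real measure" where
  "halfline \<equiv> restrict_space lborel {0<..}"

lemma space_halfline [simp]: "space halfline = {0<..}"
  by (simp add: space_restrict_space)

interpretation halfline: sigma_finite_measure halfline
  by (rule sigma_finite_measure_restrict_space) (auto simp: sigma_finite_lborel)

lemma integral_halfline_scale:
  fixes f :: "real \<Rightarrow> 'a::{banach, second_countable_topology}"
  assumes "c > 0"
  shows "(\<integral>x. f (c * x) \<partial>halfline) = (\<integral>x. f x \<partial>halfline) /\<^sub>R c"
proof -
  have "(\<integral>x. f x \<partial>halfline) = (\<integral>x. indicator {0<..} x *\<^sub>R f x \<partial>lborel)"
    by (subst integral_restrict_space) auto
  also have "\<dots> = c *\<^sub>R (\<integral>x. indicator {0<..} (c * x) *\<^sub>R f (c * x) \<partial>lborel)"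
    using lborel_integral_real_affine[of c "\<lambda>x. indicator {0<..} x *\<^sub>R f x" 0] assms by simp
  also have "(\<integral>x. indicator {0<..} (c * x) *\<^sub>R f (c * x) \<partial>lborel) = (\<integral>x. f (c * x) \<partial>halfline)"
    using assms by (subst integral_restrict_space) (auto simp: indicator_def zero_less_mult_iff intro!: Bochner_Integration.integral_cong)
  finally show ?thesis using assms by simp
qed

lemma integrable_halfline_scale:
  fixes f :: "real \<Rightarrow> 'a::{banach, second_countable_topology}"
  assumes "c > 0"
  shows "integrable halfline (\<lambda>x. f (c * x)) \<longleftrightarrow> integrable halfline f"
proof -
  have "integrable halfline f \<longleftrightarrow> integrable lborel (\<lambda>x. indicator {0<..} x *\<^sub>R f x)"
    by (subst integrable_restrict_space) (auto simp: set_integrable_def)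
  also have "\<dots> \<longleftrightarrow> integrable lborel (\<lambda>x. indicator {0<..} (c * x) *\<^sub>R f (c * x))"
    using lborel_integrable_real_affine_iff[of c "\<lambda>x. indicator {0<..} x *\<^sub>R f x" 0] assms by simp
  also have "\<dots> \<longleftrightarrow> integrable halfline (\<lambda>x. f (c * x))"
    using assms by (subst integrable_restrict_space) (auto simp: set_integrable_def indicator_def zero_less_mult_iff intro!: Bochner_Integration.integrable_cong)
  finally show ?thesis by simp
qed

lemma borel_measurable_halfline:
  assumes "continuous_on {0<..} f"
  shows "f \<in> borel_measurable halfline"
  using borel_measurable_continuous_on_restrict[OF assms] measurable_cong_sets
  by (metis sets_lborel sets_restrict_space_cong)

text \<open>Bridge between the Bochner integrals of the computation and the gauge integrals of the
  final statement. Borel measurability is assumed because absolute integrability refers to the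
  completed measure, and integrals over \<open>lborel\<close> and its completion agree for Borel
  functions.\<close>

lemma absolutely_integrable_restrict_lborel:
  fixes f :: "real \<Rightarrow> 'a::euclidean_space"
  assumes S: "S \<in> sets borel" and f: "f \<in> borel_measurable (restrict_space lborel S)"
  shows "integrable (restrict_space lborel S) f \<longleftrightarrow> f absolutely_integrable_on S"
    and "integrable (restrict_space lborel S) f \<Longrightarrow> integral S f = (\<integral>x. f x \<partial>restrict_space lborel S)"
proof -
  have m: "(\<lambda>x. indicator S x *\<^sub>R f x) \<in> borel_measurable lborel"
    using f S by (subst (asm) borel_measurable_restrict_space_iff) auto
  have eq: "integrable (restrict_space lborel S) f \<longleftrightarrow> integrable lborel (\<lambda>x. indicator S x *\<^sub>R f x)"
    using S by (subst integrable_restrict_space) (auto simp: set_integrable_def)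
  then show 1: "integrable (restrict_space lborel S) f \<longleftrightarrow> f absolutely_integrable_on S"
    unfolding set_integrable_def using integrable_completion[OF m] by simp
  assume i: "integrable (restrict_space lborel S) f"
  have "integral S f = (LINT x:S|lebesgue. f x)"
    using i 1 set_lebesgue_integral_eq_integral(2) by metis
  also have "\<dots> = (\<integral>x. indicator S x *\<^sub>R f x \<partial>lborel)"
    unfolding set_lebesgue_integral_def using integral_completion[OF m] .
  also have "\<dots> = (\<integral>x. f x \<partial>restrict_space lborel S)"
    using S by (subst integral_restrict_space) auto
  finally show "integral S f = (\<integral>x. f x \<partial>restrict_space lborel S)" .
qed

lemmas halfline_absolutely_integrable = absolutely_integrable_restrict_lborel[OF borel_open[OF open_greaterThan]]

section \<open>Gamma integrals and Laplace transforms of powers\<close>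

lemma Gamma_halfline:
  assumes s: "s > 0"
  shows "integrable halfline (\<lambda>t. t powr (s - 1) * exp (- t))"
    and "(\<integral>t. t powr (s - 1) * exp (- t) \<partial>halfline) = Gamma s"
proof -
  have eq: "(\<lambda>t. complex_of_real t powr (s - 1) / of_real (exp t)) t = complex_of_real (t powr (s - 1) * exp (- t))"
    if "t > 0" for t
    using that by (auto simp: powr_of_real exp_minus divide_simps simp flip: exp_of_real of_real_diff)
  have "(\<lambda>t. complex_of_real t powr (s - 1) / of_real (exp t)) absolutely_integrable_on {0<..}"
    using absolutely_integrable_Gamma_integral'[of "of_real s"] s by simp
  then have "(\<lambda>t. complex_of_real (t powr (s - 1) * exp (- t))) absolutely_integrable_on {0<..}"
    by (rule absolutely_integrable_spike[OF _ negligible_empty]) (use eq in auto)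
  then have "integrable halfline (\<lambda>t. complex_of_real (t powr (s - 1) * exp (- t)))"
    by (subst halfline_absolutely_integrable) (auto intro!: borel_measurable_halfline continuous_intros)
  then show int: "integrable halfline (\<lambda>t. t powr (s - 1) * exp (- t))"
    using complex_of_real_integrable_eq by blast
  have "((\<lambda>t. complex_of_real (t powr (s - 1) * exp (- t))) has_integral Gamma (of_real s)) {0<..}"
  proof (rule has_integral_eq)
    show "((\<lambda>t. complex_of_real t powr (of_real s - 1) / of_real (exp t)) has_integral Gamma (of_real s)) {0<..}"
      using s by (intro Gamma_integral_complex') simp
    show "complex_of_real t powr (of_real s - 1) / of_real (exp t) = of_real (t powr (s - 1) * exp (- t))"
      if "t \<in> {0<..}" for t
      using eq[of t] that by simp
  qed
  then have "integral {0<..} (\<lambda>t. complex_of_real (t powr (s - 1) * exp (- t))) = of_real (Gamma s)"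
    by (simp add: integral_unique Gamma_complex_of_real)
  then have "(\<integral>t. complex_of_real (t powr (s - 1) * exp (- t)) \<partial>halfline) = of_real (Gamma s)"
    using halfline_absolutely_integrable(2)[OF _ iffD2[OF complex_of_real_integrable_eq int]]
      borel_measurable_integrable[OF iffD2[OF complex_of_real_integrable_eq int]] by simp
  then show "(\<integral>t. t powr (s - 1) * exp (- t) \<partial>halfline) = Gamma s"
    by (simp only: integral_complex_of_real of_real_eq_iff)
qed

lemma laplace_power_real:
  assumes s: "s > 0" and p: "p > 0"
  shows integrable_powr_exp: "integrable halfline (\<lambda>t. t powr (s - 1) * exp (- p * t))"
    and "(\<integral>t. t powr (s - 1) * exp (- p * t) \<partial>halfline) = Gamma s * p powr (- s)"
proof -
  have eq: "t powr (s - 1) * exp (- p * t) = p powr (1 - s) * ((p * t) powr (s - 1) * exp (- (p * t)))"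
    if "t > 0" for t
    using p that by (simp add: powr_mult powr_diff field_simps)
  have "integrable halfline (\<lambda>t. (p * t) powr (s - 1) * exp (- (p * t)))"
    using integrable_halfline_scale[OF p, of "\<lambda>t. t powr (s - 1) * exp (- t)"] Gamma_halfline[OF s] by simp
  then have "integrable halfline (\<lambda>t. p powr (1 - s) * ((p * t) powr (s - 1) * exp (- (p * t))))"
    by simp
  then show "integrable halfline (\<lambda>t. t powr (s - 1) * exp (- p * t))"
    by (rule Bochner_Integration.integrable_cong[THEN iffD1, rotated -1]) (use eq in auto)
  have "(\<integral>t. t powr (s - 1) * exp (- p * t) \<partial>halfline) =
        (\<integral>t. p powr (1 - s) * ((p * t) powr (s - 1) * exp (- (p * t))) \<partial>halfline)"
    by (intro Bochner_Integration.integral_cong) (use eq in auto)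
  also have "\<dots> = p powr (1 - s) * (Gamma s / p)"
    using integral_halfline_scale[OF p, of "\<lambda>t. t powr (s - 1) * exp (- t)"] Gamma_halfline[OF s]
    by (simp add: divide_inverse mult.commute)
  also have "\<dots> = Gamma s * p powr (- s)"
    using p by (simp add: powr_diff powr_minus field_simps)
  finally show "(\<integral>t. t powr (s - 1) * exp (- p * t) \<partial>halfline) = Gamma s * p powr (- s)" .
qed

text \<open>For real p this is a rescaled Gamma integral. Both sides are holomorphic on the right
  half-plane, so the principal branch on the right is the correct one for complex p.\<close>

lemma laplace_power:
  assumes s: "s > 0" and p: "Re p > 0"
  shows "integrable halfline (\<lambda>t. of_real (t powr (s - 1)) * exp (- p * of_real t))"
    and "(\<integral>t. of_real (t powr (s - 1)) * exp (- p * of_real t) \<partial>halfline) = of_real (Gamma s) * p powr (- of_real s)"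
proof -
  have meas: "(\<lambda>t. of_real (t powr (s - 1)) * exp (- p * of_real t)) \<in> borel_measurable halfline" for p :: complex
    by (intro borel_measurable_halfline continuous_intros) auto
  show "integrable halfline (\<lambda>t. of_real (t powr (s - 1)) * exp (- p * of_real t))"
    by (rule Bochner_Integration.integrable_bound[OF integrable_powr_exp[OF s p] meas])
       (auto simp: norm_mult)
  define A where "A = {p::complex. Re p > 0}"
  have A: "open A" "connected A"
    unfolding A_def by (rule open_connected_right_half_plane)+
  have F: "(\<lambda>p. \<integral>t. of_real (t powr (s - 1)) * exp (- p * of_real t) \<partial>halfline) holomorphic_on A"
  proof (rule holomorphic_integral[OF A(1) meas])
    fix q assume q: "q \<in> A"
    \<comment> \<open>On the disc of radius Re q / 2 about q the real part stays above Re q / 2, so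
      one real exponential dominates there.\<close>
    define r where "r = Re q / 2"
    have r: "r > 0" using q by (simp add: r_def A_def)
    have "norm (complex_of_real (t powr (s - 1)) * exp (- w * of_real t)) \<le> t powr (s - 1) * exp (- r * t)"
      if "w \<in> ball q r" "t > 0" for w t
    proof -
      have "\<bar>Re (q - w)\<bar> < r" using that(1) abs_Re_le_cmod[of "q - w"] by (auto simp: dist_norm)
      then have "r \<le> Re w" by (auto simp: r_def abs_if split: if_splits)
      then show ?thesis using that by (auto simp: norm_mult mult_right_mono)
    qed
    then show "\<exists>r>0. \<exists>h. integrable halfline h \<and> (\<forall>w\<in>ball q r \<inter> A. \<forall>x\<in>space halfline.
        norm (complex_of_real (x powr (s - 1)) * exp (- w * complex_of_real x)) \<le> h x)"
      using r integrable_powr_exp[OF s r] by (intro exI[of _ r] conjI exI[of _ "\<lambda>t. t powr (s - 1) * exp (- r * t)"]) auto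
  qed (auto intro!: holomorphic_intros)
  have G: "(\<lambda>p. of_real (Gamma s) * p powr (- of_real s)) holomorphic_on A"
    by (intro holomorphic_intros) (auto simp: A_def complex_nonpos_Reals_iff)
  have eq: "complex_of_real x \<in> A \<and>
      (\<integral>t. of_real (t powr (s - 1)) * exp (- complex_of_real x * of_real t) \<partial>halfline) =
      of_real (Gamma s) * complex_of_real x powr (- of_real s)" if "0 < x" "x < 1" for x
  proof -
    have "(\<integral>t. of_real (t powr (s - 1)) * exp (- complex_of_real x * of_real t) \<partial>halfline) =
      (\<integral>t. complex_of_real (t powr (s - 1) * exp (- x * t)) \<partial>halfline)"
      by (simp flip: exp_of_real)
    also have "\<dots> = of_real (Gamma s * x powr (- s))"
      using laplace_power_real[OF s that(1)] by (simp only: integral_complex_of_real)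
    finally show ?thesis using that by (simp add: A_def powr_of_real[symmetric])
  qed
  show "(\<integral>t. of_real (t powr (s - 1)) * exp (- p * of_real t) \<partial>halfline) = of_real (Gamma s) * p powr (- of_real s)"
    by (rule holomorphic_eq_on_real_interval[OF F G A zero_less_one eq]) (use p in \<open>auto simp: A_def\<close>)
qed

section \<open>The Bessel--Clifford function\<close>

text \<open>What remains of I and J after removing the factor \<open>(z / 2) powr \<nu>\<close>, as
  an entire function of \<open>(z / 2)\<^sup>2\<close> or its negative: a regularised 0F1 series.
  The order is complex so that it can be differentiated as a holomorphic variable.\<close>

definition Bessel_Clifford :: "complex \<Rightarrow> complex \<Rightarrow> complex" where
  "Bessel_Clifford \<mu> y = (\<Sum>k. rGamma (\<mu> + of_nat k + 1) / fact k * y ^ k)"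

text \<open>The recurrence \<open>z * rGamma (z + 1) = rGamma z\<close> shows that a unit step to
  the right does not increase the modulus once \<open>norm z \<ge> 1\<close>. The finitely many
  earlier steps lie in a compact ball. Uniformity in the order is what later permits differentiation
  in it.\<close>

lemma rGamma_shift_bounded:
  obtains C where "C > 0" "\<And>\<mu> k. norm \<mu> \<le> R \<Longrightarrow> norm (rGamma (\<mu> + of_nat k + 1) :: complex) \<le> C"
proof -
  \<comment> \<open>For \<open>k \<ge> K\<close> the point \<mu> + k + 1 has modulus at least k + 1
    - R, hence at least 1; for \<open>k \<le> K\<close> it lies in the ball of radius R + K +
    1.\<close>
  define K where "K = nat \<lceil>\<bar>R\<bar>\<rceil>"
  have K: "real K \<ge> R" unfolding K_def by linarith
  have "compact ((\<lambda>z. norm (rGamma z :: complex)) ` cball 0 (R + K + 1))"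
    by (intro compact_continuous_image continuous_intros compact_cball)
  then obtain C where C: "\<And>z::complex. z \<in> cball 0 (R + K + 1) \<Longrightarrow> norm (rGamma z) \<le> C"
    by (meson bounded_imp_bdd_above compact_imp_bounded bdd_above.E imageI)
  have "norm (rGamma (\<mu> + of_nat k + 1) :: complex) \<le> max C 1" if \<mu>: "norm \<mu> \<le> R" for \<mu> k
  proof (induction k)
    case 0
    have "norm (\<mu> + 1) \<le> R + K + 1"
      using norm_triangle_ineq[of \<mu> 1] \<mu> by simp
    then have "norm (rGamma (\<mu> + 1)) \<le> C" by (intro C) simp
    then show ?case by simp
  next
    case (Suc k)
    show ?case
    proof (cases "k < K")
      case True
      have "norm (\<mu> + of_nat (Suc k) + 1) \<le> norm \<mu> + norm (of_nat (Suc k) :: complex) + 1"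
        using norm_triangle_ineq[of "\<mu> + of_nat (Suc k)" 1] norm_triangle_ineq[of \<mu> "of_nat (Suc k)"] by simp
      also have "\<dots> \<le> R + K + 1" using \<mu> True unfolding norm_of_nat by simp
      finally have "norm (rGamma (\<mu> + of_nat (Suc k) + 1)) \<le> C" by (intro C) simp
      then show ?thesis by simp
    next
      case False
      define z where "z = \<mu> + of_nat k + 1"
      have "norm (of_nat k + 1 :: complex) = k + 1"
        by (metis norm_of_nat of_nat_Suc Suc_eq_plus1 of_nat_add of_nat_1)
      then have "real k + 1 - norm \<mu> \<le> norm z"
        using norm_triangle_ineq2[of "of_nat k + 1" "- \<mu>"] by (simp add: z_def algebra_simps)
      then have z: "norm z \<ge> 1" using \<mu> False K by linarith
      have "norm z * norm (rGamma (z + 1)) = norm (rGamma z)"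
        using rGamma_plus1[of z] by (metis norm_mult)
      then have "norm (rGamma (z + 1)) \<le> norm (rGamma z)"
        using z mult_right_mono[of 1 "norm z" "norm (rGamma (z + 1))"] by simp
      then show ?thesis using Suc.IH by (simp add: z_def algebra_simps)
    qed
  qed
  then show ?thesis by (intro that[of "max C 1"]) auto
qed

lemma Bessel_Clifford_summable_norm:
  "summable (\<lambda>k. norm (rGamma (\<mu> + of_nat k + 1) / fact k * y ^ k :: complex))"
proof -
  obtain C where C: "C > 0" "\<And>\<mu>' k. norm \<mu>' \<le> norm \<mu> \<Longrightarrow> norm (rGamma (\<mu>' + of_nat k + 1) :: complex) \<le> C"
    using rGamma_shift_bounded by blast
  show ?thesis
  proof (rule summable_comparison_test')
    show "summable (\<lambda>k. C * (norm y ^ k /\<^sub>R fact k))"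
      using summable_exp[of "norm y"] by (intro summable_mult) (simp add: field_simps)
    show "norm (norm (rGamma (\<mu> + of_nat k + 1) / fact k * y ^ k)) \<le> C * (norm y ^ k /\<^sub>R fact k)" if "k \<ge> 0" for k
      using C(2)[of \<mu> k] by (auto simp: norm_mult norm_divide norm_power divide_simps intro!: mult_right_mono)
  qed
qed

text \<open>Differentiating term by term cancels k + 1 against the factorial and merely raises the
  order, without the extra powers that occur for I and J.\<close>

lemma Bessel_Clifford_has_field_derivative:
  "(Bessel_Clifford \<mu> has_field_derivative Bessel_Clifford (\<mu> + 1) y) (at y)"
proof -
  have "((\<lambda>y. \<Sum>k. rGamma (\<mu> + of_nat k + 1) / fact k * y ^ k) has_field_derivative
          (\<Sum>k. diffs (\<lambda>k. rGamma (\<mu> + of_nat k + 1) / fact k) k * y ^ k)) (at y)"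
    by (rule termdiffs_strong_converges_everywhere) (rule summable_norm_cancel[OF Bessel_Clifford_summable_norm])
  also have "diffs (\<lambda>k. rGamma (\<mu> + of_nat k + 1) / fact k) = (\<lambda>k. rGamma (\<mu> + 1 + of_nat k + 1) / fact k)"
  proof
    fix k
    have "\<mu> + of_nat (Suc k) + 1 = \<mu> + 1 + of_nat k + 1" by simp
    then show "diffs (\<lambda>k. rGamma (\<mu> + of_nat k + 1) / fact k) k = rGamma (\<mu> + 1 + of_nat k + 1) / fact k"
      unfolding diffs_def by (simp only: fact_Suc times_divide_eq_right times_divide_eq_left
          nonzero_mult_divide_mult_cancel_left[OF of_nat_neq_0])
  qed
  finally show ?thesis by (simp add: Bessel_Clifford_def[abs_def])
qed

lemma Bessel_Clifford_holomorphic [holomorphic_intros]: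
  assumes "f holomorphic_on A"
  shows "(\<lambda>z. Bessel_Clifford \<mu> (f z)) holomorphic_on A"
proof -
  have "Bessel_Clifford \<mu> holomorphic_on UNIV"
    using Bessel_Clifford_has_field_derivative by (metis holomorphic_on_open open_UNIV)
  then show ?thesis
    using holomorphic_on_compose_gen[OF assms, of "Bessel_Clifford \<mu>" UNIV] by (simp add: o_def)
qed

lemma Bessel_Clifford_continuous [continuous_intros]:
  assumes "continuous_on A f"
  shows "continuous_on A (\<lambda>z. Bessel_Clifford \<mu> (f z))"
proof -
  have "continuous_on UNIV (Bessel_Clifford \<mu>)"
    by (rule holomorphic_on_imp_continuous_on) (use Bessel_Clifford_holomorphic[of "\<lambda>z. z"] in simp)
  then show ?thesis using assms by (rule continuous_on_compose2) auto
qed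

lemma Bessel_Clifford_0_right: "Bessel_Clifford \<mu> 0 = rGamma (\<mu> + 1)"
  unfolding Bessel_Clifford_def by (subst suminf_finite[of "{0}"]) auto

text \<open>The first n coefficients vanish because \<open>rGamma\<close> is zero at the poles of
  Gamma; reindexing the remaining series gives the factor \<open>y ^ n\<close>. This is the source
  of the symmetry of I at integer order.\<close>

lemma Bessel_Clifford_minus_nat: "Bessel_Clifford (- of_nat n) y = y ^ n * Bessel_Clifford (of_nat n) y"
proof -
  let ?f = "\<lambda>k. rGamma (- of_nat n + of_nat k + 1) / fact k * y ^ k :: complex"
  have "?f k = 0" if "k < n" for k
  proof -
    have "- of_nat n + of_nat k + 1 = - (of_nat (n - k - 1) :: complex)"
      using that by (simp add: of_nat_diff)
    then have "rGamma (- of_nat n + of_nat k + 1 :: complex) = 0"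
      by (simp only: rGamma_eq_zero_iff minus_of_nat_in_nonpos_Ints)
    then show ?thesis by simp
  qed
  then have "(\<Sum>k<n. ?f k) = 0" by (intro sum.neutral) auto
  then have "Bessel_Clifford (- of_nat n) y = (\<Sum>k. ?f (k + n))"
    unfolding Bessel_Clifford_def
    by (subst suminf_split_initial_segment[of ?f n, OF summable_norm_cancel[OF Bessel_Clifford_summable_norm]]) simp
  also have "(\<lambda>k. ?f (k + n)) = (\<lambda>k. y ^ n * (rGamma (of_nat n + of_nat k + 1) / fact k * y ^ k))"
  proof
    fix k
    have "rGamma (of_nat k + 1 :: complex) = 1 / fact k"
      by (metis Gamma_fact rGamma_inverse_Gamma inverse_eq_divide add.commute)
    moreover have "rGamma (of_nat (n + k) + 1 :: complex) = 1 / fact (n + k)"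
      by (metis Gamma_fact rGamma_inverse_Gamma inverse_eq_divide add.commute)
    ultimately show "?f (k + n) = y ^ n * (rGamma (of_nat n + of_nat k + 1) / fact k * y ^ k)"
      by (simp add: power_add field_simps add_ac)
  qed
  also have "(\<Sum>k. y ^ n * (rGamma (of_nat n + of_nat k + 1) / fact k * y ^ k)) = y ^ n * Bessel_Clifford (of_nat n) y"
    unfolding Bessel_Clifford_def by (rule suminf_mult[OF summable_norm_cancel[OF Bessel_Clifford_summable_norm]])
  finally show ?thesis .
qed

lemma Bessel_I_Clifford: "Bessel_I \<nu> z = (z / 2) powr of_real \<nu> * Bessel_Clifford (of_real \<nu>) ((z / 2)\<^sup>2)"
  by (simp add: Bessel_I_def Bessel_Clifford_def power_mult)

lemma Bessel_J_Clifford: "Bessel_J \<nu> z = (z / 2) powr of_real \<nu> * Bessel_Clifford (of_real \<nu>) (- ((z / 2)\<^sup>2))"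
  unfolding Bessel_J_def Bessel_Clifford_def power_minus[of "(z / 2)\<^sup>2"] power_mult
  by (simp add: mult_ac)

section \<open>Integrals of two-sided exponential kernels\<close>

text \<open>For p = q = w / 2 the exponent is - w cosh t - \<mu> t, the classical kernel of 2 K.
  Separate parameters p and q are kept because translating t by s replaces them by p exp s and q exp
  (- s), so only their product matters up to an exponential factor.\<close>

definition exp_kernel :: "complex \<Rightarrow> complex \<Rightarrow> real \<Rightarrow> real \<Rightarrow> complex" where
  "exp_kernel p q \<mu> t = exp (- p * of_real (exp t) - q * of_real (exp (- t)) - of_real (\<mu> * t))"

definition exp_kernel_integral :: "complex \<Rightarrow> complex \<Rightarrow> real \<Rightarrow> complex" where
  "exp_kernel_integral p q \<mu> = (\<integral>t. exp_kernel p q \<mu> t \<partial>lborel)"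

lemma exp_substitution:
  fixes f :: "real \<Rightarrow> 'a::euclidean_space"
  assumes f: "f \<in> borel_measurable halfline"
  shows "integrable halfline f \<longleftrightarrow> integrable lborel (\<lambda>t. exp t *\<^sub>R f (exp t))"
    and "integrable halfline f \<Longrightarrow> (\<integral>x. f x \<partial>halfline) = (\<integral>t. exp t *\<^sub>R f (exp t) \<partial>lborel)"
proof -
  have ran: "range (exp :: real \<Rightarrow> real) = {0<..}"
    by (auto simp: image_iff) (metis exp_ln)
  have "(exp :: real \<Rightarrow> real) \<in> lborel \<rightarrow>\<^sub>M halfline"
    by (intro measurable_restrict_space2) auto
  from measurable_compose[OF this f]
  have m: "(\<lambda>t. exp t *\<^sub>R f (exp t)) \<in> borel_measurable lborel" by auto
  have sub: "(\<lambda>t. \<bar>exp t\<bar> *\<^sub>R f (exp t)) absolutely_integrable_on UNIV \<and>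
      integral UNIV (\<lambda>t. \<bar>exp t\<bar> *\<^sub>R f (exp t)) = b \<longleftrightarrow>
      f absolutely_integrable_on (range exp) \<and> integral (range exp) f = b" for b
    by (rule has_absolute_integral_change_of_variables_real)
       (auto intro!: derivative_eq_intros inj_onI)
  have eq: "integrable lborel (\<lambda>t. exp t *\<^sub>R f (exp t)) \<longleftrightarrow> (\<lambda>t. exp t *\<^sub>R f (exp t)) absolutely_integrable_on UNIV"
    using integrable_completion[OF m] by (simp add: set_integrable_def)
  show 1: "integrable halfline f \<longleftrightarrow> integrable lborel (\<lambda>t. exp t *\<^sub>R f (exp t))"
    unfolding eq halfline_absolutely_integrable(1)[OF f] using sub by (auto simp: ran)
  assume i: "integrable halfline f"
  have "(\<integral>t. exp t *\<^sub>R f (exp t) \<partial>lborel) = (LINT t:UNIV|lebesgue. exp t *\<^sub>R f (exp t))"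
    using integral_completion[OF m] by (simp add: set_lebesgue_integral_def)
  also have "\<dots> = integral UNIV (\<lambda>t. exp t *\<^sub>R f (exp t))"
    using i 1 eq set_lebesgue_integral_eq_integral(2) by metis
  also have "\<dots> = integral {0<..} f"
    using sub[of "integral {0<..} f"] i halfline_absolutely_integrable(1)[OF f] by (simp add: ran)
  also have "\<dots> = (\<integral>x. f x \<partial>halfline)"
    by (rule halfline_absolutely_integrable(2)[OF f i])
  finally show "(\<integral>x. f x \<partial>halfline) = (\<integral>t. exp t *\<^sub>R f (exp t) \<partial>lborel)" ..
qed

lemma integrable_exp_kernel_real_0:
  fixes a \<mu> :: real
  assumes "a > 0" "\<mu> < 0"
  shows "integrable lborel (\<lambda>t. exp (- a * exp t - \<mu> * t))"
    and "(\<integral>t. exp (- a * exp t - \<mu> * t) \<partial>lborel) = Gamma (- \<mu>) * a powr \<mu>"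
proof -
  note L = laplace_power_real[of "-\<mu>" a]
  have eq: "(\<lambda>t. exp t *\<^sub>R (exp t powr (- \<mu> - 1) * exp (- a * exp t))) = (\<lambda>t. exp (- a * exp t - \<mu> * t))"
    by (rule ext) (simp add: powr_def exp_diff exp_add[symmetric] exp_minus field_simps)
  show "integrable lborel (\<lambda>t. exp (- a * exp t - \<mu> * t))"
    using exp_substitution(1)[OF borel_measurable_integrable[OF L(1)]] L(1) assms unfolding eq by simp
  show "(\<integral>t. exp (- a * exp t - \<mu> * t) \<partial>lborel) = Gamma (- \<mu>) * a powr \<mu>"
    using exp_substitution(2)[OF borel_measurable_integrable[OF L(1)]] L assms unfolding eq by simp
qed

text \<open>The double exponential decay at minus infinity is weakened to a simple one: exp (- x)
  \<le> N! / x ^ N with x = b exp (- t) yields a factor exp (N t). This lowers the order to \<mu> -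
  N < 0 and leaves the case b = 0, a Gamma integral.\<close>

lemma integrable_exp_kernel_real:
  fixes a b \<mu> :: real
  assumes "a > 0" "b > 0"
  shows "integrable lborel (\<lambda>t. exp (- a * exp t - b * exp (- t) - \<mu> * t))"
proof -
  define N where "N = Suc (nat \<lceil>\<bar>\<mu>\<bar>\<rceil>)"
  have N: "\<mu> - N < 0" unfolding N_def by linarith
  show ?thesis
  proof (rule Bochner_Integration.integrable_bound)
    show "integrable lborel (\<lambda>t. fact N / b ^ N * exp (- a * exp t - (\<mu> - N) * t))"
      using integrable_exp_kernel_real_0(1)[OF assms(1) N] by simp
    show "AE t in lborel. norm (exp (- a * exp t - b * exp (- t) - \<mu> * t))
        \<le> norm (fact N / b ^ N * exp (- a * exp t - (\<mu> - N) * t))"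
    proof (rule AE_I2)
      fix t
      define x where "x = b * exp (- t)"
      have x: "x > 0" using assms by (simp add: x_def)
      have "x ^ N / fact N \<le> exp x"
        using x sum_le_suminf[OF summable_exp_generic[of x], of "{N}"]
        by (simp add: exp_def field_simps)
      then have "exp (- x) \<le> fact N / x ^ N" using x by (simp add: exp_minus field_simps)
      also have "\<dots> = fact N / b ^ N * exp (N * t)"
        using assms by (simp add: x_def power_mult_distrib exp_minus field_simps flip: exp_of_nat_mult)
      finally have "exp (- x) * exp (- a * exp t - \<mu> * t) \<le> fact N / b ^ N * exp (N * t) * exp (- a * exp t - \<mu> * t)"
        by (rule mult_right_mono) simp
      then show "norm (exp (- a * exp t - b * exp (- t) - \<mu> * t))
        \<le> norm (fact N / b ^ N * exp (- a * exp t - (\<mu> - N) * t))"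
        using assms by (simp add: x_def algebra_simps flip: exp_add)
    qed
  qed measurable
qed

lemma exp_kernel_measurable [measurable]: "exp_kernel p q \<mu> \<in> borel_measurable borel"
  unfolding exp_kernel_def by measurable

lemma norm_exp_kernel: "norm (exp_kernel p q \<mu> t) = exp (- Re p * exp t - Re q * exp (- t) - \<mu> * t)"
  unfolding exp_kernel_def norm_exp_eq_Re by simp

lemma integrable_exp_kernel:
  assumes "Re p > 0" "Re q > 0"
  shows "integrable lborel (exp_kernel p q \<mu>)"
  by (rule Bochner_Integration.integrable_bound[OF integrable_exp_kernel_real[OF assms, of \<mu>]])
     (auto simp: norm_exp_kernel)

lemma exp_kernel_integral_translate:
  "exp_kernel_integral p q \<mu> = exp (- of_real (\<mu> * s)) * exp_kernel_integral (p * of_real (exp s)) (q * of_real (exp (- s))) \<mu>"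
proof -
  have "exp_kernel_integral p q \<mu> = (\<integral>t. exp_kernel p q \<mu> (s + t) \<partial>lborel)"
    unfolding exp_kernel_integral_def using lborel_integral_real_affine[of 1 "exp_kernel p q \<mu>" s] by simp
  also have "(\<lambda>t. exp_kernel p q \<mu> (s + t)) =
     (\<lambda>t. exp (- of_real (\<mu> * s)) * exp_kernel (p * of_real (exp s)) (q * of_real (exp (- s))) \<mu> t)"
  proof
    fix t
    have e: "exp (s + t) = exp s * exp t" "exp (- (s + t)) = exp (- s) * exp (- t)"
      by (simp_all add: exp_add[symmetric])
    show "exp_kernel p q \<mu> (s + t) =
        exp (- of_real (\<mu> * s)) * exp_kernel (p * of_real (exp s)) (q * of_real (exp (- s))) \<mu> t"
      unfolding exp_kernel_def exp_add[symmetric] by (intro arg_cong[of _ _ exp]) (simp only: e of_real_mult, simp add: algebra_simps)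
  qed
  finally show ?thesis by (simp add: exp_kernel_integral_def)
qed

lemma exp_kernel_integral_reflect: "exp_kernel_integral p q \<mu> = exp_kernel_integral q p (- \<mu>)"
proof -
  have "exp_kernel_integral p q \<mu> = (\<integral>t. exp_kernel p q \<mu> (- t) \<partial>lborel)"
    unfolding exp_kernel_integral_def using lborel_integral_real_affine[of "-1" "exp_kernel p q \<mu>" 0] by simp
  also have "(\<lambda>t. exp_kernel p q \<mu> (- t)) = exp_kernel q p (- \<mu>)"
    by (rule ext) (simp add: exp_kernel_def algebra_simps)
  finally show ?thesis by (simp add: exp_kernel_integral_def)
qed

lemma
  assumes A: "open A" and f: "f holomorphic_on A" "\<And>z. z \<in> A \<Longrightarrow> Re (f z) > 0"
    and g: "g holomorphic_on A" "\<And>z. z \<in> A \<Longrightarrow> Re (g z) > 0"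
  shows exp_kernel_integral_holomorphic: "(\<lambda>z. exp_kernel_integral (f z) (g z) \<mu>) holomorphic_on A"
    and exp_kernel_integral_derivative: "z \<in> A \<Longrightarrow> ((\<lambda>z. exp_kernel_integral (f z) (g z) \<mu>) has_field_derivative
           (\<integral>t. deriv (\<lambda>z. exp_kernel (f z) (g z) \<mu> t) z \<partial>lborel)) (at z)"
proof -
  have dom: "\<exists>r>0. \<exists>h. integrable lborel h \<and> (\<forall>w\<in>ball z r \<inter> A. \<forall>t\<in>space lborel. norm (exp_kernel (f w) (g w) \<mu> t) \<le> h t)"
    if z: "z \<in> A" for z
  proof -
    \<comment> \<open>Half the real parts at z bound the real parts from below on a neighbourhood by
      continuity, so the real kernel with these parameters dominates.\<close>
    define a b where "a = Re (f z) / 2" and "b = Re (g z) / 2"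
    have ab: "a > 0" "b > 0" "a < Re (f z)" "b < Re (g z)" using f(2)[OF z] g(2)[OF z] by (auto simp: a_def b_def)
    have "isCont f z" "isCont g z"
      using f(1) g(1) A z holomorphic_on_imp_continuous_on continuous_on_eq_continuous_at by blast+
    then have "(f \<longlongrightarrow> f z) (nhds z)" "(g \<longlongrightarrow> g z) (nhds z)"
      by (simp_all add: isCont_def tendsto_at_iff_tendsto_nhds)
    then have "\<forall>\<^sub>F w in nhds z. Re (f w) > a" "\<forall>\<^sub>F w in nhds z. Re (g w) > b"
      using ab order_tendstoD(1)[OF tendsto_Re] by blast+
    then have "\<forall>\<^sub>F w in nhds z. Re (f w) > a \<and> Re (g w) > b" by eventually_elim auto
    then obtain r where r: "r > 0" "\<And>w. dist w z < r \<Longrightarrow> Re (f w) > a \<and> Re (g w) > b"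
      by (auto simp: eventually_nhds_metric)
    have "norm (exp_kernel (f w) (g w) \<mu> t) \<le> exp (- a * exp t - b * exp (- t) - \<mu> * t)" if "w \<in> ball z r" for w t
    proof -
      have "a \<le> Re (f w)" "b \<le> Re (g w)" using r(2)[of w] that by (auto simp: dist_commute)
      then have "a * exp t \<le> Re (f w) * exp t" "b * exp (-t) \<le> Re (g w) * exp (-t)" by (auto intro: mult_right_mono)
      then show ?thesis unfolding norm_exp_kernel exp_le_cancel_iff by linarith
    qed
    then show ?thesis using r(1) integrable_exp_kernel_real[OF ab(1,2), of \<mu>] by blast
  qed
  have hol: "(\<lambda>z. exp_kernel (f z) (g z) \<mu> t) holomorphic_on A" for t
    unfolding exp_kernel_def by (intro holomorphic_intros f g)
  show "(\<lambda>z. exp_kernel_integral (f z) (g z) \<mu>) holomorphic_on A"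
    unfolding exp_kernel_integral_def by (rule holomorphic_integral[OF A _ hol dom]) auto
  show "((\<lambda>z. exp_kernel_integral (f z) (g z) \<mu>) has_field_derivative
           (\<integral>t. deriv (\<lambda>z. exp_kernel (f z) (g z) \<mu> t) z \<partial>lborel)) (at z)" if "z \<in> A"
    unfolding exp_kernel_integral_def by (rule has_field_derivative_integral[OF A _ hol dom that]) auto
qed

text \<open>The derivative brings down - exp (- t), which the term \<mu> t absorbs as a shift of the
  order. \<open>Clifford_K\<close> below satisfies the same rule, and this common rule drives the
  comparison.\<close>

lemma exp_kernel_integral_derivative_right:
  assumes p: "Re p > 0" and y: "Re y > 0"
  shows "((\<lambda>y. exp_kernel_integral p y \<mu>) has_field_derivative - exp_kernel_integral p y (\<mu> + 1)) (at y)"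
proof -
  have shift: "exp_kernel p y (\<mu> + 1) t = of_real (exp (- t)) * exp_kernel p y \<mu> t" for y t
    unfolding exp_kernel_def exp_of_real[symmetric] exp_add[symmetric]
    by (rule arg_cong[of _ _ exp]) (simp add: algebra_simps)
  have "deriv (\<lambda>y. exp_kernel p y \<mu> t) y = - exp_kernel p y (\<mu> + 1) t" for t
  proof (rule DERIV_imp_deriv)
    show "((\<lambda>y. exp_kernel p y \<mu> t) has_field_derivative - exp_kernel p y (\<mu> + 1) t) (at y)"
      unfolding shift unfolding exp_kernel_def
      by (auto intro!: derivative_eq_intros)
  qed
  then have "(\<integral>t. deriv (\<lambda>y. exp_kernel p y \<mu> t) y \<partial>lborel) = - exp_kernel_integral p y (\<mu> + 1)"
    by (simp add: exp_kernel_integral_def)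
  moreover have "((\<lambda>y. exp_kernel_integral p y \<mu>) has_field_derivative
           (\<integral>t. deriv (\<lambda>y. exp_kernel p y \<mu> t) y \<partial>lborel)) (at y)"
    by (rule exp_kernel_integral_derivative[of "{y. Re y > 0}" "\<lambda>_. p" "\<lambda>y. y"])
       (use p y in \<open>auto intro!: holomorphic_intros open_halfspace_Re_gt\<close>)
  ultimately show ?thesis by simp
qed

lemma exp_kernel_integral_continuous_order:
  assumes p: "Re p > 0" and q: "Re q > 0"
  shows "isCont (\<lambda>\<mu>. exp_kernel_integral p q \<mu>) \<mu>"
  unfolding isCont_def tendsto_at_iff_sequentially exp_kernel_integral_def o_def
proof (intro allI impI)
  fix X :: "nat \<Rightarrow> real" assume "\<forall>i. X i \<in> UNIV - {\<mu>}" and X: "X \<longlonglongrightarrow> \<mu>"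
  obtain N where N: "\<And>n. n \<ge> N \<Longrightarrow> \<bar>X n - \<mu>\<bar> < 1"
    using X by (metis lim_sequentially dist_real_def zero_less_one)
  \<comment> \<open>For orders within 1 of \<mu> the factor exp (- order * t) is at most the larger
    of its values at \<mu> + 1 and \<mu> - 1, whatever the sign of t; the sum avoids a case split in
    the majorant.\<close>
  define h where "h t = exp (- Re p * exp t - Re q * exp (- t) - (\<mu> + 1) * t) + exp (- Re p * exp t - Re q * exp (- t) - (\<mu> - 1) * t)" for t
  have "(\<lambda>n. \<integral>t. exp_kernel p q (X (n + N)) t \<partial>lborel) \<longlonglongrightarrow> (\<integral>t. exp_kernel p q \<mu> t \<partial>lborel)"
  proof (rule integral_dominated_convergence[where w = h])
    show "integrable lborel h"
      unfolding h_def by (intro Bochner_Integration.integrable_add integrable_exp_kernel_real p q)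
    show "AE t in lborel. (\<lambda>n. exp_kernel p q (X (n + N)) t) \<longlonglongrightarrow> exp_kernel p q \<mu> t"
      unfolding exp_kernel_def using LIMSEQ_ignore_initial_segment[OF X] by (intro AE_I2 tendsto_intros)
    show "AE t in lborel. norm (exp_kernel p q (X (n + N)) t) \<le> h t" for n
    proof (rule AE_I2)
      fix t
      have *: "\<bar>X (n + N) - \<mu>\<bar> < 1" using N by simp
      have "- X (n + N) * t \<le> max (- (\<mu> + 1) * t) (- (\<mu> - 1) * t)"
      proof (cases "t \<ge> 0")
        case True
        then have "(\<mu> - 1) * t \<le> X (n + N) * t" using * by (intro mult_right_mono) auto
        then show ?thesis by (simp add: le_max_iff_disj algebra_simps)
      next
        case False
        then have "(\<mu> + 1) * t \<le> X (n + N) * t" using * by (intro mult_right_mono_neg) auto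
        then show ?thesis by (simp add: le_max_iff_disj algebra_simps)
      qed
      then have "norm (exp_kernel p q (X (n + N)) t) \<le> exp (- Re p * exp t - Re q * exp (- t) + max (- (\<mu> + 1) * t) (- (\<mu> - 1) * t))"
        unfolding norm_exp_kernel by simp
      also have "\<dots> \<le> h t"
        unfolding h_def max_def by (auto intro: add_increasing add_increasing2 simp del: exp_le_cancel_iff simp: algebra_simps)
      finally show "norm (exp_kernel p q (X (n + N)) t) \<le> h t" .
    qed
  qed auto
  then show "(\<lambda>n. \<integral>t. exp_kernel p q (X n) t \<partial>lborel) \<longlonglongrightarrow> (\<integral>t. exp_kernel p q \<mu> t \<partial>lborel)"
    by (rule LIMSEQ_offset)
qed

text \<open>Continuity up to the singular point y = 0 supplies the initial value for the uniqueness
  argument. Negative order makes the kernel with y = 0 integrable, and that kernel dominates all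
  others.\<close>

lemma exp_kernel_integral_continuous_right:
  assumes \<mu>: "\<mu> < 0"
  shows "continuous_on {0..} (\<lambda>y. exp_kernel_integral 1 (complex_of_real y) \<mu>)"
  unfolding continuous_on_sequentially exp_kernel_integral_def o_def
proof (intro allI ballI impI, elim conjE)
  fix X :: "nat \<Rightarrow> real" and y assume y: "y \<in> {0..}" and X: "\<forall>n. X n \<in> {0..}" "X \<longlonglongrightarrow> y"
  show "(\<lambda>n. \<integral>t. exp_kernel 1 (of_real (X n)) \<mu> t \<partial>lborel) \<longlonglongrightarrow> (\<integral>t. exp_kernel 1 (of_real y) \<mu> t \<partial>lborel)"
  proof (rule integral_dominated_convergence[where w = "\<lambda>t. exp (- 1 * exp t - \<mu> * t)"])
    show "integrable lborel (\<lambda>t. exp (- 1 * exp t - \<mu> * t))"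
      by (rule integrable_exp_kernel_real_0) (use \<mu> in auto)
    show "AE t in lborel. (\<lambda>n. exp_kernel 1 (of_real (X n)) \<mu> t) \<longlonglongrightarrow> exp_kernel 1 (of_real y) \<mu> t"
      unfolding exp_kernel_def using X(2) by (intro AE_I2 tendsto_intros)
    show "AE t in lborel. norm (exp_kernel 1 (of_real (X n)) \<mu> t) \<le> exp (- 1 * exp t - \<mu> * t)" for n
      unfolding norm_exp_kernel using X(1) by (intro AE_I2) (auto simp: )
  qed auto
qed

lemma exp_kernel_integral_0:
  assumes "\<mu> < 0"
  shows "exp_kernel_integral 1 0 \<mu> = of_real (Gamma (- \<mu>))"
proof -
  have "exp_kernel_integral 1 0 \<mu> = (\<integral>t. complex_of_real (exp (- 1 * exp t - \<mu> * t)) \<partial>lborel)"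
    unfolding exp_kernel_integral_def exp_kernel_def by (simp flip: exp_of_real)
  also have "\<dots> = of_real (Gamma (- \<mu>))"
    using integrable_exp_kernel_real_0[of 1 \<mu>] assms by (simp only: integral_complex_of_real) simp
  finally show ?thesis .
qed

section \<open>Integral representation of the modified Bessel function\<close>

text \<open>Coefficientwise this is rGamma (\<mu> + k) = (\<mu> + k) rGamma (\<mu> + k + 1): the
  summand \<mu> gives the first term, and the factor k cancels in the factorial and shifts the
  index.\<close>

lemma Bessel_Clifford_recurrence:
  "Bessel_Clifford (\<mu> - 1) y = \<mu> * Bessel_Clifford \<mu> y + y * Bessel_Clifford (\<mu> + 1) y"
proof -
  let ?f = "\<lambda>k. of_nat k * (rGamma (\<mu> + of_nat k + 1) / fact k * y ^ k) :: complex"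
  have S: "summable (\<lambda>k. rGamma (\<nu> + of_nat k + 1) / fact k * y ^ k)" for \<nu>
    by (rule summable_norm_cancel[OF Bessel_Clifford_summable_norm])
  have Suc: "?f (Suc k) = y * (rGamma (\<mu> + 1 + of_nat k + 1) / fact k * y ^ k)" for k
  proof -
    have "\<mu> + of_nat (Suc k) + 1 = \<mu> + 1 + of_nat k + 1" by simp
    moreover have "of_nat (Suc k) * (r / fact (Suc k) * y ^ Suc k) = y * (r / fact k * y ^ k)" for r :: complex
      using of_nat_neq_0[of k, where ?'a = complex] by (simp add: fact_Suc divide_simps del: of_nat_Suc)
    ultimately show ?thesis by metis
  qed
  have f: "?f sums (y * Bessel_Clifford (\<mu> + 1) y)"
  proof -
    have "(\<lambda>k. ?f (Suc k)) sums (y * Bessel_Clifford (\<mu> + 1) y)"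
      unfolding Suc Bessel_Clifford_def using S by (intro sums_mult summable_sums)
    then show ?thesis by (subst (asm) sums_Suc_iff) simp
  qed
  have "(\<lambda>k. \<mu> * (rGamma (\<mu> + of_nat k + 1) / fact k * y ^ k) + ?f k) sums
      (\<mu> * Bessel_Clifford \<mu> y + y * Bessel_Clifford (\<mu> + 1) y)"
    using S[of \<mu>] by (intro sums_add f sums_mult) (simp add: Bessel_Clifford_def summable_sums)
  also have "(\<lambda>k. \<mu> * (rGamma (\<mu> + of_nat k + 1) / fact k * y ^ k) + ?f k) =
             (\<lambda>k. rGamma (\<mu> - 1 + of_nat k + 1) / fact k * y ^ k)"
  proof
    fix k
    have "rGamma (\<mu> - 1 + of_nat k + 1) = (\<mu> + of_nat k) * rGamma (\<mu> + of_nat k + 1)"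
      by (simp add: rGamma_plus1)
    then show "\<mu> * (rGamma (\<mu> + of_nat k + 1) / fact k * y ^ k) + ?f k =
        rGamma (\<mu> - 1 + of_nat k + 1) / fact k * y ^ k"
      by (simp only:) (simp add: field_simps)
  qed
  finally show ?thesis by (simp add: Bessel_Clifford_def sums_iff)
qed

section \<open>Uniqueness argument for the integral representation\<close>

text \<open>For y > 0 and non-integer order this is y powr (- \<mu> / 2) times 2 K at 2 sqrt y: K in
  the normalisation of \<open>Bessel_Clifford\<close>, to be matched with
  \<open>exp_kernel_integral 1 y \<mu>\<close>.\<close>

definition Clifford_K :: "real \<Rightarrow> complex \<Rightarrow> complex" where
  "Clifford_K \<mu> y = of_real (pi / sin (pi * \<mu>)) *
     (y powr (- of_real \<mu>) * Bessel_Clifford (- of_real \<mu>) y - Bessel_Clifford (of_real \<mu>) y)"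

text \<open>The product rule produces two terms for the first summand, which the recurrence at order
  - \<mu> merges into one of order - \<mu> - 1. The minus sign comes from the sine at the shifted
  order. At integer order both sides are 0, since the prefactor is pi / 0.\<close>

lemma Clifford_K_has_field_derivative:
  assumes y: "y \<notin> \<real>\<^sub>\<le>\<^sub>0"
  shows "(Clifford_K \<mu> has_field_derivative - Clifford_K (\<mu> + 1) y) (at y)"
proof -
  have y0: "y \<noteq> 0" using y by auto
  have s: "sin (pi * (\<mu> + 1)) = - sin (pi * \<mu>)" by (simp add: algebra_simps)
  have "(Clifford_K \<mu> has_field_derivative of_real (pi / sin (pi * \<mu>)) *
     (- of_real \<mu> * y powr (- of_real \<mu> - 1) * Bessel_Clifford (- of_real \<mu>) y
       + Bessel_Clifford (- of_real \<mu> + 1) y * y powr (- of_real \<mu>)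
       - Bessel_Clifford (of_real \<mu> + 1) y)) (at y)"
    unfolding Clifford_K_def using y
    by (intro DERIV_cmult)
       (auto intro!: derivative_eq_intros Bessel_Clifford_has_field_derivative has_field_derivative_powr)
  also have "- of_real \<mu> * y powr (- of_real \<mu> - 1) * Bessel_Clifford (- of_real \<mu>) y
       + Bessel_Clifford (- of_real \<mu> + 1) y * y powr (- of_real \<mu>) =
      y powr (- of_real \<mu> - 1) * Bessel_Clifford (- of_real \<mu> - 1) y"
    unfolding Bessel_Clifford_recurrence[of "- of_real \<mu>"] using y0 by (simp add: powr_diff field_simps)
  also have "of_real (pi / sin (pi * \<mu>)) * (y powr (- of_real \<mu> - 1) * Bessel_Clifford (- of_real \<mu> - 1) y -
      Bessel_Clifford (of_real \<mu> + 1) y) = - Clifford_K (\<mu> + 1) y"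
  proof -
    have "- complex_of_real (\<mu> + 1) = - of_real \<mu> - 1" by simp
    then show ?thesis by (simp only: Clifford_K_def s of_real_add of_real_1) simp
  qed
  finally show ?thesis .
qed

text \<open>Evenness of K in its order, applied to order \<mu> + 1. It rewrites the derivative of a
  function of order \<mu> through the order - \<mu> - 1, which lies in (-1, 0) whenever \<mu> does;
  the pair of orders thus forms a closed system.\<close>

lemma Clifford_K_shift:
  assumes "y > 0"
  shows "Clifford_K (\<mu> + 1) (of_real y) = of_real (y powr (- \<mu> - 1)) * Clifford_K (- \<mu> - 1) (of_real y)"
proof -
  have s: "sin (pi * (\<mu> + 1)) = - sin (pi * \<mu>)" "sin (pi * (- \<mu> - 1)) = sin (pi * \<mu>)"
    using sin_minus[of "pi * (\<mu> + 1)"] by (simp_all add: algebra_simps)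
  have p: "complex_of_real y powr (of_real a) = of_real (y powr a)" for a
    using assms by (simp add: powr_of_real)
  have "y powr (- \<mu> - 1) * y powr (\<mu> + 1) = 1"
    using assms by (simp flip: powr_add)
  then have "complex_of_real (y powr (- \<mu> - 1)) * of_real (y powr (\<mu> + 1)) = 1"
    by (simp flip: of_real_mult)
  moreover have "of_real (pi / - S) * (P * X - Y) = P * (of_real (pi / S) * (Q * Y - X))"
    if PQ: "P * Q = 1" for P Q X Y :: complex and S
  proof -
    define c where "c = complex_of_real (pi / S)"
    have "P * (c * (Q * Y - X)) = c * ((P * Q) * Y - P * X)"
      by (simp add: algebra_simps)
    then have "- c * (P * X - Y) = P * (c * (Q * Y - X))" unfolding PQ by (simp add: algebra_simps)
    then show ?thesis by (simp add: c_def)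
  qed
  moreover have "- complex_of_real (\<mu> + 1) = of_real (- \<mu> - 1)" "- complex_of_real (- \<mu> - 1) = of_real (\<mu> + 1)"
    by simp_all
  ultimately show ?thesis
    unfolding Clifford_K_def s p by (simp only: p)
qed

lemma Clifford_K_continuous_0:
  assumes "\<mu> < 0"
  shows "continuous_on {0..} (\<lambda>y. Clifford_K \<mu> (of_real y))"
proof -
  have "continuous_on {0..} (\<lambda>y. of_real (pi / sin (pi * \<mu>)) * (complex_of_real (y powr (- \<mu>)) *
      Bessel_Clifford (- of_real \<mu>) (of_real y) - Bessel_Clifford (of_real \<mu>) (of_real y)))"
    using assms by (intro continuous_intros continuous_on_powr') auto
  then show ?thesis
    by (rule continuous_on_eq) (auto simp: Clifford_K_def powr_of_real[symmetric])
qed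

text \<open>Only the series of order \<mu> survives at 0 and contributes 1 / Gamma (\<mu> + 1); the
  reflection formula converts it into Gamma (- \<mu>), the value of the integral at 0.\<close>

lemma Clifford_K_0:
  assumes "- 1 < \<mu>" "\<mu> < 0"
  shows "Clifford_K \<mu> 0 = of_real (Gamma (- \<mu>))"
proof -
  have "\<mu> + 1 \<notin> \<int>\<^sub>\<le>\<^sub>0" using assms by (auto elim!: nonpos_Ints_cases)
  have "Gamma (of_real (\<mu> + 1)) * Gamma (1 - of_real (\<mu> + 1)) = of_real pi / sin (of_real pi * complex_of_real (\<mu> + 1))"
    by (rule Gamma_reflection_complex)
  moreover have "sin (of_real pi * complex_of_real (\<mu> + 1)) = of_real (- sin (pi * \<mu>))"
  proof -
    have "sin (of_real pi * complex_of_real (\<mu> + 1)) = of_real (sin (pi * (\<mu> + 1)))"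
      by (simp only: sin_of_real of_real_mult[symmetric])
    then show ?thesis by (simp add: algebra_simps)
  qed
  moreover have "1 - complex_of_real (\<mu> + 1) = of_real (- \<mu>)" by simp
  moreover have nz: "Gamma (complex_of_real (\<mu> + 1)) \<noteq> 0"
    using \<open>\<mu> + 1 \<notin> \<int>\<^sub>\<le>\<^sub>0\<close> by (metis Gamma_eq_zero_iff of_real_in_nonpos_Ints_iff)
  ultimately have "Gamma (complex_of_real (- \<mu>)) * Gamma (of_real (\<mu> + 1)) = - of_real (pi / sin (pi * \<mu>))"
    by (simp add: mult.commute)
  with nz have "Gamma (complex_of_real (- \<mu>)) = - of_real (pi / sin (pi * \<mu>)) / Gamma (of_real (\<mu> + 1))"
    by (metis nonzero_mult_div_cancel_right)
  then have "Gamma (complex_of_real (- \<mu>)) = - of_real (pi / sin (pi * \<mu>)) * rGamma (of_real (\<mu> + 1))"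
    by (simp only: rGamma_inverse_Gamma divide_inverse)
  then show ?thesis
    by (simp add: Clifford_K_def Bessel_Clifford_0_right Gamma_complex_of_real[symmetric])
qed

lemma exp_kernel_integral_shift:
  assumes "y > 0"
  shows "exp_kernel_integral 1 (of_real y) (\<mu> + 1) = of_real (y powr (- \<mu> - 1)) * exp_kernel_integral 1 (of_real y) (- \<mu> - 1)"
proof -
  have "exp_kernel_integral 1 (of_real y) (\<mu> + 1) = exp (- of_real ((\<mu> + 1) * ln y)) *
     exp_kernel_integral (of_real y) 1 (\<mu> + 1)"
    using exp_kernel_integral_translate[of 1 "of_real y" "\<mu> + 1" "ln y"] assms by (simp add: exp_minus)
  also have "exp (- complex_of_real ((\<mu> + 1) * ln y)) = of_real (y powr (- \<mu> - 1))"
    using assms by (simp only: powr_def of_real_minus[symmetric] exp_of_real) (simp add: algebra_simps)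
  finally show ?thesis
    using exp_kernel_integral_reflect[of "of_real y" 1 "\<mu> + 1"] by simp
qed

definition Clifford_diff :: "real \<Rightarrow> real \<Rightarrow> complex" where
  "Clifford_diff \<mu> y = exp_kernel_integral 1 (of_real y) \<mu> - Clifford_K \<mu> (of_real y)"

text \<open>
  Both sides of the representation (orders \<open>\<mu>\<close> and \<open>- \<mu> - 1\<close>) solve the system
  \<open>A' = - y\<^bsup>-\<mu>-1\<^esup> B\<close>, \<open>B' = - y\<^sup>\<mu> A\<close> with the same limits at the singular point \<open>0\<close>; the bound below
  makes the integrated system a contraction on a short interval.
\<close>

lemma Clifford_diff_bound:
  assumes \<mu>: "- 1 < \<mu>" "\<mu> < 0" and y: "0 \<le> y" "y \<le> \<delta>"
    and M: "\<And>s. 0 \<le> s \<Longrightarrow> s \<le> \<delta> \<Longrightarrow> norm (Clifford_diff (- \<mu> - 1) s) \<le> M"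
  shows "norm (Clifford_diff \<mu> y) \<le> M * y powr (- \<mu>) / (- \<mu>)"
proof (cases "y = 0")
  case True
  then show ?thesis using \<mu> by (simp add: Clifford_diff_def exp_kernel_integral_0 Clifford_K_0)
next
  case False
  then have y0: "0 < y" using y by simp
  have cont: "continuous_on {0..y} (Clifford_diff \<mu>)"
    unfolding Clifford_diff_def
    using continuous_on_subset[OF exp_kernel_integral_continuous_right[OF \<mu>(2)]]
      continuous_on_subset[OF Clifford_K_continuous_0[OF \<mu>(2)]]
    by (intro continuous_on_diff) auto
  \<comment> \<open>The bound on the derivative is \<open>M * s powr (- \<mu> - 1)\<close>, singular
    at 0 but integrable because \<mu> < 0. Comparing with its primitive needs derivatives only in
    the open interval.\<close>
  have "norm (Clifford_diff \<mu> y - Clifford_diff \<mu> 0) \<le>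
      M * y powr (- \<mu>) / (- \<mu>) - M * 0 powr (- \<mu>) / (- \<mu>)"
  proof (rule differentiable_bound_general[OF y0 cont])
    show "continuous_on {0..y} (\<lambda>s. M * s powr (- \<mu>) / (- \<mu>))"
      using \<mu> by (intro continuous_intros continuous_on_powr') auto
    fix s assume s: "0 < s" "s < y"
    show "(Clifford_diff \<mu> has_vector_derivative - of_real (s powr (- \<mu> - 1)) * Clifford_diff (- \<mu> - 1) s) (at s)"
    proof -
      have "((\<lambda>y. exp_kernel_integral 1 y \<mu> - Clifford_K \<mu> y) has_field_derivative
          - exp_kernel_integral 1 (of_real s) (\<mu> + 1) - (- Clifford_K (\<mu> + 1) (of_real s))) (at (of_real s))"
        using s by (intro DERIV_diff exp_kernel_integral_derivative_right Clifford_K_has_field_derivative) auto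
      then show ?thesis
        unfolding exp_kernel_integral_shift[OF s(1)] Clifford_K_shift[OF s(1)] Clifford_diff_def
        by (auto dest!: has_vector_derivative_real_field simp: algebra_simps)
    qed
    show "((\<lambda>s. M * s powr (- \<mu>) / (- \<mu>)) has_vector_derivative M * s powr (- \<mu> - 1)) (at s)"
      using s \<mu> by (auto intro!: derivative_eq_intros simp flip: has_real_derivative_iff_has_vector_derivative)
    show "norm (- of_real (s powr (- \<mu> - 1)) * Clifford_diff (- \<mu> - 1) s) \<le> M * s powr (- \<mu> - 1)"
      using M[of s] s y by (simp add: norm_mult mult.commute mult_right_mono)
  qed
  then show ?thesis using \<mu> by (simp add: Clifford_diff_def exp_kernel_integral_0 Clifford_K_0)
qed

lemma Clifford_diff_0:
  assumes \<mu>: "- 1 < \<mu>" "\<mu> < 0"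
  obtains \<delta> where "\<delta> > 0" "\<And>y. 0 \<le> y \<Longrightarrow> y \<le> \<delta> \<Longrightarrow> Clifford_diff \<mu> y = 0"
proof -
  define \<beta> where "\<beta> = - \<mu> - 1"
  have \<beta>: "- 1 < \<beta>" "\<beta> < 0" "- \<beta> - 1 = \<mu>" using \<mu> by (auto simp: \<beta>_def)
  \<comment> \<open>The exponents - \<mu> and - \<beta> add up to 1, so applying the bound twice
    multiplies the maximum by \<delta> / (\<mu> \<beta>). This choice makes the factor 1/2.\<close>
  define \<delta> where "\<delta> = \<mu> * \<beta> / 2"
  have \<delta>: "\<delta> > 0" using \<mu> \<beta> by (simp add: \<delta>_def mult_neg_neg)
  have cont: "continuous_on {0..\<delta>} (\<lambda>y. norm (Clifford_diff \<nu> y))" if "\<nu> < 0" for \<nu>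
    unfolding Clifford_diff_def
    using continuous_on_subset[OF exp_kernel_integral_continuous_right[OF that]]
      continuous_on_subset[OF Clifford_K_continuous_0[OF that]]
    by (intro continuous_on_norm continuous_on_diff) auto
  obtain a where a: "a \<in> {0..\<delta>}" "\<And>y. y \<in> {0..\<delta>} \<Longrightarrow> norm (Clifford_diff \<mu> y) \<le> norm (Clifford_diff \<mu> a)"
    using continuous_attains_sup[OF compact_Icc _ cont[OF \<mu>(2)]] \<delta> by fastforce
  obtain b where b: "b \<in> {0..\<delta>}" "\<And>y. y \<in> {0..\<delta>} \<Longrightarrow> norm (Clifford_diff \<beta> y) \<le> norm (Clifford_diff \<beta> b)"
    using continuous_attains_sup[OF compact_Icc _ cont[OF \<beta>(2)]] \<delta> by fastforce
  define A B where "A = norm (Clifford_diff \<mu> a)" and "B = norm (Clifford_diff \<beta> b)"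
  have AB: "A \<ge> 0" "B \<ge> 0" by (auto simp: A_def B_def)
  have "A \<le> B * a powr (- \<mu>) / (- \<mu>)"
    unfolding A_def B_def by (rule Clifford_diff_bound[OF \<mu>]) (use a b in \<open>auto simp: \<beta>_def\<close>)
  also have "\<dots> \<le> B * \<delta> powr (- \<mu>) / (- \<mu>)"
    using a \<mu> AB by (intro divide_right_mono mult_left_mono powr_mono2) auto
  finally have 1: "A \<le> B * \<delta> powr (- \<mu>) / (- \<mu>)" .
  have "B \<le> A * b powr (- \<beta>) / (- \<beta>)"
    unfolding A_def B_def by (rule Clifford_diff_bound[OF \<beta>(1,2)]) (use a b \<beta> in auto)
  also have "\<dots> \<le> A * \<delta> powr (- \<beta>) / (- \<beta>)"
    using b \<beta> AB by (intro divide_right_mono mult_left_mono powr_mono2) auto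
  finally have 2: "B \<le> A * \<delta> powr (- \<beta>) / (- \<beta>)" .
  have "A \<le> (A * \<delta> powr (- \<beta>) / (- \<beta>)) * \<delta> powr (- \<mu>) / (- \<mu>)"
    by (rule order_trans[OF 1], intro divide_right_mono mult_right_mono 2) (use \<mu> in auto)
  also have "\<dots> = A * (\<delta> powr (- \<beta>) * \<delta> powr (- \<mu>)) / (\<mu> * \<beta>)"
    by (simp add: mult_ac)
  also have "\<delta> powr (- \<beta>) * \<delta> powr (- \<mu>) = \<delta>"
    using \<delta> by (simp add: powr_add[symmetric] \<beta>_def)
  also have "A * \<delta> / (\<mu> * \<beta>) = A / 2"
    using \<mu> \<beta> by (simp add: \<delta>_def)
  finally have "A = 0" using AB by simp
  then show ?thesis using that[OF \<delta>] a(2) by (force simp: A_def)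
qed

text \<open>On the strip (-1, 0) agreement near 0 spreads by the identity theorem. Both sides change
  sign and gain one in the order under differentiation, so agreement at one order implies it at the
  next.\<close>

theorem Clifford_K_eq_integral:
  assumes \<mu>: "\<mu> > - 1" "\<mu> \<notin> \<int>" and y: "Re y > 0"
  shows "Clifford_K \<mu> y = exp_kernel_integral 1 y \<mu>"
proof -
  define A where "A = {y::complex. Re y > 0}"
  have A: "open A" "connected A"
    unfolding A_def by (rule open_connected_right_half_plane)+
  have slit: "y \<notin> \<real>\<^sub>\<le>\<^sub>0" if "y \<in> A" for y using that by (auto simp: A_def complex_nonpos_Reals_iff)
  have H1: "Clifford_K \<mu> holomorphic_on A" for \<mu>
    using Clifford_K_has_field_derivative slit A(1) by (metis holomorphic_on_open)
  have H2: "(\<lambda>y. exp_kernel_integral 1 y \<mu>) holomorphic_on A" for \<mu>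
    by (rule exp_kernel_integral_holomorphic) (use A in \<open>auto simp: A_def intro!: holomorphic_intros\<close>)
  have base: "Clifford_K \<mu> y = exp_kernel_integral 1 y \<mu>" if \<mu>: "- 1 < \<mu>" "\<mu> < 0" and y: "y \<in> A" for \<mu> y
  proof -
    obtain \<delta> where \<delta>: "\<delta> > 0" "\<And>y. 0 \<le> y \<Longrightarrow> y \<le> \<delta> \<Longrightarrow> Clifford_diff \<mu> y = 0"
      using Clifford_diff_0[OF \<mu>] by blast
    show ?thesis
      by (rule holomorphic_eq_on_real_interval[OF H1 H2 A \<delta>(1)])
         (use \<delta> y in \<open>auto simp: A_def Clifford_diff_def\<close>)
  qed
  have "Clifford_K \<mu> y = exp_kernel_integral 1 y \<mu>"
    if "real n - 1 < \<mu>" "\<mu> < real n" "y \<in> A" for n \<mu> y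
    using that
  proof (induction n arbitrary: \<mu> y)
    case (Suc n)
    have "Clifford_K (\<mu> - 1) u = exp_kernel_integral 1 u (\<mu> - 1)" if "u \<in> A" for u
      using Suc that by (intro Suc.IH) auto
    then have "((\<lambda>y. exp_kernel_integral 1 y (\<mu> - 1)) has_field_derivative - Clifford_K (\<mu> - 1 + 1) y) (at y)"
      by (rule has_field_derivative_transform_within_open
          [OF Clifford_K_has_field_derivative[OF slit[OF Suc.prems(3)]] A(1) Suc.prems(3)])
    moreover have "((\<lambda>y. exp_kernel_integral 1 y (\<mu> - 1)) has_field_derivative - exp_kernel_integral 1 y (\<mu> - 1 + 1)) (at y)"
      using Suc.prems by (intro exp_kernel_integral_derivative_right) (auto simp: A_def)
    ultimately show ?case using DERIV_unique by fastforce
  qed (use base in auto)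
  moreover have "\<exists>n. real n - 1 < \<mu> \<and> \<mu> < real n"
  proof (intro exI conjI)
    \<comment> \<open>The ceiling is the number of differentiations: the induction runs over n with
      n - 1 < \<mu> < n, and the order is not an integer.\<close>
    have "\<mu> \<noteq> of_int \<lceil>\<mu>\<rceil>" using \<mu> by (metis Ints_of_int)
    moreover have "\<lceil>\<mu>\<rceil> \<ge> 0" using \<mu> by linarith
    ultimately show "real (nat \<lceil>\<mu>\<rceil>) - 1 < \<mu>" "\<mu> < real (nat \<lceil>\<mu>\<rceil>)" by linarith+
  qed
  ultimately show ?thesis using y by (auto simp: A_def)
qed

section \<open>From the Clifford normalisation to K, for all real orders\<close>

definition K_quotient :: "real \<Rightarrow> complex \<Rightarrow> complex" where
  "K_quotient \<mu> z = of_real (pi / 2) * (Bessel_I (- \<mu>) z - Bessel_I \<mu> z) / of_real (sin (\<mu> * pi))"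

lemma Bessel_K_conv_quotient: "Bessel_K \<nu> z = (if \<nu> \<notin> \<int> then K_quotient \<nu> z else Lim (at \<nu>) (\<lambda>\<mu>. K_quotient \<mu> z))"
  by (simp add: Bessel_K_def K_quotient_def Let_def)

lemma K_quotient_minus: "K_quotient (- \<mu>) z = K_quotient \<mu> z"
proof -
  have "c * (a - b) / (- s) = c * (b - a) / s" for a b c s :: complex
    by (simp add: algebra_simps diff_divide_distrib)
  then show ?thesis by (simp only: K_quotient_def minus_minus mult_minus_left sin_minus of_real_minus)
qed

lemma Bessel_I_holomorphic: "Bessel_I \<nu> holomorphic_on (- \<real>\<^sub>\<le>\<^sub>0)"
proof -
  have "z / 2 \<notin> \<real>\<^sub>\<le>\<^sub>0" if "z \<in> - \<real>\<^sub>\<le>\<^sub>0" for z :: complex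
    using that by (auto simp: complex_nonpos_Reals_iff)
  then show ?thesis unfolding Bessel_I_Clifford[abs_def] by (intro holomorphic_intros) auto
qed

lemma K_quotient_holomorphic:
  assumes "\<mu> \<notin> \<int>"
  shows "K_quotient \<mu> holomorphic_on (- \<real>\<^sub>\<le>\<^sub>0)"
proof -
  have "sin (\<mu> * pi) \<noteq> 0" using assms by (metis sin_zero_iff_int2 Ints_of_int mult_cancel_right pi_neq_zero)
  then show ?thesis unfolding K_quotient_def[abs_def] by (intro holomorphic_intros Bessel_I_holomorphic) auto
qed

text \<open>The previous representation requires Re y > 0, which for y = (w / 2)^2 holds only in a
  quarter-plane sector. Hence positive real w come first, with orders at most -1 reached by
  evenness, and the identity theorem extends to the half-plane.\<close>

lemma K_quotient_eq_integral:
  assumes \<mu>: "\<mu> \<notin> \<int>" and w: "Re w > 0"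
  shows "K_quotient \<mu> w = exp_kernel_integral (w / 2) (w / 2) \<mu> / 2"
proof -
  define A where "A = {y::complex. Re y > 0}"
  have A: "open A" "connected A"
    unfolding A_def by (rule open_connected_right_half_plane)+
  have real: "K_quotient \<mu> (of_real x) = exp_kernel_integral (of_real x / 2) (of_real x / 2) \<mu> / 2"
    if \<mu>: "\<mu> > - 1" "\<mu> \<notin> \<int>" and x: "x > 0" for \<mu> x
  proof -
    define y where "y = (complex_of_real x / 2)\<^sup>2"
    have y: "y = of_real ((x / 2)\<^sup>2)" by (simp add: y_def)
    have p: "(complex_of_real x / 2) powr (of_real a) = of_real ((x / 2) powr a)" for a
      using x powr_of_real[of "x / 2" a] by simp
    have q: "y powr (of_real a) = of_real ((x / 2) powr (2 * a))" for a
      unfolding y using x powr_of_real[of "(x / 2)\<^sup>2" a] by (simp add: powr_mult powr_powr flip: powr_numeral)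
    have "exp_kernel_integral 1 y \<mu> = exp (- of_real (\<mu> * ln (x / 2))) * exp_kernel_integral (of_real x / 2) (of_real x / 2) \<mu>"
      using exp_kernel_integral_translate[of 1 y \<mu> "ln (x / 2)"] x
      by (simp add: exp_minus y_def power2_eq_square field_simps)
    also have "exp (- complex_of_real (\<mu> * ln (x / 2))) = of_real ((x / 2) powr (- \<mu>))"
      using x by (simp add: powr_def flip: exp_of_real)
    finally have "of_real ((x / 2) powr \<mu>) * exp_kernel_integral 1 y \<mu> =
        of_real ((x / 2) powr \<mu> * (x / 2) powr (- \<mu>)) * exp_kernel_integral (of_real x / 2) (of_real x / 2) \<mu>"
      by simp
    also have "(x / 2) powr \<mu> * (x / 2) powr (- \<mu>) = 1"
      using x by (simp flip: powr_add)
    finally have 1: "of_real ((x / 2) powr \<mu>) * exp_kernel_integral 1 y \<mu> = exp_kernel_integral (of_real x / 2) (of_real x / 2) \<mu>"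
      by simp
    have "exp_kernel_integral 1 y \<mu> = Clifford_K \<mu> y"
      using Clifford_K_eq_integral[OF \<mu>, of y] x by (simp add: y)
    also have "of_real ((x / 2) powr \<mu>) * Clifford_K \<mu> y = 2 * K_quotient \<mu> (of_real x)"
    proof -
      have "(x / 2) powr \<mu> * (x / 2) powr (2 * - \<mu>) = (x / 2) powr (- \<mu>)"
        using x by (simp flip: powr_add)
      then have "complex_of_real ((x / 2) powr \<mu>) * of_real ((x / 2) powr (2 * - \<mu>)) = of_real ((x / 2) powr (- \<mu>))"
        by (metis of_real_mult)
      then show ?thesis
        using p[of \<mu>] p[of "-\<mu>"] q[of "-\<mu>"]
        unfolding Clifford_K_def K_quotient_def Bessel_I_Clifford y_def[symmetric]
        by (simp add: algebra_simps diff_divide_distrib)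
    qed
    ultimately show ?thesis using 1 by (simp add: mult.commute)
  qed
  have real': "K_quotient \<mu> (of_real x) = exp_kernel_integral (of_real x / 2) (of_real x / 2) \<mu> / 2" if "x > 0" for x
  proof (cases "\<mu> > - 1")
    case True
    then show ?thesis using real[OF _ \<mu> that] by simp
  next
    case False
    then have "K_quotient (- \<mu>) (of_real x) = exp_kernel_integral (of_real x / 2) (of_real x / 2) (- \<mu>) / 2"
      using \<mu> that by (intro real) auto
    then show ?thesis
      using exp_kernel_integral_reflect[of "of_real x / 2" "of_real x / 2" \<mu>] by (simp add: K_quotient_minus)
  qed
  have H1: "K_quotient \<mu> holomorphic_on A"
    by (rule holomorphic_on_subset[OF K_quotient_holomorphic[OF \<mu>]]) (auto simp: A_def complex_nonpos_Reals_iff)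
  have H2: "(\<lambda>w. exp_kernel_integral (w / 2) (w / 2) \<mu> / 2) holomorphic_on A"
    by (intro holomorphic_intros exp_kernel_integral_holomorphic) (use A in \<open>auto simp: A_def\<close>)
  show ?thesis
    by (rule holomorphic_eq_on_real_interval[OF H1 H2 A zero_less_one]) (use w real' in \<open>auto simp: A_def\<close>)
qed

lemma eventually_at_not_Ints: "\<forall>\<^sub>F \<mu> in at (\<nu>::real). \<mu> \<notin> \<int>"
proof -
  have "\<not> \<nu> islimpt \<int>"
    by (rule discrete_imp_not_islimpt[OF zero_less_one]) (auto elim!: Ints_cases simp: dist_real_def)
  then show ?thesis by (simp add: islimpt_iff_eventually)
qed

text \<open>The integral is continuous in the order, so at an integer it equals the limit of the
  non-integer quotients, which is how K is defined there.\<close>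

theorem Bessel_K_eq_integral:
  assumes w: "Re w > 0"
  shows "Bessel_K \<nu> w = exp_kernel_integral (w / 2) (w / 2) \<nu> / 2"
proof (cases "\<nu> \<in> \<int>")
  case True
  have "((\<lambda>\<mu>. exp_kernel_integral (w / 2) (w / 2) \<mu> / 2) \<longlongrightarrow> exp_kernel_integral (w / 2) (w / 2) \<nu> / 2) (at \<nu>)"
    using exp_kernel_integral_continuous_order[of "w / 2" "w / 2" \<nu>] w
    by (intro tendsto_intros) (auto simp: isCont_def)
  then have "((\<lambda>\<mu>. K_quotient \<mu> w) \<longlongrightarrow> exp_kernel_integral (w / 2) (w / 2) \<nu> / 2) (at \<nu>)"
    by (rule tendsto_cong[THEN iffD1, rotated])
       (use eventually_at_not_Ints[of \<nu>] in eventually_elim, simp add: K_quotient_eq_integral w)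
  then show ?thesis using True by (simp add: Bessel_K_conv_quotient tendsto_Lim)
next
  case False
  then show ?thesis using K_quotient_eq_integral[OF False w] by (simp add: Bessel_K_conv_quotient)
qed

section \<open>Holomorphy of the modified Bessel function, including integer order\<close>

text \<open>At integer order K is built from derivatives of I in the order, and these must be
  holomorphic in the argument on the whole slit plane. The series is treated as an integral over
  counting measure, so the theorem on parameter integrals covers both claims.\<close>

lemma Bessel_Clifford_order_derivative:
  obtains D where
    "\<And>y. ((\<lambda>\<mu>. Bessel_Clifford \<mu> y) has_field_derivative D y) (at \<mu>)" "D holomorphic_on UNIV"
proof -
  define d where "d k = deriv rGamma (\<mu> + of_nat k + 1)" for k :: nat
  \<comment> \<open>Radius \<open>norm \<mu> + 1\<close> makes the bound valid on unit discs about
    the order, where Cauchy's inequality bounds the differentiated coefficients by the same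
    constant.\<close>
  obtain C where C: "C > 0" "\<And>\<mu>' k. norm \<mu>' \<le> norm \<mu> + 1 \<Longrightarrow> norm (rGamma (\<mu>' + of_nat k + 1) :: complex) \<le> C"
    using rGamma_shift_bounded by blast
  have C': "norm (rGamma (w + of_nat k + 1)) \<le> C" if "norm (w - \<mu>) \<le> 1" for w k
    using that norm_triangle_ineq2[of w \<mu>] by (intro C(2)) auto
  have d: "norm (d k) \<le> C" for k
  proof -
    have "norm ((deriv ^^ 1) rGamma (\<mu> + of_nat k + 1)) \<le> fact 1 * C / 1 ^ 1"
    proof (rule Cauchy_inequality)
      show "norm (rGamma x) \<le> C" if "norm (\<mu> + of_nat k + 1 - x) = 1" for x
        using C'[of "x - of_nat k - 1" k] that by (simp add: norm_minus_commute algebra_simps)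
    qed (auto intro!: holomorphic_intros continuous_intros)
    then show ?thesis by (simp add: d_def)
  qed
  have summ: "integrable (count_space UNIV) (\<lambda>k. C * (r ^ k /\<^sub>R fact k))" for r :: real
    using summable_exp_generic[of "\<bar>r\<bar>"] by (simp add: integrable_count_space_nat_iff abs_mult power_abs)
  define D where "D y = (\<integral>k. d k / fact k * y ^ k \<partial>count_space UNIV)" for y
  have "((\<lambda>\<mu>. Bessel_Clifford \<mu> y) has_field_derivative D y) (at \<mu>)" for y
  proof -
    have int: "integrable (count_space UNIV) (\<lambda>k. rGamma (\<mu> + of_nat k + 1) / fact k * y ^ k)" for \<mu>
      using Bessel_Clifford_summable_norm by (simp add: integrable_count_space_nat_iff)
    have "((\<lambda>\<mu>. \<integral>k. rGamma (\<mu> + of_nat k + 1) / fact k * y ^ k \<partial>count_space UNIV) has_field_derivative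
        (\<integral>k. deriv (\<lambda>\<mu>. rGamma (\<mu> + of_nat k + 1) / fact k * y ^ k) \<mu> \<partial>count_space UNIV)) (at \<mu>)"
    proof (rule has_field_derivative_integral[where A = "ball \<mu> 1"])
      fix z assume z: "z \<in> ball \<mu> 1"
      have "norm (rGamma (w + of_nat k + 1) / fact k * y ^ k) \<le> C * (norm y ^ k /\<^sub>R fact k)" if "w \<in> ball \<mu> 1" for w k
        using C'[of w k] that
        by (auto simp: norm_mult norm_divide norm_power divide_simps dist_norm norm_minus_commute intro!: mult_right_mono)
      then show "\<exists>r>0. \<exists>h. integrable (count_space UNIV) h \<and> (\<forall>w\<in>ball z r \<inter> ball \<mu> 1. \<forall>k\<in>space (count_space UNIV).
          norm (rGamma (w + of_nat k + 1) / fact k * y ^ k) \<le> h k)"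
        using summ[of "norm y"] by (intro exI[of _ 1] conjI exI[of _ "\<lambda>k. C * (norm y ^ k /\<^sub>R fact k)"]) auto
    qed (auto intro!: holomorphic_intros)
    also have "(\<lambda>k. deriv (\<lambda>\<mu>. rGamma (\<mu> + of_nat k + 1) / fact k * y ^ k) \<mu>) = (\<lambda>k. d k / fact k * y ^ k)"
    proof
      fix k
      have "(rGamma has_field_derivative d k) (at (\<mu> + of_nat k + 1))"
        unfolding d_def by (rule holomorphic_derivI[of _ UNIV]) (auto intro!: holomorphic_intros)
      then have "((\<lambda>\<mu>. rGamma (\<mu> + of_nat k + 1)) has_field_derivative d k) (at \<mu>)"
        using DERIV_shift[of rGamma "d k" \<mu> "of_nat k + 1"] by (simp add: add.assoc)
      then have "((\<lambda>\<mu>. rGamma (\<mu> + of_nat k + 1) / fact k * y ^ k) has_field_derivative d k / fact k * y ^ k) (at \<mu>)"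
        by (intro DERIV_cmult_right DERIV_cdivide)
      then show "deriv (\<lambda>\<mu>. rGamma (\<mu> + of_nat k + 1) / fact k * y ^ k) \<mu> = d k / fact k * y ^ k"
        by (rule DERIV_imp_deriv)
    qed
    also have "(\<lambda>\<mu>. \<integral>k. rGamma (\<mu> + of_nat k + 1) / fact k * y ^ k \<partial>count_space UNIV) = (\<lambda>\<mu>. Bessel_Clifford \<mu> y)"
      unfolding Bessel_Clifford_def using integral_count_space_nat[OF int] by simp
    finally show ?thesis by (simp add: D_def)
  qed
  moreover have "D holomorphic_on UNIV"
    unfolding D_def
  proof (rule holomorphic_integral)
    fix z :: complex
    have "norm (d k / fact k * w ^ k) \<le> C * ((norm z + 1) ^ k /\<^sub>R fact k)" if "w \<in> ball z 1" for w k
    proof -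
      have "norm w \<le> norm z + 1"
        using that norm_triangle_ineq2[of w z] by (auto simp: dist_norm norm_minus_commute)
      then have "norm (d k) * norm w ^ k \<le> C * (norm z + 1) ^ k"
        using d[of k] C(1) by (intro mult_mono power_mono) auto
      then show ?thesis by (simp add: norm_mult norm_divide norm_power divide_simps)
    qed
    then show "\<exists>r>0. \<exists>h. integrable (count_space UNIV) h \<and> (\<forall>w\<in>ball z r \<inter> UNIV. \<forall>k\<in>space (count_space UNIV).
          norm (d k / fact k * w ^ k) \<le> h k)"
      using summ[of "norm z + 1"] by (intro exI[of _ 1] conjI exI[of _ "\<lambda>k. C * ((norm z + 1) ^ k /\<^sub>R fact k)"]) auto
  qed (auto intro!: holomorphic_intros)
  ultimately show ?thesis using that by blast
qed

lemma Bessel_I_minus_Ints: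
  assumes "\<nu> \<in> \<int>" "z \<noteq> 0"
  shows "Bessel_I (- \<nu>) z = Bessel_I \<nu> z"
proof -
  have nat: "Bessel_I (- real n) z = Bessel_I (real n) z" for n
  proof -
    have "u powr (- of_nat n) * (u\<^sup>2) ^ n = u powr (of_nat n)" if "u \<noteq> 0" for u :: complex
      using that by (simp add: powr_minus powr_nat power2_eq_square power_mult_distrib field_simps)
    from this[of "z / 2"] have "(z / 2) powr (- of_nat n) * ((z / 2)\<^sup>2) ^ n = (z / 2) powr (of_nat n)"
      using assms(2) by simp
    then show ?thesis
      by (simp add: Bessel_I_Clifford Bessel_Clifford_minus_nat mult.assoc[symmetric])
  qed
  obtain k where k: "\<nu> = of_int k" using assms(1) by (elim Ints_cases)
  show ?thesis
  proof (cases "k \<ge> 0")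
    case True
    then have "\<nu> = real (nat k)" using k by simp
    then show ?thesis using nat by simp
  next
    case False
    then have "- \<nu> = real (nat (- k))" using k by simp
    then show ?thesis using nat[of "nat (-k)"] by (metis minus_minus)
  qed
qed

lemma Bessel_I_order_derivative:
  obtains D where "\<And>z. z \<noteq> 0 \<Longrightarrow> ((\<lambda>\<mu>. (Bessel_I \<mu> z - Bessel_I \<nu> z) / of_real (\<mu> - \<nu>)) \<longlongrightarrow> D z) (at \<nu>)"
    "D holomorphic_on (- \<real>\<^sub>\<le>\<^sub>0)"
proof -
  obtain E where E: "\<And>y. ((\<lambda>\<mu>. Bessel_Clifford \<mu> y) has_field_derivative E y) (at (of_real \<nu>))" "E holomorphic_on UNIV"
    using Bessel_Clifford_order_derivative by blast
  define D where "D z = (z / 2) powr (of_real \<nu>) * Ln (z / 2) * Bessel_Clifford (of_real \<nu>) ((z / 2)\<^sup>2) +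
    E ((z / 2)\<^sup>2) * (z / 2) powr (of_real \<nu>)" for z
  have "((\<lambda>\<mu>. (Bessel_I \<mu> z - Bessel_I \<nu> z) / of_real (\<mu> - \<nu>)) \<longlongrightarrow> D z) (at \<nu>)" if z: "z \<noteq> 0" for z
  proof -
    have "((\<lambda>\<mu>. (z / 2) powr \<mu>) has_field_derivative (z / 2) powr (of_real \<nu>) * Ln (z / 2)) (at (of_real \<nu>))"
      using z by (auto simp: powr_def intro!: derivative_eq_intros)
    from DERIV_mult[OF this E(1)[of "(z / 2)\<^sup>2"]]
    have lim: "((\<lambda>\<mu>. ((z / 2) powr \<mu> * Bessel_Clifford \<mu> ((z / 2)\<^sup>2) -
        (z / 2) powr (of_real \<nu>) * Bessel_Clifford (of_real \<nu>) ((z / 2)\<^sup>2)) / (\<mu> - of_real \<nu>)) \<longlongrightarrow> D z) (at (of_real \<nu>))"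
      by (simp add: has_field_derivative_iff D_def)
    have "filterlim complex_of_real (at (of_real \<nu>)) (at \<nu>)"
      by (auto simp: filterlim_at eventually_at_filter intro!: tendsto_intros)
    from filterlim_compose[OF lim this] show ?thesis by (simp add: Bessel_I_Clifford)
  qed
  moreover have "(\<lambda>z. E ((z / 2)\<^sup>2)) holomorphic_on (- \<real>\<^sub>\<le>\<^sub>0)"
  proof -
    have "(\<lambda>z::complex. (z / 2)\<^sup>2) holomorphic_on (- \<real>\<^sub>\<le>\<^sub>0)" by (intro holomorphic_intros) auto
    from holomorphic_on_compose_gen[OF this E(2)] show ?thesis by (simp add: o_def)
  qed
  then have "D holomorphic_on (- \<real>\<^sub>\<le>\<^sub>0)"
    unfolding D_def by (intro holomorphic_intros) (auto simp: complex_nonpos_Reals_iff)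
  ultimately show ?thesis using that by blast
qed

text \<open>At integer order numerator and sine both vanish. Dividing each by the increment of the
  order, as in l'Hospital's rule, leaves a combination of two holomorphic order derivatives over a
  nonzero constant.\<close>

theorem Bessel_K_holomorphic: "Bessel_K \<nu> holomorphic_on (- \<real>\<^sub>\<le>\<^sub>0)"
proof (cases "\<nu> \<in> \<int>")
  case False
  then show ?thesis using K_quotient_holomorphic[OF False] by (simp add: Bessel_K_conv_quotient[abs_def])
next
  case True
  obtain D1 where D1: "\<And>z. z \<noteq> 0 \<Longrightarrow> ((\<lambda>\<mu>. (Bessel_I \<mu> z - Bessel_I \<nu> z) / of_real (\<mu> - \<nu>)) \<longlongrightarrow> D1 z) (at \<nu>)"
      "D1 holomorphic_on (- \<real>\<^sub>\<le>\<^sub>0)"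
    using Bessel_I_order_derivative by blast
  obtain D2 where D2: "\<And>z. z \<noteq> 0 \<Longrightarrow> ((\<lambda>\<mu>. (Bessel_I \<mu> z - Bessel_I (- \<nu>) z) / of_real (\<mu> - - \<nu>)) \<longlongrightarrow> D2 z) (at (- \<nu>))"
      "D2 holomorphic_on (- \<real>\<^sub>\<le>\<^sub>0)"
    using Bessel_I_order_derivative by blast
  define c where "c = cos (\<nu> * pi) * pi"
  have sin0: "sin (\<nu> * pi) = 0" using True by (metis sin_zero_iff_int2 Ints_cases)
  then have c: "c \<noteq> 0" using sin_cos_squared_add[of "\<nu> * pi"] by (auto simp: c_def)
  have "Bessel_K \<nu> z = of_real (pi / 2) * (- D2 z - D1 z) / of_real c" if z: "z \<in> - \<real>\<^sub>\<le>\<^sub>0" for z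
  proof -
    have z0: "z \<noteq> 0" using z by auto
    \<comment> \<open>Since both functions have the same value at \<nu>, the numerator of the
      quotient splits into two increments, one at - \<nu> and one at \<nu>.\<close>
    have I: "Bessel_I (- \<nu>) z = Bessel_I \<nu> z" by (rule Bessel_I_minus_Ints[OF True z0])
    have "filterlim uminus (at (- \<nu>)) (at \<nu>)"
      by (auto simp: filterlim_at eventually_at_filter intro!: tendsto_intros)
    from filterlim_compose[OF D2(1)[OF z0] this]
    have 1: "((\<lambda>\<mu>. (Bessel_I (- \<mu>) z - Bessel_I (- \<nu>) z) / of_real (- \<mu> - - \<nu>)) \<longlongrightarrow> D2 z) (at \<nu>)" .
    have "((\<lambda>\<mu>. sin (\<mu> * pi)) has_real_derivative c) (at \<nu>)"
      unfolding c_def by (auto intro!: derivative_eq_intros)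
    then have 2: "((\<lambda>\<mu>. sin (\<mu> * pi) / (\<mu> - \<nu>)) \<longlongrightarrow> c) (at \<nu>)"
      using sin0 by (simp add: has_field_derivative_iff)
    have "((\<lambda>\<mu>. of_real (pi / 2) * (- ((Bessel_I (- \<mu>) z - Bessel_I (- \<nu>) z) / of_real (- \<mu> - - \<nu>)) -
        (Bessel_I \<mu> z - Bessel_I \<nu> z) / of_real (\<mu> - \<nu>)) / of_real (sin (\<mu> * pi) / (\<mu> - \<nu>))) \<longlongrightarrow>
       of_real (pi / 2) * (- D2 z - D1 z) / of_real c) (at \<nu>)"
      using c by (intro tendsto_intros 1 2 D1(1)[OF z0]) auto
    then have "((\<lambda>\<mu>. K_quotient \<mu> z) \<longlongrightarrow> of_real (pi / 2) * (- D2 z - D1 z) / of_real c) (at \<nu>)"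
    proof (rule Lim_transform_eventually)
      have alg: "C * (- ((A - I) / (- m)) - (B - I) / m) / (S / m) = C * (A - B) / S"
        if "m \<noteq> 0" for A B C I S m :: complex
        using that by (simp add: divide_simps)
      have "\<forall>\<^sub>F \<mu> in at \<nu>. \<mu> \<noteq> \<nu>" by (simp add: eventually_at_filter)
      then show "\<forall>\<^sub>F \<mu> in at \<nu>. of_real (pi / 2) * (- ((Bessel_I (- \<mu>) z - Bessel_I (- \<nu>) z) / of_real (- \<mu> - - \<nu>)) -
        (Bessel_I \<mu> z - Bessel_I \<nu> z) / of_real (\<mu> - \<nu>)) / of_real (sin (\<mu> * pi) / (\<mu> - \<nu>)) = K_quotient \<mu> z"
      proof eventually_elim
        case (elim \<mu>)
        then have "complex_of_real (\<mu> - \<nu>) \<noteq> 0" by simp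
        from alg[OF this, of "of_real (pi / 2)" "Bessel_I (- \<mu>) z" "Bessel_I \<nu> z" "Bessel_I \<mu> z" "of_real (sin (\<mu> * pi))"]
        show ?case by (simp add: I K_quotient_def)
      qed
    qed
    then show ?thesis using True by (simp add: Bessel_K_conv_quotient tendsto_Lim)
  qed
  moreover have "(\<lambda>z. of_real (pi / 2) * (- D2 z - D1 z) / of_real c) holomorphic_on (- \<real>\<^sub>\<le>\<^sub>0)"
    using c by (intro holomorphic_intros D1 D2) auto
  ultimately show ?thesis using holomorphic_cong by (metis (mono_tags, lifting))
qed

section \<open>Poisson integral and its consequences\<close>

lemma Gamma_half_nat: "Gamma (real k + 1 / 2) = fact (2 * k) * sqrt pi / (4 ^ k * fact k)"
proof (induction k)
  case 0
  then show ?case using Gamma_one_half_real by simp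
next
  case (Suc k)
  have "real k + 1 / 2 \<notin> \<int>\<^sub>\<le>\<^sub>0" by (auto elim!: nonpos_Ints_cases)
  have r: "Gamma (real (Suc k) + 1 / 2) = (real k + 1 / 2) * Gamma (real k + 1 / 2)"
    using Gamma_plus1[of "real k + 1 / 2"] \<open>real k + 1 / 2 \<notin> \<int>\<^sub>\<le>\<^sub>0\<close> by (simp add: add_ac)
  have "fact (2 * Suc k) = (2 * real k + 2) * (2 * real k + 1) * fact (2 * k)"
    by (simp add: fact_Suc algebra_simps)
  then show ?case unfolding r Suc.IH by (simp add: divide_simps) (simp add: algebra_simps)
qed

abbreviation unit_interval :: "real measure" where
  "unit_interval \<equiv> restrict_space lborel {0<..<1}"

lemmas integral_unit_interval = absolutely_integrable_restrict_lborel[OF borel_open[OF open_greaterThanLessThan]]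

text \<open>The substitution s = t^2 turns the moment into half a Beta integral; \<nu> > -1/2 is the
  convergence condition at t = 1.\<close>

lemma Poisson_moment:
  assumes \<nu>: "\<nu> > - 1 / 2"
  shows "integrable unit_interval (\<lambda>t. t ^ (2 * k) * (1 - t\<^sup>2) powr (\<nu> - 1 / 2))"
    and "(\<integral>t. t ^ (2 * k) * (1 - t\<^sup>2) powr (\<nu> - 1 / 2) \<partial>unit_interval) = Beta (real k + 1 / 2) (\<nu> + 1 / 2) / 2"
proof -
  define f where "f s = s powr (real k + 1 / 2 - 1) * (1 - s) powr (\<nu> + 1 / 2 - 1)" for s :: real
  have fint: "(f has_integral Beta (real k + 1 / 2) (\<nu> + 1 / 2)) {0<..<1}"
    using has_integral_Beta_real[of "real k + 1 / 2" "\<nu> + 1 / 2"] \<nu> unfolding f_def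
    by (simp add: has_integral_Icc_iff_Ioo)
  have fabs: "f absolutely_integrable_on {0<..<1}"
    using fint by (intro nonnegative_absolutely_integrable_1) (auto simp: f_def integrable_on_def)
  have img: "(\<lambda>t::real. t\<^sup>2) ` {0<..<1} = {0<..<1}"
  proof (intro equalityI subsetI)
    fix s :: real assume "s \<in> {0<..<1}"
    then show "s \<in> (\<lambda>t. t\<^sup>2) ` {0<..<1}" by (intro image_eqI[of _ _ "sqrt s"]) auto
  qed (auto simp: power_less_one_iff)
  have "(\<lambda>t. \<bar>2 * t\<bar> *\<^sub>R f (t\<^sup>2)) absolutely_integrable_on {0<..<1} \<and>
      integral {0<..<1} (\<lambda>t. \<bar>2 * t\<bar> *\<^sub>R f (t\<^sup>2)) = Beta (real k + 1 / 2) (\<nu> + 1 / 2) \<longleftrightarrow>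
      f absolutely_integrable_on ((\<lambda>t. t\<^sup>2) ` {0<..<1}) \<and> integral ((\<lambda>t. t\<^sup>2) ` {0<..<1}) f = Beta (real k + 1 / 2) (\<nu> + 1 / 2)"
    by (rule has_absolute_integral_change_of_variables_real)
       (auto intro!: derivative_eq_intros inj_onI simp: power2_eq_iff)
  then have *: "(\<lambda>t. \<bar>2 * t\<bar> *\<^sub>R f (t\<^sup>2)) absolutely_integrable_on {0<..<1}"
      "integral {0<..<1} (\<lambda>t. \<bar>2 * t\<bar> *\<^sub>R f (t\<^sup>2)) = Beta (real k + 1 / 2) (\<nu> + 1 / 2)"
    using fabs fint unfolding img by (auto simp: integral_unique)
  have eq: "\<bar>2 * t\<bar> *\<^sub>R f (t\<^sup>2) = 2 * (t ^ (2 * k) * (1 - t\<^sup>2) powr (\<nu> - 1 / 2))" if "t \<in> {0<..<1}" for t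
  proof -
    have "t * (t\<^sup>2) powr (real k + 1 / 2 - 1) = t * t powr (2 * (real k + 1 / 2 - 1))"
      using that by (simp add: powr_powr flip: powr_numeral)
    also have "\<dots> = t powr (1 + 2 * (real k + 1 / 2 - 1))" using that by (simp only: powr_add) simp
    also have "1 + 2 * (real k + 1 / 2 - 1) = real (2 * k)" by simp
    also have "t powr real (2 * k) = t ^ (2 * k)" using that by (intro powr_realpow) simp
    finally show ?thesis using that by (simp add: f_def mult.assoc[symmetric])
  qed
  have 1: "(\<lambda>t. 2 * (t ^ (2 * k) * (1 - t\<^sup>2) powr (\<nu> - 1 / 2))) absolutely_integrable_on {0<..<1}"
    using *(1) by (rule absolutely_integrable_spike[OF _ negligible_empty]) (use eq in auto)
  have 2: "integral {0<..<1} (\<lambda>t. 2 * (t ^ (2 * k) * (1 - t\<^sup>2) powr (\<nu> - 1 / 2))) = Beta (real k + 1 / 2) (\<nu> + 1 / 2)"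
    using *(2) by (subst (asm) Henstock_Kurzweil_Integration.integral_cong[OF eq])
  have meas: "(\<lambda>t. 2 * (t ^ (2 * k) * (1 - t\<^sup>2) powr (\<nu> - 1 / 2))) \<in> borel_measurable unit_interval"
    by (intro measurable_restrict_space1) measurable
  have 3: "integrable unit_interval (\<lambda>t. 2 * (t ^ (2 * k) * (1 - t\<^sup>2) powr (\<nu> - 1 / 2)))"
    using integral_unit_interval(1)[OF meas] 1 by simp
  then show "integrable unit_interval (\<lambda>t. t ^ (2 * k) * (1 - t\<^sup>2) powr (\<nu> - 1 / 2))"
    by simp
  show "(\<integral>t. t ^ (2 * k) * (1 - t\<^sup>2) powr (\<nu> - 1 / 2) \<partial>unit_interval) = Beta (real k + 1 / 2) (\<nu> + 1 / 2) / 2"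
    using integral_unit_interval(2)[OF meas 3] 2 by simp
qed

lemma cosh_even_series: "(\<lambda>k. \<eta> ^ (2 * k) / fact (2 * k)) sums cosh (\<eta> :: 'a::{banach,real_normed_field})"
proof -
  have "(\<lambda>k. (\<lambda>n. if even n then \<eta> ^ n / fact n else 0) (2 * k)) sums cosh \<eta>"
  proof (subst sums_mono_reindex)
    have "(\<lambda>n. if even n then \<eta> ^ n /\<^sub>R fact n else 0) = (\<lambda>n. if even n then \<eta> ^ n / fact n else 0)"
      by (auto simp: scaleR_conv_of_real divide_inverse mult.commute)
    then show "(\<lambda>n. if even n then \<eta> ^ n / fact n else 0) sums cosh \<eta>"
      using cosh_converges[of \<eta>] by simp
  qed (auto simp: strict_mono_def elim!: evenE)
  then show ?thesis by simp
qed

text \<open>The endpoint order, where the Poisson weight is not integrable. Here the function is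
  elementary, so later estimates treat this order separately.\<close>

lemma Bessel_Clifford_half: "Bessel_Clifford (- 1 / 2) (\<eta>\<^sup>2 / 4) = cosh \<eta> / of_real (sqrt pi)"
proof -
  have "rGamma (- 1 / 2 + of_nat k + 1) / fact k * (\<eta>\<^sup>2 / 4) ^ k = \<eta> ^ (2 * k) / fact (2 * k) / of_real (sqrt pi)" for k
  proof -
    have "- 1 / 2 + of_nat k + 1 = complex_of_real (real k + 1 / 2)" by simp
    then have "rGamma (- 1 / 2 + of_nat k + 1) = complex_of_real (4 ^ k * fact k / (fact (2 * k) * sqrt pi))"
      by (simp only: rGamma_inverse_Gamma Gamma_complex_of_real Gamma_half_nat inverse_divide of_real_inverse[symmetric])
    then show ?thesis
      unfolding power_mult power_divide by simp
  qed
  then show ?thesis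
    unfolding Bessel_Clifford_def using sums_divide[OF cosh_even_series[of \<eta>], of "of_real (sqrt pi)"]
    by (simp add: sums_iff)
qed

text \<open>Expand cosh and integrate termwise: the Beta moments combined with Gamma at
  half-integers reproduce the coefficients of the series.\<close>

theorem Bessel_Clifford_Poisson:
  assumes \<nu>: "\<nu> > - 1 / 2"
  shows "integrable unit_interval (\<lambda>t. of_real ((1 - t\<^sup>2) powr (\<nu> - 1 / 2)) * cosh (\<eta> * of_real t))"
    and "Bessel_Clifford (of_real \<nu>) (\<eta>\<^sup>2 / 4) = of_real (2 / (sqrt pi * Gamma (\<nu> + 1 / 2))) *
         (\<integral>t. of_real ((1 - t\<^sup>2) powr (\<nu> - 1 / 2)) * cosh (\<eta> * of_real t) \<partial>unit_interval)"
proof -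
  define w where "w t = (1 - t\<^sup>2) powr (\<nu> - 1 / 2)" for t :: real
  define F where "F k t = \<eta> ^ (2 * k) / fact (2 * k) * complex_of_real (t ^ (2 * k) * w t)" for k t
  note mom = Poisson_moment[OF \<nu>, folded w_def]
  have Fint: "integrable unit_interval (F k)" for k
    unfolding F_def using mom(1)[of k] by (intro integrable_mult_right) (simp only: complex_of_real_integrable_eq)
  have Fval: "(\<integral>t. F k t \<partial>unit_interval) = \<eta> ^ (2 * k) / fact (2 * k) * of_real (Beta (real k + 1 / 2) (\<nu> + 1 / 2) / 2)" for k
    unfolding F_def using mom(2)[of k] by (simp only: integral_mult_right_zero integral_complex_of_real)
  have w0: "w t \<ge> 0" for t by (simp add: w_def)
  have nF: "norm (F k t) = norm \<eta> ^ (2 * k) / fact (2 * k) * (t ^ (2 * k) * w t)" for k t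
    unfolding F_def using w0[of t] by (simp add: norm_mult norm_divide norm_power power_mult abs_mult)
  have sc: "summable (\<lambda>k. x ^ (2 * k) / fact (2 * k))" for x :: real
    using cosh_even_series[of x] by (rule sums_summable)
  have FS: "(\<lambda>k. F k t) sums (of_real (w t) * cosh (\<eta> * of_real t))" for t
    using sums_mult[OF cosh_even_series[of "\<eta> * of_real t"], of "of_real (w t)"]
    by (simp add: F_def power_mult_distrib mult_ac)
  have summ1: "AE t in unit_interval. summable (\<lambda>k. norm (F k t))"
  proof (rule AE_I2)
    fix t
    show "summable (\<lambda>k. norm (F k t))"
      using summable_mult[OF sc[of "norm \<eta> * t"], of "w t"] unfolding nF by (simp add: power_mult_distrib mult_ac)
  qed
  have summ2: "summable (\<lambda>k. \<integral>t. norm (F k t) \<partial>unit_interval)"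
  proof (rule summable_comparison_test')
    show "summable (\<lambda>k. norm \<eta> ^ (2 * k) / fact (2 * k) * (\<integral>t. w t \<partial>unit_interval))"
      by (intro summable_mult2 sc)
    fix k :: nat
    \<comment> \<open>On the unit interval t ^ (2 k) \<le> 1, so every moment is at most the zeroth
      one and the cosh series dominates.\<close>
    have "(\<integral>t. norm (F k t) \<partial>unit_interval) \<le> norm \<eta> ^ (2 * k) / fact (2 * k) * (\<integral>t. w t \<partial>unit_interval)"
      unfolding nF using mom(1)[of k] mom(1)[of 0] w0
      by (subst integral_mult_right_zero, intro mult_left_mono integral_mono)
         (auto simp: space_restrict_space power_le_one mult_left_le_one_le)
    then show "norm (\<integral>t. norm (F k t) \<partial>unit_interval) \<le> norm \<eta> ^ (2 * k) / fact (2 * k) * (\<integral>t. w t \<partial>unit_interval)"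
      by (simp add: integral_nonneg)
  qed
  have eq: "(\<lambda>t. \<Sum>k. F k t) = (\<lambda>t. of_real (w t) * cosh (\<eta> * of_real t))"
    using FS by (auto simp: sums_iff)
  show "integrable unit_interval (\<lambda>t. of_real (w t) * cosh (\<eta> * of_real t))"
    using integrable_suminf[OF Fint summ1 summ2] unfolding eq .
  have "(\<integral>t. of_real (w t) * cosh (\<eta> * of_real t) \<partial>unit_interval) = (\<Sum>k. \<integral>t. F k t \<partial>unit_interval)"
    using integral_suminf[OF Fint summ1 summ2] unfolding eq .
  moreover have "summable (\<lambda>k. \<integral>t. F k t \<partial>unit_interval)"
    by (rule summable_norm_cancel, rule summable_comparison_test'[OF summ2]) auto
  moreover have "of_real (2 / (sqrt pi * Gamma (\<nu> + 1 / 2))) * (\<integral>t. F k t \<partial>unit_interval) =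
     rGamma (of_real \<nu> + of_nat k + 1) / fact k * (\<eta>\<^sup>2 / 4) ^ k" for k
  proof -
    have g: "Gamma (\<nu> + 1 / 2) > 0" using \<nu> by simp
    define R where "R = rGamma (real k + 1 / 2 + (\<nu> + 1 / 2))"
    have r: "rGamma (of_real \<nu> + of_nat k + 1) = complex_of_real R"
      by (simp add: R_def rGamma_complex_of_real[symmetric] add_ac)
    have b: "Beta (real k + 1 / 2) (\<nu> + 1 / 2) / 2 =
        R * Gamma (\<nu> + 1 / 2) * (fact (2 * k) * sqrt pi / (4 ^ k * fact k)) / 2"
      unfolding Beta_def Gamma_half_nat R_def by (simp add: rGamma_inverse_Gamma field_simps)
    show ?thesis
      unfolding Fval r b power_mult power_divide using g by (simp add: divide_simps)
  qed
  ultimately show "Bessel_Clifford (of_real \<nu>) (\<eta>\<^sup>2 / 4) = of_real (2 / (sqrt pi * Gamma (\<nu> + 1 / 2))) *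
         (\<integral>t. of_real (w t) * cosh (\<eta> * of_real t) \<partial>unit_interval)"
    unfolding Bessel_Clifford_def by (simp only:) (simp only: suminf_mult[symmetric])
qed


text \<open>On the negative axis the Poisson kernel cosh (i x t) is a cosine, bounded by 1, so the
  total mass of the weight is a bound. This is the estimate on which the domination in the first
  Fubini exchange rests.\<close>

lemma Bessel_Clifford_neg_real_bounded:
  assumes \<nu>: "\<nu> \<ge> - 1 / 2"
  obtains C where "C > 0" "\<And>x. norm (Bessel_Clifford (of_real \<nu>) (- ((of_real x / 2)\<^sup>2))) \<le> C"
proof -
  have arg: "- ((complex_of_real x / 2)\<^sup>2) = (\<i> * of_real x)\<^sup>2 / 4" for x
    by (simp add: power_mult_distrib power_divide)
  have cosh: "norm (cosh (\<i> * complex_of_real x)) \<le> 1" for x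
    by (simp add: cosh_conv_cos cos_of_real)
  show ?thesis
  proof (cases "\<nu> = - 1 / 2")
    case True
    have "norm (Bessel_Clifford (of_real \<nu>) (- ((of_real x / 2)\<^sup>2))) \<le> 1 / sqrt pi" for x
      using cosh[of x] unfolding arg True by (simp add: Bessel_Clifford_half[simplified] norm_divide divide_right_mono)
    then show ?thesis by (intro that[of "1 / sqrt pi"]) auto
  next
    case False
    then have \<nu>: "\<nu> > - 1 / 2" using \<nu> by simp
    define m where "m = (\<integral>t. (1 - t\<^sup>2) powr (\<nu> - 1 / 2) \<partial>unit_interval)"
    define c where "c = 2 / (sqrt pi * Gamma (\<nu> + 1 / 2))"
    have c: "c > 0" using \<nu> by (simp add: c_def)
    have m: "m \<ge> 0" by (simp add: m_def integral_nonneg)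
    have "norm (Bessel_Clifford (of_real \<nu>) (- ((of_real x / 2)\<^sup>2))) \<le> c * m" for x
    proof -
      have "norm (\<integral>t. of_real ((1 - t\<^sup>2) powr (\<nu> - 1 / 2)) * cosh (\<i> * of_real x * of_real t) \<partial>unit_interval) \<le> m"
        unfolding m_def
      proof (rule Bochner_Integration.integral_norm_bound_integral)
        show "integrable unit_interval (\<lambda>t. (1 - t\<^sup>2) powr (\<nu> - 1 / 2))"
          using Poisson_moment(1)[OF \<nu>, of 0] by simp
        show "norm (of_real ((1 - t\<^sup>2) powr (\<nu> - 1 / 2)) * cosh (\<i> * of_real x * of_real t)) \<le> (1 - t\<^sup>2) powr (\<nu> - 1 / 2)" for t
          using cosh[of "x * t"] by (simp add: norm_mult mult.assoc mult_left_le)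
      qed (rule Bessel_Clifford_Poisson(1)[OF \<nu>])
      then show ?thesis
        unfolding arg Bessel_Clifford_Poisson(2)[OF \<nu>] c_def[symmetric] using c by (simp add: norm_mult)
    qed
    then show ?thesis using c m that[of "c * m + 1"] by (smt (verit, best) mult_nonneg_nonneg)
  qed
qed

section \<open>Exponential growth of J off the real axis\<close>

text \<open>Preparation for Laplace's method: cosh is largest near t = 1, and t = 1 - v / c
  magnifies that endpoint to unit scale. The prefactor cancels the powers of c and the exponential
  growth, so the integrand has a pointwise limit as c grows.\<close>

lemma Poisson_integral_rescale:
  assumes \<nu>: "\<nu> > - 1 / 2" and \<eta>: "Re \<eta> > 0" and c: "c > 0"
  shows "of_real (c powr (\<nu> + 1 / 2)) * exp (- of_real c * \<eta>) *
     (\<integral>t. of_real ((1 - t\<^sup>2) powr (\<nu> - 1 / 2)) * cosh (of_real c * \<eta> * of_real t) \<partial>unit_interval) =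
     (\<integral>v. indicator {..<c} v *\<^sub>R (of_real (v powr (\<nu> - 1 / 2) * (2 - v / c) powr (\<nu> - 1 / 2)) *
        (exp (- \<eta> * of_real v) + exp (- \<eta> * of_real (2 * c - v))) / 2) \<partial>halfline)"
proof -
  define f where "f t = of_real ((1 - t\<^sup>2) powr (\<nu> - 1 / 2)) * cosh (of_real c * \<eta> * of_real t)" for t :: real
  have "(\<integral>t. f t \<partial>unit_interval) = (\<integral>t. indicator {0<..<1} t *\<^sub>R f t \<partial>lborel)"
    by (subst integral_restrict_space) auto
  also have "\<dots> = (1 / c) *\<^sub>R (\<integral>v. indicator {0<..<1} (1 - v / c) *\<^sub>R f (1 - v / c) \<partial>lborel)"
    using lborel_integral_real_affine[of "- 1 / c" "\<lambda>t. indicator {0<..<1} t *\<^sub>R f t" 1] c by simp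
  also have "(\<lambda>v. indicator {0<..<1} (1 - v / c) *\<^sub>R f (1 - v / c)) =
      (\<lambda>v. indicator {0<..} v *\<^sub>R indicator {..<c} v *\<^sub>R f (1 - v / c))"
    using c by (auto simp: indicator_def field_simps)
  also have "(\<integral>v. indicator {0<..} v *\<^sub>R indicator {..<c} v *\<^sub>R f (1 - v / c) \<partial>lborel) =
     (\<integral>v. indicator {..<c} v *\<^sub>R f (1 - v / c) \<partial>halfline)"
    by (subst integral_restrict_space) auto
  finally have 1: "(\<integral>t. f t \<partial>unit_interval) = (\<integral>v. indicator {..<c} v *\<^sub>R f (1 - v / c) \<partial>halfline) /\<^sub>R c"
    by (simp add: divide_inverse)
  have "of_real (c powr (\<nu> + 1 / 2)) * exp (- of_real c * \<eta>) * (\<integral>t. f t \<partial>unit_interval) =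
     (of_real (c powr (\<nu> - 1 / 2)) * exp (- of_real c * \<eta>)) * (\<integral>v. indicator {..<c} v *\<^sub>R f (1 - v / c) \<partial>halfline)"
  proof -
    have "c powr (\<nu> + 1 / 2) = c powr (\<nu> - 1 / 2) * c" using c powr_add[of c "\<nu> - 1 / 2" 1] by (simp add: add.commute)
    then show ?thesis using c unfolding 1 by (simp add: scaleR_conv_of_real)
  qed
  also have "\<dots> = (\<integral>v. (of_real (c powr (\<nu> - 1 / 2)) * exp (- of_real c * \<eta>)) * (indicator {..<c} v *\<^sub>R f (1 - v / c)) \<partial>halfline)"
    by (simp only: integral_mult_right_zero)
  also have "\<dots> = (\<integral>v. indicator {..<c} v *\<^sub>R (of_real (v powr (\<nu> - 1 / 2) * (2 - v / c) powr (\<nu> - 1 / 2)) *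
        (exp (- \<eta> * of_real v) + exp (- \<eta> * of_real (2 * c - v))) / 2) \<partial>halfline)"
  proof (rule Bochner_Integration.integral_cong[OF refl])
    fix v assume "v \<in> space halfline"
    then have v: "v > 0" by simp
    show "(of_real (c powr (\<nu> - 1 / 2)) * exp (- of_real c * \<eta>)) * (indicator {..<c} v *\<^sub>R f (1 - v / c)) =
      indicator {..<c} v *\<^sub>R (of_real (v powr (\<nu> - 1 / 2) * (2 - v / c) powr (\<nu> - 1 / 2)) *
        (exp (- \<eta> * of_real v) + exp (- \<eta> * of_real (2 * c - v))) / 2)"
    proof (cases "v < c")
      case True
      have q: "1 - (1 - v / c)\<^sup>2 = (v / c) * (2 - v / c)"
        by (simp add: power2_eq_square algebra_simps)
      have "2 - v / c \<ge> 0" using True c by (simp add: field_simps)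
      then have "(v / c * (2 - v / c)) powr (\<nu> - 1 / 2) = v powr (\<nu> - 1 / 2) / c powr (\<nu> - 1 / 2) * (2 - v / c) powr (\<nu> - 1 / 2)"
        using v c by (simp only: powr_mult powr_divide)
      then have P: "c powr (\<nu> - 1 / 2) * (1 - (1 - v / c)\<^sup>2) powr (\<nu> - 1 / 2) =
         v powr (\<nu> - 1 / 2) * (2 - v / c) powr (\<nu> - 1 / 2)"
        using c unfolding q by simp
      have "of_real c * \<eta> * of_real (1 - v / c) = \<eta> * of_real (c - v)"
        using c by (simp add: field_simps)
      then have E: "exp (- of_real c * \<eta>) * cosh (of_real c * \<eta> * of_real (1 - v / c)) =
         (exp (- \<eta> * of_real v) + exp (- \<eta> * of_real (2 * c - v))) / 2"
        by (simp only: cosh_field_def) (simp add: exp_add[symmetric] distrib_left algebra_simps)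
      have "of_real (c powr (\<nu> - 1 / 2)) * exp (- of_real c * \<eta>) * f (1 - v / c) =
         of_real (c powr (\<nu> - 1 / 2) * (1 - (1 - v / c)\<^sup>2) powr (\<nu> - 1 / 2)) *
         (exp (- of_real c * \<eta>) * cosh (of_real c * \<eta> * of_real (1 - v / c)))"
        by (simp add: f_def mult_ac)
      then show ?thesis using True unfolding P E by simp
    qed auto
  qed
  finally show ?thesis unfolding f_def .
qed

text \<open>Dominated convergence in the rescaled Poisson integral; the limit is a Gamma integral in
  v and therefore explicitly nonzero. The endpoint order is read off from cosh.\<close>

lemma Bessel_Clifford_asymp:
  assumes \<nu>: "\<nu> \<ge> - 1 / 2" and \<eta>: "Re \<eta> > 0"
  obtains L where "L \<noteq> 0"
    "((\<lambda>c. of_real (c powr (\<nu> + 1 / 2)) * exp (- of_real c * \<eta>) *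
        Bessel_Clifford (of_real \<nu>) ((of_real c * \<eta>)\<^sup>2 / 4)) \<longlongrightarrow> L) at_top"
proof (cases "\<nu> = - 1 / 2")
  case True
  have "((\<lambda>c. exp (- (2 * Re \<eta>) * c)) \<longlongrightarrow> 0) at_top" using \<eta> by real_asymp
  then have "((\<lambda>c. exp (- of_real c * (2 * \<eta>))) \<longlongrightarrow> 0) at_top"
    by (subst tendsto_norm_zero_iff[symmetric]) (simp add: mult_ac)
  then have "((\<lambda>c. (1 + exp (- of_real c * (2 * \<eta>))) / (2 * of_real (sqrt pi))) \<longlongrightarrow> (1 + 0) / (2 * of_real (sqrt pi))) at_top"
    by (intro tendsto_intros) auto
  moreover have "\<forall>\<^sub>F c in at_top. (1 + exp (- of_real c * (2 * \<eta>))) / (2 * of_real (sqrt pi)) =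
     of_real (c powr (\<nu> + 1 / 2)) * exp (- of_real c * \<eta>) * Bessel_Clifford (of_real \<nu>) ((of_real c * \<eta>)\<^sup>2 / 4)"
    using eventually_gt_at_top[of 0]
  proof eventually_elim
    case (elim c)
    have "exp (- of_real c * \<eta>) * cosh (of_real c * \<eta>) = (1 + exp (- of_real c * (2 * \<eta>))) / 2"
      by (simp add: cosh_field_def exp_add[symmetric] algebra_simps)
    moreover have "of_real (c powr (\<nu> + 1 / 2)) * exp (- of_real c * \<eta>) * Bessel_Clifford (of_real \<nu>) ((of_real c * \<eta>)\<^sup>2 / 4) =
        exp (- of_real c * \<eta>) * cosh (of_real c * \<eta>) / of_real (sqrt pi)"
      using elim unfolding True by (simp add: Bessel_Clifford_half[simplified])
    ultimately show ?case by (simp only: divide_divide_eq_left)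
  qed
  ultimately have "((\<lambda>c. of_real (c powr (\<nu> + 1 / 2)) * exp (- of_real c * \<eta>) *
        Bessel_Clifford (of_real \<nu>) ((of_real c * \<eta>)\<^sup>2 / 4)) \<longlongrightarrow> (1 + 0) / (2 * of_real (sqrt pi))) at_top"
    by (rule Lim_transform_eventually)
  then show ?thesis by (rule that[rotated]) simp
next
  case False
  then have \<nu>: "\<nu> > - 1 / 2" using \<nu> by simp
  define k where "k = \<nu> - 1 / 2"
  have k: "k + 1 > 0" using \<nu> by (simp add: k_def)
  define s where "s c v = indicator {..<c} v *\<^sub>R (of_real (v powr k * (2 - v / c) powr k) *
        (exp (- \<eta> * of_real v) + exp (- \<eta> * of_real (2 * c - v))) / 2)" for c v :: real
  define f where "f v = of_real (2 powr k) / 2 * (complex_of_real (v powr k) * exp (- \<eta> * of_real v))" for v :: real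
  \<comment> \<open>For v < c the base 2 - v / c lies between 1 and 2, so this bounds its power for
    either sign of the exponent k.\<close>
  define M where "M = max 1 (2 powr k)"
  have lim: "((\<lambda>c. \<integral>v. s c v \<partial>halfline) \<longlongrightarrow> (\<integral>v. f v \<partial>halfline)) at_top"
  proof (rule integral_dominated_convergence_at_top[where w = "\<lambda>v. M * (v powr (k + 1 - 1) * exp (- Re \<eta> * v))"])
    show "f \<in> borel_measurable halfline" unfolding f_def by (intro measurable_restrict_space1) measurable
    show "s c \<in> borel_measurable halfline" for c unfolding s_def by (intro measurable_restrict_space1) measurable
    show "integrable halfline (\<lambda>v. M * (v powr (k + 1 - 1) * exp (- Re \<eta> * v)))"
      by (intro integrable_mult_right integrable_powr_exp k \<eta>)
    show "\<forall>\<^sub>F c in at_top. AE v in halfline. norm (s c v) \<le> M * (v powr (k + 1 - 1) * exp (- Re \<eta> * v))"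
      using eventually_gt_at_top[of 0]
    proof eventually_elim
      case (elim c)
      show ?case
      proof (rule AE_I2)
        fix v assume "v \<in> space halfline"
        then have v: "v > 0" by simp
        show "norm (s c v) \<le> M * (v powr (k + 1 - 1) * exp (- Re \<eta> * v))"
        proof (cases "v < c")
          case True
          have b: "1 \<le> 2 - v / c" "2 - v / c \<le> 2" using True v elim by auto
          have P: "(2 - v / c) powr k \<le> M"
          proof (cases "k \<ge> 0")
            case True
            then have "(2 - v / c) powr k \<le> 2 powr k" using b by (intro powr_mono2) auto
            then show ?thesis by (simp add: M_def)
          next
            case False
            then have "(2 - v / c) powr k \<le> (2 - v / c) powr 0" using b by (intro powr_mono) auto
            then show ?thesis using b by (simp add: M_def)
          qed
          have "norm (exp (- \<eta> * of_real v) + exp (- \<eta> * of_real (2 * c - v))) \<le>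
              exp (- Re \<eta> * v) + exp (- Re \<eta> * (2 * c - v))"
            by (rule norm_triangle_le) simp
          also have "exp (- Re \<eta> * (2 * c - v)) \<le> exp (- Re \<eta> * v)"
            using True \<eta> by (simp add: mult_left_mono)
          finally have E: "norm (exp (- \<eta> * of_real v) + exp (- \<eta> * of_real (2 * c - v))) \<le> 2 * exp (- Re \<eta> * v)" by simp
          have "norm (s c v) = v powr k * ((2 - v / c) powr k * (norm (exp (- \<eta> * of_real v) + exp (- \<eta> * of_real (2 * c - v))) / 2))"
            using True by (simp add: s_def norm_mult)
          also have "\<dots> \<le> v powr k * (M * (2 * exp (- Re \<eta> * v) / 2))"
            using P E by (intro mult_left_mono mult_mono divide_right_mono) (auto simp: M_def)
          finally show ?thesis by (simp add: mult_ac)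
        qed (auto simp: s_def M_def)
      qed
    qed
    show "AE v in halfline. ((\<lambda>c. s c v) \<longlongrightarrow> f v) at_top"
    proof (rule AE_I2)
      fix v assume "v \<in> space halfline"
      then have v: "v > 0" by simp
      have "((\<lambda>c. exp (- Re \<eta> * (2 * c - v))) \<longlongrightarrow> 0) at_top" using \<eta> by real_asymp
      then have e: "((\<lambda>c. exp (- \<eta> * of_real (2 * c - v))) \<longlongrightarrow> 0) at_top"
        by (subst tendsto_norm_zero_iff[symmetric]) simp
      have p: "((\<lambda>c. (2 - v / c) powr k) \<longlongrightarrow> 2 powr k) at_top" by real_asymp
      have "((\<lambda>c. of_real (v powr k * (2 - v / c) powr k) * (exp (- \<eta> * of_real v) + exp (- \<eta> * of_real (2 * c - v))) / 2) \<longlongrightarrow>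
        of_real (v powr k * 2 powr k) * (exp (- \<eta> * of_real v) + 0) / 2) at_top"
        by (intro tendsto_intros e p) auto
      also have "of_real (v powr k * 2 powr k) * (exp (- \<eta> * of_real v) + 0) / 2 = f v" by (simp add: f_def)
      finally show "((\<lambda>c. s c v) \<longlongrightarrow> f v) at_top"
      proof (rule Lim_transform_eventually)
        show "\<forall>\<^sub>F c in at_top. of_real (v powr k * (2 - v / c) powr k) * (exp (- \<eta> * of_real v) + exp (- \<eta> * of_real (2 * c - v))) / 2 = s c v"
          using eventually_gt_at_top[of v] by eventually_elim (simp add: s_def)
      qed
    qed
  qed
  define N where "N = complex_of_real (2 / (sqrt pi * Gamma (\<nu> + 1 / 2)))"
  have N: "N \<noteq> 0" using \<nu> by (simp add: N_def less_imp_neq[symmetric])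
  have val: "(\<integral>v. f v \<partial>halfline) = of_real (2 powr k) / 2 * (of_real (Gamma (k + 1)) * \<eta> powr (- of_real (k + 1)))"
    using laplace_power(2)[OF k \<eta>] unfolding f_def by (simp only: integral_mult_right_zero) simp
  show ?thesis
  proof (rule that)
    have "Gamma (k + 1) > 0" using k by simp
    then show "N * (\<integral>v. f v \<partial>halfline) \<noteq> 0" unfolding val using N \<eta> by (auto simp: )
    have "((\<lambda>c. N * (\<integral>v. s c v \<partial>halfline)) \<longlongrightarrow> N * (\<integral>v. f v \<partial>halfline)) at_top"
      by (intro tendsto_intros lim)
    then show "((\<lambda>c. of_real (c powr (\<nu> + 1 / 2)) * exp (- of_real c * \<eta>) *
        Bessel_Clifford (of_real \<nu>) ((of_real c * \<eta>)\<^sup>2 / 4)) \<longlongrightarrow> N * (\<integral>v. f v \<partial>halfline)) at_top"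
    proof (rule Lim_transform_eventually)
      show "\<forall>\<^sub>F c in at_top. N * (\<integral>v. s c v \<partial>halfline) = of_real (c powr (\<nu> + 1 / 2)) * exp (- of_real c * \<eta>) *
        Bessel_Clifford (of_real \<nu>) ((of_real c * \<eta>)\<^sup>2 / 4)"
        using eventually_gt_at_top[of 0]
      proof eventually_elim
        case (elim c)
        show ?case
          using Poisson_integral_rescale[OF \<nu> \<eta> elim]
          unfolding Bessel_Clifford_Poisson(2)[OF \<nu>] N_def[symmetric] s_def k_def by (simp add: mult_ac)
      qed
    qed
  qed
qed

lemma Bessel_J_growth:
  assumes \<nu>: "\<nu> \<ge> - 1 / 2" and z: "Im z \<noteq> 0"
  obtains \<eta> L where "Re \<eta> > 0" "L \<noteq> 0"
    "((\<lambda>c. of_real (c powr (1 / 2)) * exp (- of_real c * \<eta>) * Bessel_J \<nu> (of_real c * z)) \<longlongrightarrow> L) at_top"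
proof -
  \<comment> \<open>Of the two square roots of - z^2 this is the one with real part \<bar>Im
    z\<bar>, which is the growth rate.\<close>
  define \<eta> where "\<eta> = (if Im z > 0 then - \<i> * z else \<i> * z)"
  have \<eta>: "Re \<eta> > 0" "\<eta>\<^sup>2 = - (z\<^sup>2)" using z by (auto simp: \<eta>_def power_mult_distrib)
  obtain L where L: "L \<noteq> 0" "((\<lambda>c. of_real (c powr (\<nu> + 1 / 2)) * exp (- of_real c * \<eta>) *
        Bessel_Clifford (of_real \<nu>) ((of_real c * \<eta>)\<^sup>2 / 4)) \<longlongrightarrow> L) at_top"
    using Bessel_Clifford_asymp[OF \<nu> \<eta>(1)] by blast
  define m where "m = (z / 2) powr (of_real \<nu>)"
  have m: "m \<noteq> 0" using z by (auto simp: m_def)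
  have "((\<lambda>c. m * (of_real (c powr (\<nu> + 1 / 2)) * exp (- of_real c * \<eta>) *
        Bessel_Clifford (of_real \<nu>) ((of_real c * \<eta>)\<^sup>2 / 4))) \<longlongrightarrow> m * L) at_top"
    by (intro tendsto_intros L)
  then have "((\<lambda>c. of_real (c powr (1 / 2)) * exp (- of_real c * \<eta>) * Bessel_J \<nu> (of_real c * z)) \<longlongrightarrow> m * L) at_top"
  proof (rule Lim_transform_eventually)
    show "\<forall>\<^sub>F c in at_top. m * (of_real (c powr (\<nu> + 1 / 2)) * exp (- of_real c * \<eta>) *
        Bessel_Clifford (of_real \<nu>) ((of_real c * \<eta>)\<^sup>2 / 4)) =
        of_real (c powr (1 / 2)) * exp (- of_real c * \<eta>) * Bessel_J \<nu> (of_real c * z)"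
      using eventually_gt_at_top[of 0]
    proof eventually_elim
      case (elim c)
      have "(of_real c * (z / 2)) powr (of_real \<nu>) = of_real (c powr \<nu>) * m"
        using elim unfolding m_def by (subst powr_times_real_left) (auto simp: powr_of_real)
      then have p: "(of_real c * z / 2) powr (of_real \<nu>) = of_real (c powr \<nu>) * m" by simp
      have a: "- ((of_real c * z / 2)\<^sup>2) = (of_real c * \<eta>)\<^sup>2 / 4"
        using \<eta>(2) by (simp add: power_mult_distrib power_divide)
      have "c powr (\<nu> + 1 / 2) = c powr (1 / 2) * c powr \<nu>" by (simp add: powr_add)
      then show ?case unfolding Bessel_J_Clifford p a by (simp add: mult_ac)
    qed
  qed
  then show ?thesis using that[OF \<eta>(1), of "m * L"] m L(1) by simp
qed

section \<open>A Laplace transform\<close>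

lemma Gamma_duplication_real:
  assumes "s > (0::real)"
  shows "rGamma s * Gamma (2 * s) = Gamma (s + 1 / 2) * 2 powr (2 * s - 1) / sqrt pi"
proof -
  have np: "complex_of_real s \<notin> \<int>\<^sub>\<le>\<^sub>0" "complex_of_real s + 1 / 2 \<notin> \<int>\<^sub>\<le>\<^sub>0"
    using assms by (auto elim!: nonpos_Ints_cases simp: complex_eq_iff)
  have "complex_of_real (Gamma s * Gamma (s + 1 / 2)) = of_real (exp ((1 - 2 * s) * ln 2) * sqrt pi * Gamma (2 * s))"
    using Gamma_legendre_duplication[OF np] by (simp add: Gamma_complex_of_real[symmetric] exp_of_real[symmetric])
  then have dup: "Gamma s * Gamma (s + 1 / 2) = 2 powr (1 - 2 * s) * sqrt pi * Gamma (2 * s)"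
    unfolding of_real_eq_iff by (simp add: powr_def mult.commute)
  have "2 powr (2 * s - 1) * (Gamma s * Gamma (s + 1 / 2)) = (2 powr (2 * s - 1) * 2 powr (1 - 2 * s)) * (sqrt pi * Gamma (2 * s))"
    unfolding dup by (simp only: mult_ac)
  also have "2 powr (2 * s - 1) * 2 powr (1 - 2 * s) = (1::real)" by (simp flip: powr_add)
  finally have "sqrt pi * Gamma (2 * s) = 2 powr (2 * s - 1) * (Gamma s * Gamma (s + 1 / 2))" by simp
  moreover have "Gamma s > 0" using assms by simp
  ultimately show ?thesis by (simp add: rGamma_inverse_Gamma divide_simps mult_ac)
qed

lemma binomial_series_pochhammer:
  assumes "\<bar>r\<bar> < (1::real)" "a > 0"
  shows "(\<lambda>k. (- 1) ^ k * Gamma (a + real k) / fact k * r ^ k) sums (Gamma a * (1 + r) powr (- a))"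
proof -
  have np: "a \<notin> \<int>\<^sub>\<le>\<^sub>0" using assms by (auto elim!: nonpos_Ints_cases)
  have "Gamma a * ((- a gchoose k) * r ^ k) = (- 1) ^ k * Gamma (a + real k) / fact k * r ^ k" for k
    using Gamma_real_pos[OF assms(2)] by (simp add: gbinomial_pochhammer pochhammer_Gamma[OF np])
  then show ?thesis
    using sums_mult[OF gen_binomial_real[OF assms(1), of "- a"], of "Gamma a"] by simp
qed

text \<open>The power series is transformed termwise. The duplication formula reduces the quotient
  of Gamma values to Gamma (\<nu> + 3/2 + k), which leaves a binomial series in r = (x / p)^2; hence
  the restriction p > x.\<close>

lemma Bessel_Clifford_laplace_real:
  assumes \<nu>: "\<nu> \<ge> - 1 / 2" and x: "x > 0" and p: "p > x"
  shows "(\<integral>c. of_real (c powr (2 * \<nu> + 1)) * Bessel_Clifford (of_real \<nu>) (- ((of_real (c * x) / 2)\<^sup>2)) *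
            exp (- of_real p * of_real c) \<partial>halfline) =
         of_real (2 powr (2 * \<nu> + 1) * Gamma (\<nu> + 3 / 2) / sqrt pi) * of_real p *
           (of_real p ^ 2 + of_real x ^ 2) powr (- of_real (\<nu> + 3 / 2))"
proof -
  have p0: "p > 0" using x p by simp
  define a where "a = \<nu> + 3 / 2"
  have a: "a > 0" using \<nu> by (simp add: a_def)
  define b where "b k = rGamma (\<nu> + real k + 1) / fact k * (x / 2) ^ (2 * k)" for k
  have b0: "b k \<ge> 0" for k using \<nu> x by (simp add: b_def rGamma_inverse_Gamma)
  define F where "F k c = complex_of_real ((- 1) ^ k * b k) *
      complex_of_real (c powr (2 * \<nu> + 2 * real k + 2 - 1) * exp (- p * c))" for k c
  define r where "r = (x / p)\<^sup>2"
  have r: "0 < r" "r < 1" using x p by (auto simp: r_def power_less_one_iff)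
  define T where "T k = Gamma (a + real k) / fact k * r ^ k" for k
  define D where "D = 2 powr (2 * \<nu> + 1) / sqrt pi * p powr (- 2 * \<nu> - 2)"
  have s0: "2 * \<nu> + 2 * real k + 2 > 0" for k using \<nu> by simp
  have moment: "b k * (\<integral>c. c powr (2 * \<nu> + 2 * real k + 2 - 1) * exp (- p * c) \<partial>halfline) = D * T k" for k
  proof -
    have h1: "rGamma (\<nu> + real k + 1) * Gamma (2 * \<nu> + 2 * real k + 2) = Gamma (a + real k) * 2 powr (2 * \<nu> + 2 * real k + 1) / sqrt pi"
      using Gamma_duplication_real[of "\<nu> + real k + 1"] \<nu> by (simp add: a_def algebra_simps)
    have h2: "2 powr (2 * \<nu> + 2 * real k + 1) = 2 powr (2 * \<nu> + 1) * 2 ^ (2 * k)"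
    proof -
      have "2 powr (2 * \<nu> + 1 + real (2 * k)) = 2 powr (2 * \<nu> + 1) * 2 powr real (2 * k)" by (rule powr_add)
      also have "2 powr real (2 * k) = (2::real) ^ (2 * k)" by (intro powr_realpow) simp
      finally show ?thesis by (simp add: algebra_simps)
    qed
    have h3: "p powr (- (2 * \<nu> + 2 * real k + 2)) = p powr (- 2 * \<nu> - 2) / p ^ (2 * k)"
    proof -
      have "p powr (- 2 * \<nu> - 2 - real (2 * k)) = p powr (- 2 * \<nu> - 2) / p powr real (2 * k)" by (rule powr_diff)
      also have "p powr real (2 * k) = p ^ (2 * k)" using p0 by (intro powr_realpow)
      also have "- 2 * \<nu> - 2 - real (2 * k) = - (2 * \<nu> + 2 * real k + 2)" by simp
      finally show ?thesis .
    qed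
    have "b k * (Gamma (2 * \<nu> + 2 * real k + 2) * p powr (- (2 * \<nu> + 2 * real k + 2))) =
        (rGamma (\<nu> + real k + 1) * Gamma (2 * \<nu> + 2 * real k + 2)) / fact k * (x / 2) ^ (2 * k) * p powr (- (2 * \<nu> + 2 * real k + 2))"
      unfolding b_def by simp
    also have "\<dots> = (Gamma (a + real k) * (2 powr (2 * \<nu> + 1) * 2 ^ (2 * k)) / sqrt pi) / fact k * (x / 2) ^ (2 * k) * (p powr (- 2 * \<nu> - 2) / p ^ (2 * k))"
      unfolding h1 h2 h3 ..
    also have "\<dots> = D * T k"
      unfolding D_def T_def r_def power_mult[symmetric] by (simp add: power_divide mult_ac)
    finally show ?thesis unfolding laplace_power_real(2)[OF s0 p0] .
  qed
  have Fint: "integrable halfline (F k)" for k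
    unfolding F_def using laplace_power_real(1)[OF s0 p0] by (intro integrable_mult_right) (simp only: complex_of_real_integrable_eq)
  have Fval: "(\<integral>c. F k c \<partial>halfline) = complex_of_real (D * ((- 1) ^ k * T k))" for k
    unfolding F_def integral_mult_right_zero integral_complex_of_real of_real_mult[symmetric]
    using moment[of k] by (simp only: mult.assoc) (simp add: mult_ac)
  have nF: "norm (F k c) = b k * (c powr (2 * \<nu> + 2 * real k + 2 - 1) * exp (- p * c))" for k c
    unfolding F_def using b0[of k] by (simp add: norm_mult norm_power abs_mult power_abs)
  have nFval: "(\<integral>c. norm (F k c) \<partial>halfline) = D * T k" for k
    unfolding nF using moment[of k] by (simp only: integral_mult_right_zero)
  have FS: "(\<lambda>k. F k c) sums (of_real (c powr (2 * \<nu> + 1)) * Bessel_Clifford (of_real \<nu>) (- ((of_real (c * x) / 2)\<^sup>2)) *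
            exp (- of_real p * of_real c))" (is "_ sums ?G c")
    and summ1: "summable (\<lambda>k. norm (F k c))" if c: "c > 0" for c
  proof -
    define E where "E = complex_of_real (c powr (2 * \<nu> + 1) * exp (- p * c))"
    define B where "B k = rGamma (of_real \<nu> + of_nat k + 1) / fact k * (- ((complex_of_real (c * x) / 2)\<^sup>2)) ^ k" for k
    have eq: "F k c = E * B k" for k
    proof -
      have "rGamma (of_real \<nu> + of_nat k + 1) = complex_of_real (rGamma (\<nu> + real k + 1))"
        by (simp add: rGamma_complex_of_real[symmetric])
      moreover have "(- ((complex_of_real (c * x) / 2)\<^sup>2)) ^ k = of_real ((- 1) ^ k * (x / 2) ^ (2 * k) * c ^ (2 * k))"
        unfolding power_minus[of "(complex_of_real (c * x) / 2)\<^sup>2"] power_mult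
        by (simp add: power_mult_distrib power_divide)
      moreover have "c powr (2 * \<nu> + 2 * real k + 2 - 1) = c powr (2 * \<nu> + 1) * c ^ (2 * k)"
      proof -
        have "c powr (2 * \<nu> + 1 + real (2 * k)) = c powr (2 * \<nu> + 1) * c powr real (2 * k)" by (rule powr_add)
        also have "c powr real (2 * k) = c ^ (2 * k)" using c by (intro powr_realpow)
        finally show ?thesis by (simp add: algebra_simps)
      qed
      ultimately show ?thesis unfolding F_def E_def B_def b_def by (simp add: mult_ac)
    qed
    have "?G c = E * Bessel_Clifford (of_real \<nu>) (- ((of_real (c * x) / 2)\<^sup>2))"
      by (simp add: E_def mult_ac flip: exp_of_real)
    moreover have "B sums Bessel_Clifford (of_real \<nu>) (- ((of_real (c * x) / 2)\<^sup>2))"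
      unfolding Bessel_Clifford_def B_def by (rule summable_sums[OF summable_norm_cancel[OF Bessel_Clifford_summable_norm]])
    ultimately show "(\<lambda>k. F k c) sums ?G c" unfolding eq using sums_mult by metis
    have "summable (\<lambda>k. norm (B k))" unfolding B_def by (rule Bessel_Clifford_summable_norm)
    then show "summable (\<lambda>k. norm (F k c))" unfolding eq norm_mult by (rule summable_mult)
  qed
  have Tsums: "(\<lambda>k. (- 1) ^ k * T k) sums (Gamma a * (1 + r) powr (- a))"
    using binomial_series_pochhammer[of r a] r a by (simp add: T_def mult.assoc)
  \<comment> \<open>Absolute summability is ordinary convergence of the same binomial series at - r,
    where all terms are positive.\<close>
  have Tsumm: "summable T"
  proof -
    have "(- 1) ^ k * (- 1) ^ k = (1::real)" for k :: nat by (simp flip: power_mult_distrib)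
    then have "(- 1) ^ k * Gamma (a + real k) / fact k * (- r) ^ k = T k" for k
      unfolding T_def power_minus[of r] by (simp add: field_simps)
    then show ?thesis
      using binomial_series_pochhammer[of "- r" a] r a by (simp add: sums_iff)
  qed
  have summ2: "summable (\<lambda>k. \<integral>c. norm (F k c) \<partial>halfline)"
    unfolding nFval by (intro summable_mult Tsumm)
  have "(\<integral>c. (\<Sum>k. F k c) \<partial>halfline) = (\<Sum>k. \<integral>c. F k c \<partial>halfline)"
    by (rule integral_suminf[OF Fint _ summ2]) (use summ1 in auto)
  also have "(\<integral>c. (\<Sum>k. F k c) \<partial>halfline) = (\<integral>c. ?G c \<partial>halfline)"
    using FS by (intro Bochner_Integration.integral_cong) (auto simp: sums_iff)
  also have "(\<Sum>k. \<integral>c. F k c \<partial>halfline) = of_real (D * (Gamma a * (1 + r) powr (- a)))"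
    unfolding Fval using sums_of_real[OF sums_mult[OF Tsums, of D]] by (rule sums_unique[symmetric])
  also have "D * (Gamma a * (1 + r) powr (- a)) = 2 powr (2 * \<nu> + 1) * Gamma a / sqrt pi * (p * (p\<^sup>2 + x\<^sup>2) powr (- a))"
  proof -
    have "1 + r = (p\<^sup>2 + x\<^sup>2) / p\<^sup>2" using p0 by (simp add: r_def field_simps)
    then have "(1 + r) powr (- a) = (p\<^sup>2 + x\<^sup>2) powr (- a) / (p\<^sup>2) powr (- a)"
      using p0 by (simp add: powr_divide)
    also have "(p\<^sup>2) powr (- a) = p powr (- 2 * a)" using p0 by (simp add: powr_powr flip: powr_numeral)
    finally have "p powr (- 2 * \<nu> - 2) * (1 + r) powr (- a) = (p\<^sup>2 + x\<^sup>2) powr (- a) * (p powr (- 2 * \<nu> - 2) / p powr (- 2 * a))"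
      by simp
    also have "p powr (- 2 * \<nu> - 2) / p powr (- 2 * a) = p" using p0 by (simp add: a_def flip: powr_diff)
    finally show ?thesis by (simp add: D_def mult_ac)
  qed
  also have "complex_of_real (2 powr (2 * \<nu> + 1) * Gamma a / sqrt pi * (p * (p\<^sup>2 + x\<^sup>2) powr (- a))) =
     of_real (2 powr (2 * \<nu> + 1) * Gamma a / sqrt pi) * of_real p * (of_real p ^ 2 + of_real x ^ 2) powr (- of_real a)"
    using powr_of_real[of "p\<^sup>2 + x\<^sup>2" "- a"] by simp
  finally show ?thesis by (simp only: a_def)
qed

text \<open>Continuation from p > x to the half-plane. The left side is holomorphic there because
  the Bessel factor is bounded on the real axis, not merely of exponential type.\<close>

theorem Bessel_Clifford_laplace:
  assumes \<nu>: "\<nu> \<ge> - 1 / 2" and x: "x > 0" and p: "Re p > 0"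
  shows "(\<integral>c. of_real (c powr (2 * \<nu> + 1)) * Bessel_Clifford (of_real \<nu>) (- ((of_real (c * x) / 2)\<^sup>2)) *
            exp (- p * of_real c) \<partial>halfline) =
         of_real (2 powr (2 * \<nu> + 1) * Gamma (\<nu> + 3 / 2) / sqrt pi) * p * (p\<^sup>2 + of_real x ^ 2) powr (- of_real (\<nu> + 3 / 2))"
proof -
  define A where "A = {p::complex. Re p > 0}"
  have A: "open A" "connected A"
    unfolding A_def by (rule open_connected_right_half_plane)+
  define B where "B c = Bessel_Clifford (of_real \<nu>) (- ((of_real (c * x) / 2)\<^sup>2))" for c
  obtain C where C: "C > 0" "\<And>x. norm (Bessel_Clifford (of_real \<nu>) (- ((of_real x / 2)\<^sup>2))) \<le> C"
    using Bessel_Clifford_neg_real_bounded[OF \<nu>] by blast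
  have BC: "norm (B c) \<le> C" for c using C(2)[of "c * x"] by (simp add: B_def)
  have meas: "(\<lambda>c. of_real (c powr (2 * \<nu> + 1)) * B c * exp (- p * of_real c)) \<in> borel_measurable halfline" for p
    unfolding B_def by (intro borel_measurable_halfline continuous_intros) auto
  have s: "2 * \<nu> + 2 > 0" using \<nu> by simp
  have F: "(\<lambda>p. \<integral>c. of_real (c powr (2 * \<nu> + 1)) * B c * exp (- p * of_real c) \<partial>halfline) holomorphic_on A"
  proof (rule holomorphic_integral[OF A(1) meas])
    fix q assume q: "q \<in> A"
    define r where "r = Re q / 2"
    have r: "r > 0" using q by (simp add: r_def A_def)
    have "norm (of_real (t powr (2 * \<nu> + 1)) * B t * exp (- w * of_real t)) \<le> C * (t powr (2 * \<nu> + 2 - 1) * exp (- r * t))"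
      if "w \<in> ball q r" "t > 0" for w t
    proof -
      have "\<bar>Re (q - w)\<bar> < r" using that(1) abs_Re_le_cmod[of "q - w"] by (auto simp: dist_norm)
      then have "r \<le> Re w" by (auto simp: r_def abs_if split: if_splits)
      then have "exp (- Re w * t) \<le> exp (- r * t)" using that by (auto simp: mult_right_mono)
      then have "t powr (2 * \<nu> + 1) * norm (B t) * exp (- Re w * t) \<le> t powr (2 * \<nu> + 1) * C * exp (- r * t)"
        using BC[of t] C(1) by (intro mult_mono mult_left_mono) auto
      moreover have "2 * \<nu> + 2 - 1 = 2 * \<nu> + 1" by simp
      ultimately show ?thesis by (simp only: norm_mult norm_of_real norm_exp_eq_Re) (simp add: mult_ac)
    qed
    then show "\<exists>r>0. \<exists>h. integrable halfline h \<and> (\<forall>w\<in>ball q r \<inter> A. \<forall>t\<in>space halfline.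
        norm (of_real (t powr (2 * \<nu> + 1)) * B t * exp (- w * of_real t)) \<le> h t)"
      using r integrable_powr_exp[OF s r]
      by (intro exI[of _ r] conjI exI[of _ "\<lambda>t. C * (t powr (2 * \<nu> + 2 - 1) * exp (- r * t))"]) auto
  qed (auto intro!: holomorphic_intros)
  \<comment> \<open>A real value of p^2 + x^2 with Re p > 0 forces Im p = 0, and then the value is
    positive; so the principal power stays off its cut.\<close>
  have slit: "p\<^sup>2 + of_real x ^ 2 \<notin> \<real>\<^sub>\<le>\<^sub>0" if "p \<in> A" for p
  proof
    assume *: "p\<^sup>2 + of_real x ^ 2 \<in> \<real>\<^sub>\<le>\<^sub>0"
    have "Re p > 0" using that by (simp add: A_def)
    moreover have "Im p = 0" using * calculation by (simp add: complex_nonpos_Reals_iff power2_eq_square)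
    ultimately show False using * x
      by (simp add: complex_nonpos_Reals_iff power2_eq_square) (smt (verit) mult_pos_pos)
  qed
  have G: "(\<lambda>p. of_real (2 powr (2 * \<nu> + 1) * Gamma (\<nu> + 3 / 2) / sqrt pi) * p * (p\<^sup>2 + of_real x ^ 2) powr (- of_real (\<nu> + 3 / 2))) holomorphic_on A"
    using slit by (intro holomorphic_intros) auto
  have less: "x < x + 1" by simp
  have "(\<integral>c. of_real (c powr (2 * \<nu> + 1)) * B c * exp (- p * of_real c) \<partial>halfline) =
      of_real (2 powr (2 * \<nu> + 1) * Gamma (\<nu> + 3 / 2) / sqrt pi) * p * (p\<^sup>2 + of_real x ^ 2) powr (- of_real (\<nu> + 3 / 2))"
  proof (rule holomorphic_eq_on_real_interval[OF F G A less])
    fix u assume "x < u" "u < x + 1"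
    then show "complex_of_real u \<in> A \<and> (\<integral>c. of_real (c powr (2 * \<nu> + 1)) * B c * exp (- of_real u * of_real c) \<partial>halfline) =
      of_real (2 powr (2 * \<nu> + 1) * Gamma (\<nu> + 3 / 2) / sqrt pi) * of_real u * ((of_real u)\<^sup>2 + of_real x ^ 2) powr (- of_real (\<nu> + 3 / 2))"
      using Bessel_Clifford_laplace_real[OF \<nu> x, of u] x by (simp add: A_def B_def)
  qed (use p in \<open>simp add: A_def\<close>)
  then show ?thesis by (simp only: B_def)
qed

section \<open>Gaussian integrals on a rotated ray\<close>

lemma gaussian_moment:
  assumes b: "b > 0"
  shows "integrable halfline (\<lambda>y. y ^ m * exp (- b * y\<^sup>2))"
    and "(\<integral>y. y ^ m * exp (- b * y\<^sup>2) \<partial>halfline) = Gamma ((real m + 1) / 2) * b powr (- (real m + 1) / 2) / 2"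
proof -
  define \<mu> where "\<mu> = - (real m + 1) / 2"
  have \<mu>: "\<mu> < 0" by (simp add: \<mu>_def)
  have meas: "(\<lambda>y. y ^ m * exp (- b * y\<^sup>2)) \<in> borel_measurable halfline"
    by (intro measurable_restrict_space1) measurable
  have eq: "exp t *\<^sub>R (exp t ^ m * exp (- b * (exp t)\<^sup>2)) = exp (- b * exp (2 * t) - \<mu> * (2 * t))" for t
  proof -
    have e: "exp t ^ m = exp (real m * t)" "(exp t)\<^sup>2 = exp (2 * t)"
      by (rule exp_of_nat_mult[symmetric], rule exp_double[symmetric])
    show ?thesis
      unfolding real_scaleR_def e exp_add[symmetric]
      by (rule arg_cong[of _ _ exp]) (simp add: \<mu>_def field_simps)
  qed
  note K = integrable_exp_kernel_real_0[OF b \<mu>]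
  have i: "integrable lborel (\<lambda>t. exp (- b * exp (2 * t) - \<mu> * (2 * t)))"
    using lborel_integrable_real_affine[OF K(1), of 2 0] by simp
  then show I: "integrable halfline (\<lambda>y. y ^ m * exp (- b * y\<^sup>2))"
    unfolding exp_substitution(1)[OF meas] eq .
  have "(\<integral>y. y ^ m * exp (- b * y\<^sup>2) \<partial>halfline) = (\<integral>t. exp (- b * exp (2 * t) - \<mu> * (2 * t)) \<partial>lborel)"
    using exp_substitution(2)[OF meas I] unfolding eq .
  also have "\<dots> = Gamma (- \<mu>) * b powr \<mu> / 2"
    using lborel_integral_real_affine[of 2 "\<lambda>t. exp (- b * exp t - \<mu> * t)" 0] K(2) by simp
  also have "- \<mu> = (real m + 1) / 2" by (simp add: \<mu>_def field_simps)
  finally show "(\<integral>y. y ^ m * exp (- b * y\<^sup>2) \<partial>halfline) = Gamma ((real m + 1) / 2) * b powr (- (real m + 1) / 2) / 2"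
    unfolding \<mu>_def .
qed

text \<open>Expand sin and insert the Gaussian moments: Gamma (k + 3/2) / (2 k + 1)! collapses to a
  multiple of 1 / (4 ^ k k!). The alternating series is exp (- 1 / (4 b)), and its absolute version
  exp (1 / (4 b)) justifies the exchange.\<close>

lemma gaussian_sine_integral:
  assumes b: "b > 0"
  shows "(\<integral>y. y * sin y * exp (- b * y\<^sup>2) \<partial>halfline) = sqrt pi / 4 * b powr (- 3 / 2) * exp (- 1 / (4 * b))"
proof -
  define F where "F k y = (- 1) ^ k / fact (2 * k + 1) * (y ^ (2 * k + 2) * exp (- b * y\<^sup>2))" for k and y :: real
  define T where "T k = sqrt pi / 4 * b powr (- 3 / 2) * ((1 / (4 * b)) ^ k / fact k)" for k
  have mom: "(\<integral>y. y ^ (2 * k + 2) * exp (- b * y\<^sup>2) \<partial>halfline) / fact (2 * k + 1) = T k" for k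
  proof -
    have h1: "Gamma ((real (2 * k + 2) + 1) / 2) = fact (2 * Suc k) * sqrt pi / (4 ^ Suc k * fact (Suc k))"
      using Gamma_half_nat[of "Suc k"] by (simp add: field_simps)
    have h2: "b powr (- (real (2 * k + 2) + 1) / 2) = b powr (- 3 / 2) / b ^ k"
    proof -
      have "b powr (- 3 / 2 - real k) = b powr (- 3 / 2) / b powr real k" by (rule powr_diff)
      also have "b powr real k = b ^ k" using b by (intro powr_realpow)
      also have "- 3 / 2 - real k = - (real (2 * k + 2) + 1) / 2" by (simp add: field_simps)
      finally show ?thesis .
    qed
    have h3: "fact (2 * Suc k) = (2 * real (Suc k)) * fact (2 * k + 1)" "fact (Suc k) = real (Suc k) * fact k"
      by (simp_all add: fact_Suc)
    show ?thesis
      unfolding gaussian_moment(2)[OF b] T_def power_divide power_mult_distrib h1 h2 h3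
      using b by (simp add: divide_simps del: of_nat_Suc fact_Suc)
  qed
  have Fint: "integrable halfline (F k)" for k
    unfolding F_def by (intro integrable_mult_right gaussian_moment b)
  have Fval: "(\<integral>y. F k y \<partial>halfline) = (- 1) ^ k * T k" for k
    unfolding F_def integral_mult_right_zero mom[symmetric] by simp
  have nF: "norm (F k y) = 1 / fact (2 * k + 1) * (y ^ (2 * k + 2) * exp (- b * y\<^sup>2))" for k y
  proof -
    have "y ^ (2 * k + 2) \<ge> 0" by (rule zero_le_even_power) simp
    then show ?thesis unfolding F_def real_norm_def abs_mult by (simp add: power_abs)
  qed
  have nFval: "(\<integral>y. norm (F k y) \<partial>halfline) = T k" for k
    unfolding nF integral_mult_right_zero mom[symmetric] by simp
  have FS: "(\<lambda>k. F k y) sums (y * sin y * exp (- b * y\<^sup>2))" for y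
    using sums_mult[OF sin_paired[of y], of "y * exp (- b * y\<^sup>2)"] by (simp add: F_def mult_ac power2_eq_square)
  have summ1: "summable (\<lambda>k. norm (F k y))" for y
  proof -
    have "summable ((\<lambda>n. \<bar>y\<bar> ^ n /\<^sub>R fact n) \<circ> (\<lambda>k. 2 * k + 1))"
      by (rule summable_reindex[OF summable_exp_generic]) (auto intro: injI)
    then have "summable (\<lambda>k. \<bar>y\<bar> * exp (- b * y\<^sup>2) * (\<bar>y\<bar> ^ (2 * k + 1) /\<^sub>R fact (2 * k + 1)))"
      unfolding o_def by (rule summable_mult)
    also have "(\<lambda>k. \<bar>y\<bar> * exp (- b * y\<^sup>2) * (\<bar>y\<bar> ^ (2 * k + 1) /\<^sub>R fact (2 * k + 1))) = (\<lambda>k. norm (F k y))"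
    proof
      fix k
      have "y ^ (2 * k + 2) = \<bar>y\<bar> ^ (2 * k + 2)" by (rule power_even_abs[symmetric]) simp
      also have "\<dots> = \<bar>y\<bar> * \<bar>y\<bar> ^ (2 * k + 1)"
      proof -
        have "2 * k + 2 = Suc (2 * k + 1)" by simp
        show ?thesis unfolding \<open>2 * k + 2 = Suc (2 * k + 1)\<close> by (rule power_Suc)
      qed
      finally show "\<bar>y\<bar> * exp (- b * y\<^sup>2) * (\<bar>y\<bar> ^ (2 * k + 1) /\<^sub>R fact (2 * k + 1)) = norm (F k y)"
        unfolding nF by (simp only: real_scaleR_def divide_inverse mult_ac)
    qed
    finally show ?thesis .
  qed
  have es: "(\<lambda>k. x ^ k / fact k) sums exp x" for x :: real
    using exp_converges[of x] by (simp add: divide_inverse mult.commute)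
  have T: "T sums (sqrt pi / 4 * b powr (- 3 / 2) * exp (1 / (4 * b)))"
    unfolding T_def by (intro sums_mult es)
  have T': "(\<lambda>k. (- 1) ^ k * T k) sums (sqrt pi / 4 * b powr (- 3 / 2) * exp (- 1 / (4 * b)))"
  proof -
    have "(- 1) ^ k * T k = sqrt pi / 4 * b powr (- 3 / 2) * ((- 1 / (4 * b)) ^ k / fact k)" for k
    proof -
      have "(- 1 / (4 * b)) ^ k = ((- 1) * (1 / (4 * b))) ^ k" by simp
      also have "\<dots> = (- 1) ^ k * (1 / (4 * b)) ^ k" by (rule power_mult_distrib)
      finally have e: "(- 1 / (4 * b)) ^ k = (- 1) ^ k * (1 / (4 * b)) ^ k" .
      have "s * (C * (X / f)) = C * (s * X / f)" for s C X f :: real by simp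
      then show ?thesis unfolding T_def e .
    qed
    then have "(\<lambda>k. (- 1) ^ k * T k) = (\<lambda>k. sqrt pi / 4 * b powr (- 3 / 2) * ((- 1 / (4 * b)) ^ k / fact k))" by (rule ext)
    then show ?thesis by (rule ssubst) (rule sums_mult[OF es])
  qed
  have AE: "AE y in halfline. summable (\<lambda>k. norm (F k y))"
    by (rule AE_I2) (rule summ1)
  have summ2: "summable (\<lambda>k. \<integral>y. norm (F k y) \<partial>halfline)"
    unfolding nFval by (rule sums_summable[OF T])
  have "(\<lambda>y. \<Sum>k. F k y) = (\<lambda>y. y * sin y * exp (- b * y\<^sup>2))"
    by (rule ext) (rule sums_unique[OF FS, symmetric])
  then have "(\<integral>y. y * sin y * exp (- b * y\<^sup>2) \<partial>halfline) = (\<Sum>k. \<integral>y. F k y \<partial>halfline)"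
    using integral_suminf[OF Fint AE summ2] by simp
  also have "\<dots> = (\<Sum>k. (- 1) ^ k * T k)"
    by (simp only: Fval)
  also have "\<dots> = sqrt pi / 4 * b powr (- 3 / 2) * exp (- 1 / (4 * b))"
    by (rule sums_unique[OF T', symmetric])
  finally show ?thesis .
qed

definition \<omega> :: complex where "\<omega> = exp (\<i> * of_real (pi / 4))"

lemma \<omega>_Complex: "\<omega> = Complex (1 / sqrt 2) (1 / sqrt 2)"
  by (simp add: \<omega>_def exp_eq_polar cis.ctr cos_45 sin_45 real_div_sqrt field_simps)

lemma \<omega>_simps [simp]: "Re \<omega> = 1 / sqrt 2" "Im \<omega> = 1 / sqrt 2" "\<omega>\<^sup>2 = \<i>" "Re \<omega> > 0" "norm \<omega> = 1" "\<omega> \<noteq> 0"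
proof -
  show "Re \<omega> = 1 / sqrt 2" "Im \<omega> = 1 / sqrt 2" by (simp_all add: \<omega>_Complex)
  show "\<omega>\<^sup>2 = \<i>" by (simp add: \<omega>_Complex complex_eq_iff power2_eq_square)
  show "Re \<omega> > 0" by (simp add: \<omega>_Complex)
  show "norm \<omega> = 1" by (simp add: \<omega>_def norm_exp_eq_Re)
  then show "\<omega> \<noteq> 0" by auto
qed

lemma integrable_linear_exp:
  assumes "r > 0"
  shows "integrable halfline (\<lambda>t. t * exp (- r * t))"
proof -
  have "integrable halfline (\<lambda>t. t powr (2 - 1) * exp (- r * t)) \<longleftrightarrow> integrable halfline (\<lambda>t. t * exp (- r * t))"
    by (rule Bochner_Integration.integrable_cong) auto
  then show ?thesis using integrable_powr_exp[of 2 r] assms by simp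
qed

text \<open>
  The substitution \<open>t \<mapsto> \<rho> t\<close> shows that the integral of \<open>g \<rho>\<close> is constant for real \<open>\<rho> > 0\<close>, hence on
  the sector where it is holomorphic; letting \<open>\<rho>\<close> tend to the boundary point \<open>cnj \<omega>\<close> performs the rotation.
\<close>

lemma gaussian_rotation:
  assumes b: "b > 0"
  shows "(\<integral>t. of_real t * exp (- \<omega> * of_real t + \<i> * of_real (b * t\<^sup>2)) \<partial>halfline) =
         \<i> * (\<integral>t. of_real t * exp (- \<i> * of_real t - of_real (b * t\<^sup>2)) \<partial>halfline)"
proof -
  \<comment> \<open>The sector Re (\<rho>^2) > 0, where the Gaussian factor decays;
    \<open>cnj \<omega>\<close> lies on its boundary.\<close>
  define S where "S = {\<rho>::complex. \<bar>Im \<rho>\<bar> < Re \<rho>}"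
  \<comment> \<open>The factor \<rho>^2 collects the Jacobian and the linear factor under t ->
    \<rho> t.\<close>
  define g where "g \<rho> t = \<rho>\<^sup>2 * (of_real t * exp (- \<i> * \<rho> * of_real t - \<rho>\<^sup>2 * of_real (b * t\<^sup>2)))" for \<rho> :: complex and t :: real
  have S: "open S" "connected S"
  proof -
    have "S = {\<rho>. Re \<rho> - Im \<rho> > 0} \<inter> {\<rho>. Re \<rho> + Im \<rho> > 0}" by (auto simp: S_def)
    moreover have "open {\<rho>. Re \<rho> - Im \<rho> > 0}" "open {\<rho>. Re \<rho> + Im \<rho> > 0}"
      by (intro open_Collect_less continuous_intros)+
    ultimately show "open S" by auto
    have "convex S"
    proof (rule convexI)
      fix x y :: complex and u v :: real
      assume xy: "x \<in> S" "y \<in> S" and uv: "0 \<le> u" "0 \<le> v" "u + v = 1"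
      have "\<bar>u * Im x + v * Im y\<bar> \<le> u * \<bar>Im x\<bar> + v * \<bar>Im y\<bar>"
        using uv abs_triangle_ineq[of "u * Im x" "v * Im y"] by (simp add: abs_mult)
      also have "\<dots> < u * Re x + v * Re y"
      proof (cases "u = 0")
        case False
        then have "u * \<bar>Im x\<bar> < u * Re x" using uv xy by (simp add: S_def)
        moreover have "v * \<bar>Im y\<bar> \<le> v * Re y" using uv xy by (intro mult_left_mono) (auto simp: S_def)
        ultimately show ?thesis by simp
      qed (use uv xy in \<open>auto simp: S_def\<close>)
      finally show "u *\<^sub>R x + v *\<^sub>R y \<in> S" by (simp add: S_def)
    qed
    then show "connected S" by (rule convex_connected)
  qed
  have Re2: "Re (\<rho>\<^sup>2) = (Re \<rho> - \<bar>Im \<rho>\<bar>) * (Re \<rho> + \<bar>Im \<rho>\<bar>)" for \<rho>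
    by (simp add: power2_eq_square algebra_simps)
  have norm_g: "norm (g \<rho> t) = (norm \<rho>)\<^sup>2 * (\<bar>t\<bar> * exp (Im \<rho> * t - Re (\<rho>\<^sup>2) * (b * t\<^sup>2)))" for \<rho> t
    unfolding g_def by (simp add: norm_mult norm_power norm_exp_eq_Re)
  have F: "(\<lambda>\<rho>. \<integral>t. g \<rho> t \<partial>halfline) holomorphic_on S"
  proof (rule holomorphic_integral[OF S(1)])
    show "g \<rho> \<in> borel_measurable halfline" for \<rho>
      unfolding g_def by (intro measurable_restrict_space1) measurable
    show "(\<lambda>\<rho>. g \<rho> t) holomorphic_on S" for t unfolding g_def by (intro holomorphic_intros)
    fix z assume z: "z \<in> S"
    define m where "m = Re (z\<^sup>2) / 2"
    define M where "M = norm z + 1"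
    have m: "m > 0" "Re (z\<^sup>2) > m" using z unfolding m_def Re2 by (auto simp: S_def intro!: mult_pos_pos)
    have M: "M > 0" by (simp add: M_def add_nonneg_pos)
    have "((\<lambda>w. Re (w\<^sup>2)) \<longlongrightarrow> Re (z\<^sup>2)) (nhds z)"
      by (intro tendsto_intros filterlim_ident)
    then have "\<forall>\<^sub>F w in nhds z. Re (w\<^sup>2) > m"
      using m(2) by (rule order_tendstoD(1))
    then obtain r where r: "r > 0" "\<And>w. dist w z < r \<Longrightarrow> Re (w\<^sup>2) > m" by (auto simp: eventually_nhds_metric)
    \<comment> \<open>Completing the square: (M + 1) t - m b t^2 is at most (M + 1)^2 / (4 m b).
      Using M + 1 instead of M leaves a spare exp (- t) for integrability.\<close>
    define C where "C = M\<^sup>2 * exp ((M + 1)\<^sup>2 / (4 * (m * b)))"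
    have "norm (g w t) \<le> C * (t * exp (- 1 * t))" if w: "w \<in> ball z (min r 1)" and t: "t > 0" for w t
    proof -
      have "norm w \<le> norm z + dist w z" using norm_triangle_sub[of w z] by (simp add: dist_norm)
      then have nw: "norm w \<le> M" using w by (auto simp: M_def dist_commute)
      have "m \<le> Re (w\<^sup>2)" using r(2)[of w] w by (auto simp: dist_commute)
      then have 1: "m * (b * t\<^sup>2) \<le> Re (w\<^sup>2) * (b * t\<^sup>2)" using b by (intro mult_right_mono) auto
      have 2: "Im w * t \<le> M * t" using nw abs_Im_le_cmod[of w] t by (intro mult_right_mono) auto
      have "0 \<le> (M + 1 - 2 * (m * b) * t)\<^sup>2" by simp
      then have "4 * (m * b) * ((M + 1) * t - m * b * t\<^sup>2) \<le> (M + 1)\<^sup>2"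
        by (simp add: power2_eq_square algebra_simps)
      then have 3: "(M + 1) * t - m * (b * t\<^sup>2) \<le> (M + 1)\<^sup>2 / (4 * (m * b))"
        using m b by (simp add: pos_le_divide_eq mult_ac)
      have "Im w * t - Re (w\<^sup>2) * (b * t\<^sup>2) \<le> (M + 1)\<^sup>2 / (4 * (m * b)) + - 1 * t"
        using 1 2 3 by (simp add: algebra_simps)
      then have e: "exp (Im w * t - Re (w\<^sup>2) * (b * t\<^sup>2)) \<le> exp ((M + 1)\<^sup>2 / (4 * (m * b))) * exp (- 1 * t)"
        by (simp flip: exp_add)
      have "norm (g w t) \<le> M\<^sup>2 * (t * (exp ((M + 1)\<^sup>2 / (4 * (m * b))) * exp (- 1 * t)))"
        unfolding norm_g using t nw by (intro mult_mono power_mono mult_mono e) auto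
      then show ?thesis by (simp add: C_def mult_ac)
    qed
    then show "\<exists>r>0. \<exists>h. integrable halfline h \<and> (\<forall>w\<in>ball z r \<inter> S. \<forall>t\<in>space halfline. norm (g w t) \<le> h t)"
      using r(1) integrable_linear_exp[of 1]
      by (intro exI[of _ "min r 1"] conjI exI[of _ "\<lambda>t. C * (t * exp (- 1 * t))"]) auto
  qed
  have const: "(\<integral>t. g \<rho> t \<partial>halfline) = (\<integral>t. g 1 t \<partial>halfline)" if "\<rho> \<in> S" for \<rho>
  proof (rule holomorphic_eq_on_real_interval[OF F _ S zero_less_one _ that])
    fix x :: real assume x: "0 < x" "x < 1"
    have "g (of_real x) t = of_real x * g 1 (x * t)" for t
      by (simp add: g_def power2_eq_square mult_ac)
    then have "(\<integral>t. g (of_real x) t \<partial>halfline) = of_real x * (\<integral>t. g 1 (x * t) \<partial>halfline)"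
      by simp
    then show "complex_of_real x \<in> S \<and> (\<integral>t. g (of_real x) t \<partial>halfline) = (\<integral>t. g 1 t \<partial>halfline)"
      unfolding integral_halfline_scale[OF x(1)] using x by (simp add: S_def scaleR_conv_of_real)
  qed simp
  \<comment> \<open>In the limit the Gaussian factor only oscillates, so the decay must come from
    exp (Im \<rho> t). With n + 2 the factor 1 - 1 / (n + 2) is at least 1/2, which gives the
    uniform rate 1 / (2 sqrt 2) while each point stays inside the sector.\<close>
  define \<rho> where "\<rho> n = Complex (1 / sqrt 2) (- (1 - 1 / real (n + 2)) / sqrt 2)" for n
  have \<rho>S: "\<rho> n \<in> S" for n
  proof -
    have q: "0 < 1 / real (n + 2)" "1 / real (n + 2) < 1" by auto
    then have "\<bar>- (1 - 1 / real (n + 2)) / sqrt 2\<bar> = (1 - 1 / real (n + 2)) / sqrt 2"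
      by (simp only: abs_divide abs_minus_cancel) simp
    also have "\<dots> < 1 / sqrt 2" using q by (intro divide_strict_right_mono) auto
    finally show ?thesis by (simp add: \<rho>_def S_def)
  qed
  have \<rho>lim: "\<rho> \<longlonglongrightarrow> cnj \<omega>"
  proof -
    have "(\<lambda>n. 1 / real (n + 2)) \<longlonglongrightarrow> 0" by real_asymp
    then have "(\<lambda>n. - (1 - 1 / real (n + 2)) / sqrt 2) \<longlonglongrightarrow> - (1 - 0) / sqrt 2"
      by (intro tendsto_intros) auto
    then show ?thesis unfolding \<rho>_def by (subst tendsto_complex_iff) simp
  qed
  have i\<omega>: "\<i> * cnj \<omega> = \<omega>" "(cnj \<omega>)\<^sup>2 = - \<i>"
  proof -
    show "\<i> * cnj \<omega> = \<omega>" by (simp add: complex_eq_iff)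
    show "(cnj \<omega>)\<^sup>2 = - \<i>" by (simp only: complex_cnj_power[symmetric] \<omega>_simps(3) complex_cnj_i)
  qed
  have meas: "g z \<in> borel_measurable halfline" for z
    unfolding g_def by (intro measurable_restrict_space1) measurable
  have lim: "(\<lambda>n. \<integral>t. g (\<rho> n) t \<partial>halfline) \<longlonglongrightarrow> (\<integral>t. g (cnj \<omega>) t \<partial>halfline)"
  proof (rule integral_dominated_convergence[where w = "\<lambda>t. t * exp (- (1 / (2 * sqrt 2)) * t)"])
    show "integrable halfline (\<lambda>t. t * exp (- (1 / (2 * sqrt 2)) * t))" by (rule integrable_linear_exp) simp
    show "AE t in halfline. (\<lambda>n. g (\<rho> n) t) \<longlonglongrightarrow> g (cnj \<omega>) t"
      unfolding g_def by (intro AE_I2 tendsto_intros \<rho>lim)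
    show "AE t in halfline. norm (g (\<rho> n) t) \<le> t * exp (- (1 / (2 * sqrt 2)) * t)" for n
    proof (rule AE_I2)
      fix t assume "t \<in> space halfline"
      then have t: "t > 0" by simp
      have "1 / real (n + 2) \<le> 1 / 2" by simp
      then have "(1 / 2) / sqrt 2 \<le> (1 - 1 / real (n + 2)) / sqrt 2" by (intro divide_right_mono) auto
      moreover have "Im (\<rho> n) = - ((1 - 1 / real (n + 2)) / sqrt 2)" by (simp only: \<rho>_def complex.sel minus_divide_left)
      ultimately have I: "Im (\<rho> n) \<le> - (1 / (2 * sqrt 2))" by simp
      have ImRe: "\<bar>Im (\<rho> n)\<bar> < Re (\<rho> n)" using \<rho>S[of n] by (simp only: S_def mem_Collect_eq)
      have Re: "Re (\<rho> n) = 1 / sqrt 2" by (simp only: \<rho>_def complex.sel)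
      have R: "Re ((\<rho> n)\<^sup>2) \<ge> 0" unfolding Re2 using ImRe by (intro mult_nonneg_nonneg) linarith+
      have "\<bar>Im (\<rho> n)\<bar> \<le> 1 / sqrt 2" using ImRe unfolding Re by linarith
      then have "\<bar>Im (\<rho> n)\<bar>\<^sup>2 \<le> (1 / sqrt 2)\<^sup>2" by (rule power_mono) simp
      then have N: "(norm (\<rho> n))\<^sup>2 \<le> 1" unfolding cmod_power2 Re by (simp add: power_divide)
      have "Im (\<rho> n) * t - Re ((\<rho> n)\<^sup>2) * (b * t\<^sup>2) \<le> - (1 / (2 * sqrt 2)) * t - 0"
        using I R t b by (intro diff_mono mult_right_mono mult_nonneg_nonneg) auto
      then have "norm (g (\<rho> n) t) \<le> 1 * (t * exp (- (1 / (2 * sqrt 2)) * t))"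
        unfolding norm_g using t N by (intro mult_mono) auto
      then show "norm (g (\<rho> n) t) \<le> t * exp (- (1 / (2 * sqrt 2)) * t)" by simp
    qed
  qed (rule meas)+
  have "(\<lambda>n::nat. \<integral>t. g 1 t \<partial>halfline) \<longlonglongrightarrow> (\<integral>t. g (cnj \<omega>) t \<partial>halfline)"
    using lim by (simp only: const[OF \<rho>S])
  then have "(\<integral>t. g (cnj \<omega>) t \<partial>halfline) = (\<integral>t. g 1 t \<partial>halfline)"
    by (simp only: LIMSEQ_const_iff)
  also have "g (cnj \<omega>) = (\<lambda>t. - \<i> * (of_real t * exp (- \<omega> * of_real t + \<i> * of_real (b * t\<^sup>2))))"
  proof
    fix t
    have "- \<i> * cnj \<omega> * of_real t = - \<omega> * of_real t"
      by (simp only: mult_minus_left i\<omega>(1))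
    then show "g (cnj \<omega>) t = - \<i> * (of_real t * exp (- \<omega> * of_real t + \<i> * of_real (b * t\<^sup>2)))"
      unfolding g_def i\<omega>(2) by (simp only:) simp
  qed
  finally have A: "- \<i> * (\<integral>t. of_real t * exp (- \<omega> * of_real t + \<i> * of_real (b * t\<^sup>2)) \<partial>halfline) = (\<integral>t. g 1 t \<partial>halfline)"
    by (simp only: integral_mult_right_zero)
  have B: "g 1 = (\<lambda>t. of_real t * exp (- \<i> * of_real t - of_real (b * t\<^sup>2)))"
    by (rule ext) (simp add: g_def)
  have C: "X = \<i> * Y" if "- \<i> * X = Y" for X Y :: complex
    unfolding that[symmetric] by (simp only: mult.assoc[symmetric]) simp
  from C[OF A] show ?thesis unfolding B .
qed

text \<open>Rotation gives U = i V, so the real part of U sees only the sine part of V; the cosine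
  part is the imaginary part of U and cancels against the conjugate. This is the effect of the
  second bracket term.\<close>

lemma gaussian_rotation_value:
  assumes b: "b > 0"
  defines "U \<equiv> \<integral>t. of_real t * exp (- \<omega> * of_real t + \<i> * of_real (b * t\<^sup>2)) \<partial>halfline"
  shows "U + cnj U = of_real (sqrt pi / 2 * b powr (- 3 / 2) * exp (- 1 / (4 * b)))"
proof -
  define V where "V = (\<integral>t. of_real t * exp (- \<i> * of_real t - of_real (b * t\<^sup>2)) \<partial>halfline)"
  have "integrable halfline (\<lambda>t. complex_of_real t * exp (- \<i> * of_real t - of_real (b * t\<^sup>2)))"
  proof (rule Bochner_Integration.integrable_bound[OF gaussian_moment(1)[OF b, of 1]])
    show "(\<lambda>t. complex_of_real t * exp (- \<i> * of_real t - of_real (b * t\<^sup>2))) \<in> borel_measurable halfline"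
      by (intro measurable_restrict_space1) measurable
  qed (auto simp: norm_mult norm_exp_eq_Re)
  then have "Im V = (\<integral>t. Im (of_real t * exp (- \<i> * of_real t - of_real (b * t\<^sup>2))) \<partial>halfline)"
    unfolding V_def by (rule integral_Im[symmetric])
  also have "\<dots> = (\<integral>t. - (t * sin t * exp (- b * t\<^sup>2)) \<partial>halfline)"
    by (intro Bochner_Integration.integral_cong) (auto simp: Im_exp mult_ac)
  also have "\<dots> = - (sqrt pi / 4 * b powr (- 3 / 2) * exp (- 1 / (4 * b)))"
    using gaussian_sine_integral[OF b] by simp
  finally have "Im V = - (sqrt pi / 4 * b powr (- 3 / 2) * exp (- 1 / (4 * b)))" .
  moreover have "U = \<i> * V" unfolding U_def V_def by (rule gaussian_rotation[OF b])
  ultimately have "2 * Re U = sqrt pi / 2 * b powr (- 3 / 2) * exp (- 1 / (4 * b))" by simp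
  then show ?thesis unfolding complex_add_cnj by (simp only:)
qed

section \<open>The integral for positive real argument\<close>

interpretation lborel_halfline: pair_sigma_finite lborel halfline
  by (intro pair_sigma_finite.intro sigma_finite_lborel halfline.sigma_finite_measure_axioms)

interpretation halfline_halfline: pair_sigma_finite halfline halfline
  by (intro pair_sigma_finite.intro halfline.sigma_finite_measure_axioms)

lemma fst_halfline_measurable:
  "(\<lambda>z. fst z) \<in> borel_measurable (lborel \<Otimes>\<^sub>M M)"
  "(\<lambda>z. fst z) \<in> borel_measurable (halfline \<Otimes>\<^sub>M M)"
  by (rule measurable_compose[OF measurable_fst], auto intro: measurable_restrict_space1)+

lemma snd_halfline_measurable:
  "(\<lambda>z. snd z) \<in> borel_measurable (M \<Otimes>\<^sub>M halfline)"
  by (rule measurable_compose[OF measurable_snd]) (auto intro: measurable_restrict_space1)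

lemma exp_kernel_integral_cnj: "cnj (exp_kernel_integral p q \<mu>) = exp_kernel_integral (cnj p) (cnj q) \<mu>"
proof -
  have "exp_kernel (cnj p) (cnj q) \<mu> t = cnj (exp_kernel p q \<mu> t)" for t
    by (simp add: exp_kernel_def exp_cnj)
  then show ?thesis by (simp add: exp_kernel_integral_def)
qed

lemma Bessel_K_cnj:
  assumes "Re w > 0"
  shows "Bessel_K \<nu> (cnj w) = cnj (Bessel_K \<nu> w)"
  using assms by (simp add: Bessel_K_eq_integral exp_kernel_integral_cnj)

lemma Bessel_Clifford_of_real_in_Reals: "Bessel_Clifford (of_real \<nu>) (of_real y) \<in> \<real>"
proof -
  have eq: "rGamma (of_real \<nu> + of_nat k + 1) / fact k * of_real y ^ k = complex_of_real (rGamma (\<nu> + real k + 1) / fact k * y ^ k)" for k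
    by (simp add: rGamma_complex_of_real[symmetric])
  have "summable (\<lambda>k. complex_of_real (rGamma (\<nu> + real k + 1) / fact k * y ^ k))"
    using summable_norm_cancel[OF Bessel_Clifford_summable_norm[of "of_real \<nu>" "of_real y"]] unfolding eq .
  then have "Bessel_Clifford (of_real \<nu>) (of_real y) = of_real (\<Sum>k. rGamma (\<nu> + real k + 1) / fact k * y ^ k)"
    unfolding Bessel_Clifford_def eq by (simp only: suminf_of_real summable_complex_of_real)
  then show ?thesis by (metis Reals_of_real)
qed

locale Bessel_JK =
  fixes \<nu> x :: real
  assumes \<nu>: "\<nu> \<ge> - 1 / 2" and x: "x > 0"
begin

abbreviation "a \<equiv> \<nu> + 3 / 2"

definition B :: "real \<Rightarrow> complex" where
  "B c = Bessel_Clifford (of_real \<nu>) (- ((of_real (c * x) / 2)\<^sup>2))"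

lemma B_Reals: "B c \<in> \<real>"
proof -
  have "- ((complex_of_real (c * x) / 2)\<^sup>2) = of_real (- ((c * x / 2)\<^sup>2))" by simp
  then show ?thesis unfolding B_def using Bessel_Clifford_of_real_in_Reals by metis
qed

lemma Bessel_J_B:
  assumes "c > 0"
  shows "Bessel_J \<nu> (of_real c * of_real x) = of_real (c powr \<nu> * (x / 2) powr \<nu>) * B c"
proof -
  have "(of_real c * complex_of_real x / 2) powr of_real \<nu> = of_real ((c * (x / 2)) powr \<nu>)"
    using assms x powr_of_real[of "c * (x / 2)" \<nu>] by simp
  also have "(c * (x / 2)) powr \<nu> = c powr \<nu> * (x / 2) powr \<nu>"
    using assms x by (simp only: powr_mult)
  finally show ?thesis by (simp add: Bessel_J_Clifford B_def)
qed

section \<open>First exchange: the Laplace transform inside the integral for K\<close>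

definition \<Phi> :: "real \<Rightarrow> real \<Rightarrow> complex" where
  "\<Phi> t c = of_real (c powr (2 * \<nu> + 1)) * B c * exp_kernel \<omega> (\<omega> * of_real c) (2 * \<nu>) t"

text \<open>Majorant for \<open>\<Phi>\<close> up to a constant: the Bessel factor is replaced by 1
  and the kernel by its modulus. The exponent is left as 2 \<nu> + 2 - 1 to match the Gamma integral
  with s = 2 \<nu> + 2.\<close>

definition D :: "real \<Rightarrow> real \<Rightarrow> real" where
  "D t c = exp (- (1 / sqrt 2) * exp t - 2 * \<nu> * t) * (c powr (2 * \<nu> + 2 - 1) * exp (- ((1 / sqrt 2) * exp (- t)) * c))"

text \<open>The c-integral grows like exp ((2 \<nu> + 2) t); together with exp (- 2 \<nu> t) this
  leaves exp (2 t) against the double exponential, a kernel of order -2 with vanishing second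
  parameter, which is integrable.\<close>

lemma D_integrable: "integrable (lborel \<Otimes>\<^sub>M halfline) (\<lambda>(t, c). D t c)"
proof (rule lborel_halfline.Fubini_integrable)
  note [measurable] = fst_halfline_measurable snd_halfline_measurable
  show "(\<lambda>(t, c). D t c) \<in> borel_measurable (lborel \<Otimes>\<^sub>M halfline)"
    unfolding D_def split_beta by measurable
  have s: "2 * \<nu> + 2 > 0" using \<nu> by simp
  have r: "(1 / sqrt 2) * exp (- t) > 0" for t by simp
  have int: "integrable halfline (\<lambda>c. D t c)" for t
    unfolding D_def by (intro integrable_mult_right integrable_powr_exp s r)
  then show "AE t in lborel. integrable halfline (\<lambda>c. case (t, c) of (t, c) \<Rightarrow> D t c)" by simp
  have "(\<integral>c. norm (D t c) \<partial>halfline) = Gamma (2 * \<nu> + 2) * (1 / sqrt 2) powr (- (2 * \<nu> + 2)) *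
      exp (- (1 / sqrt 2) * exp t - (- 2) * t)" for t
  proof -
    have "(\<integral>c. norm (D t c) \<partial>halfline) = exp (- (1 / sqrt 2) * exp t - 2 * \<nu> * t) *
        (Gamma (2 * \<nu> + 2) * ((1 / sqrt 2) * exp (- t)) powr (- (2 * \<nu> + 2)))"
      unfolding D_def using laplace_power_real(2)[OF s r] by (simp only: norm_mult) simp
    also have "((1 / sqrt 2) * exp (- t)) powr (- (2 * \<nu> + 2)) = (1 / sqrt 2) powr (- (2 * \<nu> + 2)) * exp (t * (2 * \<nu> + 2))"
      by (subst powr_mult) (auto simp: exp_powr_real algebra_simps)
    also have "exp (- (1 / sqrt 2) * exp t - 2 * \<nu> * t) * (Gamma (2 * \<nu> + 2) * ((1 / sqrt 2) powr (- (2 * \<nu> + 2)) * exp (t * (2 * \<nu> + 2)))) =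
       Gamma (2 * \<nu> + 2) * (1 / sqrt 2) powr (- (2 * \<nu> + 2)) * (exp (- (1 / sqrt 2) * exp t - 2 * \<nu> * t) * exp (t * (2 * \<nu> + 2)))"
      by (simp only: mult_ac)
    also have "exp (- (1 / sqrt 2) * exp t - 2 * \<nu> * t) * exp (t * (2 * \<nu> + 2)) = exp (- (1 / sqrt 2) * exp t - (- 2) * t)"
      unfolding exp_add[symmetric] by (rule arg_cong[of _ _ exp]) (simp add: algebra_simps)
    finally show ?thesis .
  qed
  moreover have "integrable lborel (\<lambda>t. exp (- (1 / sqrt 2) * exp t - (- 2) * t))"
    by (rule integrable_exp_kernel_real_0) auto
  ultimately show "integrable lborel (\<lambda>t. \<integral>c. norm (case (t, c) of (t, c) \<Rightarrow> D t c) \<partial>halfline)"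
    by simp
qed

lemma \<Phi>_integrable: "integrable (lborel \<Otimes>\<^sub>M halfline) (\<lambda>(t, c). \<Phi> t c)"
proof -
  obtain C where C: "C > 0" "\<And>x. norm (Bessel_Clifford (of_real \<nu>) (- ((of_real x / 2)\<^sup>2))) \<le> C"
    using Bessel_Clifford_neg_real_bounded[OF \<nu>] by blast
  have "continuous_on UNIV B" unfolding B_def by (intro continuous_intros) auto
  then have "B \<in> borel_measurable borel" by (rule borel_measurable_continuous_onI)
  note [measurable] = fst_halfline_measurable snd_halfline_measurable this
  show ?thesis
  proof (rule Bochner_Integration.integrable_bound[OF integrable_mult_right[OF D_integrable, of C]])
    show "(\<lambda>(t, c). \<Phi> t c) \<in> borel_measurable (lborel \<Otimes>\<^sub>M halfline)"
      unfolding \<Phi>_def exp_kernel_def split_beta by measurable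
    show "AE z in lborel \<Otimes>\<^sub>M halfline. norm (case z of (t, c) \<Rightarrow> \<Phi> t c) \<le> norm (C * (case z of (t, c) \<Rightarrow> D t c))"
    proof (rule AE_I2, clarify)
      fix t c :: real
      have "norm (B c) \<le> C" using C(2)[of "c * x"] by (simp add: B_def)
      then have le: "c powr (2 * \<nu> + 1) * norm (B c) * E \<le> c powr (2 * \<nu> + 1) * C * E" if "E \<ge> 0" for E
        using that by (intro mult_right_mono mult_left_mono) auto
      have "norm (exp_kernel \<omega> (\<omega> * of_real c) (2 * \<nu>) t) =
         exp (- (1 / sqrt 2) * exp t - 2 * \<nu> * t) * exp (- ((1 / sqrt 2) * exp (- t)) * c)"
        unfolding norm_exp_kernel exp_add[symmetric] by (rule arg_cong[of _ _ exp]) simp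
      moreover have "2 * \<nu> + 2 - 1 = 2 * \<nu> + 1" by simp
      ultimately have "C * D t c = c powr (2 * \<nu> + 1) * C * norm (exp_kernel \<omega> (\<omega> * of_real c) (2 * \<nu>) t)"
        unfolding D_def by (simp only: mult_ac)
      moreover have "norm (\<Phi> t c) = c powr (2 * \<nu> + 1) * norm (B c) * norm (exp_kernel \<omega> (\<omega> * of_real c) (2 * \<nu>) t)"
        unfolding \<Phi>_def norm_mult norm_of_real by simp
      ultimately have "norm (\<Phi> t c) \<le> C * D t c"
        using le[OF norm_ge_zero, of "exp_kernel \<omega> (\<omega> * of_real c) (2 * \<nu>) t"] by (simp only:)
      then show "norm (\<Phi> t c) \<le> norm (C * D t c)" by simp
    qed
  qed
qed

text \<open>The part of the integrand that belongs to the first bracket term; for real x the second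
  term contributes its complex conjugate.\<close>

definition T :: "real \<Rightarrow> complex" where
  "T c = of_real ((x / 2) powr \<nu> / 2) * exp (\<i> * of_real ((\<nu> + 1) * pi / 2)) * (\<integral>t. \<Phi> t c \<partial>lborel)"

lemma T_integrable: "integrable halfline T"
  unfolding T_def by (intro integrable_mult_right lborel_halfline.integrable_snd \<Phi>_integrable)

lemma T_eq:
  assumes c: "c > 0"
  shows "T c = of_real c * Bessel_J \<nu> (of_real c * of_real x) * exp (\<i> * of_real ((\<nu> + 1) * pi / 2)) *
     Bessel_K (2 * \<nu>) (2 * \<omega> * of_real (sqrt c))"
proof -
  \<comment> \<open>Translation by half the logarithm of c balances the two kernel parameters: both
    become \<omega> sqrt c.\<close>
  define s where "s = ln c / 2"
  have es: "exp s = sqrt c" using c by (simp add: s_def ln_sqrt[symmetric])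
  have es': "c * exp (- s) = sqrt c"
    using c by (simp add: exp_minus es field_simps)
  have "exp_kernel_integral \<omega> (\<omega> * of_real c) (2 * \<nu>) = exp (- of_real (2 * \<nu> * s)) *
      exp_kernel_integral (\<omega> * of_real (exp s)) (\<omega> * of_real c * of_real (exp (- s))) (2 * \<nu>)"
    by (rule exp_kernel_integral_translate)
  also have "\<omega> * of_real c * of_real (exp (- s)) = \<omega> * of_real (sqrt c)"
    unfolding es'[symmetric] by simp
  also have "exp (- complex_of_real (2 * \<nu> * s)) = of_real (c powr (- \<nu>))"
    using c by (simp add: s_def powr_def flip: exp_of_real)
  also have "exp_kernel_integral (\<omega> * of_real (exp s)) (\<omega> * of_real (sqrt c)) (2 * \<nu>) =
     2 * Bessel_K (2 * \<nu>) (2 * \<omega> * of_real (sqrt c))"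
    using Bessel_K_eq_integral[of "2 * \<omega> * of_real (sqrt c)" "2 * \<nu>"] c by (simp add: es mult.commute)
  finally have K: "exp_kernel_integral \<omega> (\<omega> * of_real c) (2 * \<nu>) =
      of_real (c powr (- \<nu>)) * (2 * Bessel_K (2 * \<nu>) (2 * \<omega> * of_real (sqrt c)))" .
  have "(\<integral>t. \<Phi> t c \<partial>lborel) = of_real (c powr (2 * \<nu> + 1)) * B c * exp_kernel_integral \<omega> (\<omega> * of_real c) (2 * \<nu>)"
    unfolding \<Phi>_def integral_mult_right_zero exp_kernel_integral_def ..
  also have "\<dots> = of_real (c powr (2 * \<nu> + 1) * c powr (- \<nu>)) * (2 * B c * Bessel_K (2 * \<nu>) (2 * \<omega> * of_real (sqrt c)))"
    unfolding K by simp
  also have "c powr (2 * \<nu> + 1) * c powr (- \<nu>) = c * c powr \<nu>"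
    using c powr_add[of c 1 \<nu>] by (simp add: algebra_simps flip: powr_add)
  finally show ?thesis
    unfolding T_def Bessel_J_B[OF c] by simp
qed

text \<open>J is real on the positive axis, and K commutes with conjugation on the right
  half-plane.\<close>

lemma integrand_eq:
  assumes c: "c > 0"
  shows "Bessel_JK_integrand \<nu> (of_real x) c = T c + cnj (T c)"
proof -
  have cnj\<omega>: "exp (- \<i> * of_real (pi / 4)) = cnj \<omega>" by (simp add: \<omega>_def exp_cnj)
  have cnjE: "exp (- \<i> * of_real ((\<nu> + 1) * pi / 2)) = cnj (exp (\<i> * of_real ((\<nu> + 1) * pi / 2)))" by (simp add: exp_cnj)
  have "2 * cnj \<omega> * of_real (sqrt c) = cnj (2 * \<omega> * of_real (sqrt c))" by simp
  moreover have "Re (2 * \<omega> * of_real (sqrt c)) > 0" using c by simp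
  ultimately have K: "Bessel_K (2 * \<nu>) (2 * cnj \<omega> * of_real (sqrt c)) = cnj (Bessel_K (2 * \<nu>) (2 * \<omega> * of_real (sqrt c)))"
    using Bessel_K_cnj by metis
  have J: "cnj (Bessel_J \<nu> (of_real c * of_real x)) = Bessel_J \<nu> (of_real c * of_real x)"
    unfolding Bessel_J_B[OF c] using B_Reals[of c] by (simp add: Reals_cnj_iff)
  show ?thesis
    unfolding Bessel_JK_integrand_def T_eq[OF c] cnj\<omega> cnjE K \<omega>_def[symmetric] complex_cnj_mult J
    by (simp add: algebra_simps)
qed

text \<open>At p = \<omega> exp (- t) one has p^2 + x^2 = exp (- 2 t) * i * (1 - i x^2 exp (2 t)).
  Extracting i gives the constant phase and leaves a base of real part 1, to which the Gamma
  integral applies.\<close>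

lemma inner_integral:
  "(\<integral>c. \<Phi> t c \<partial>halfline) = of_real (2 powr (2 * \<nu> + 1) * Gamma a / sqrt pi) * (\<omega> * exp (- \<i> * of_real (pi * a / 2))) *
     (of_real (exp (2 * t)) * exp (- \<omega> * of_real (exp t)) * (1 - \<i> * of_real (x\<^sup>2 * exp (2 * t))) powr (- of_real a))"
proof -
  define p where "p = \<omega> * of_real (exp (- t))"
  have p: "Re p > 0" by (simp add: p_def)
  define k where "k = complex_of_real (2 powr (2 * \<nu> + 1) * Gamma a / sqrt pi)"
  define q where "q = 1 - \<i> * complex_of_real (x\<^sup>2 * exp (2 * t))"
  have q: "Re q > 0" "Im q < 0" using x by (auto simp: q_def)
  have "exp_kernel \<omega> (\<omega> * of_real c) (2 * \<nu>) t = exp (- \<omega> * of_real (exp t) - of_real (2 * \<nu> * t)) * exp (- p * of_real c)" for c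
    unfolding exp_kernel_def p_def exp_add[symmetric] by (rule arg_cong[of _ _ exp]) (simp add: algebra_simps)
  then have "\<Phi> t c = exp (- \<omega> * of_real (exp t) - of_real (2 * \<nu> * t)) * (of_real (c powr (2 * \<nu> + 1)) * B c * exp (- p * of_real c))" for c
    unfolding \<Phi>_def by (simp only: mult_ac)
  then have "(\<integral>c. \<Phi> t c \<partial>halfline) = exp (- \<omega> * of_real (exp t) - of_real (2 * \<nu> * t)) *
     (k * p * (p\<^sup>2 + of_real x ^ 2) powr (- of_real a))"
    using Bessel_Clifford_laplace[OF \<nu> x p] unfolding B_def k_def by (simp only: integral_mult_right_zero)
  also have "p\<^sup>2 + of_real x ^ 2 = of_real (exp (- 2 * t)) * (\<i> * q)"
  proof -
    have "p\<^sup>2 = \<i> * of_real (exp (- 2 * t))"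
      by (simp add: p_def power_mult_distrib exp_double[symmetric] flip: of_real_power)
    moreover have "complex_of_real (exp (- 2 * t)) * of_real (exp (2 * t)) = 1"
      unfolding of_real_mult[symmetric] exp_add[symmetric] by simp
    then have "complex_of_real (exp (- 2 * t)) * (\<i> * q) = \<i> * of_real (exp (- 2 * t)) + of_real x ^ 2"
      by (simp add: q_def algebra_simps flip: exp_of_real)
    ultimately show ?thesis by simp
  qed
  also have "(of_real (exp (- 2 * t)) * (\<i> * q)) powr (- of_real a) = of_real (exp (2 * a * t)) * (exp (- \<i> * of_real (pi * a / 2)) * q powr (- of_real a))"
  proof -
    \<comment> \<open>The argument of q lies strictly between - pi / 2 and pi / 2, so adding pi / 2
      for the factor i does not cross the branch cut.\<close>
    have "\<bar>Im (Ln q)\<bar> < pi / 2" using q(1) by (intro Re_Ln_pos_lt_imp)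
    then have "Ln (\<i> * q) = \<i> * of_real (pi / 2) + Ln q"
      using q by (subst Ln_times_simple) (auto simp: )
    then have "(\<i> * q) powr (- of_real a) = exp (- \<i> * of_real (pi * a / 2)) * q powr (- of_real a)"
    proof -
      assume L: "Ln (\<i> * q) = \<i> * of_real (pi / 2) + Ln q"
      have "- of_real a * (\<i> * of_real (pi / 2) + Ln q) = - \<i> * of_real (pi * a / 2) + - of_real a * Ln q"
        by (simp add: field_simps)
      then have "exp (- of_real a * Ln (\<i> * q)) = exp (- \<i> * of_real (pi * a / 2)) * exp (- of_real a * Ln q)"
        unfolding L exp_add[symmetric] by (rule arg_cong)
      moreover have "q \<noteq> 0" using q by auto
      ultimately show ?thesis by (simp only: powr_def) simp
    qed
    moreover have "complex_of_real (exp (- 2 * t)) powr (- of_real a) = of_real (exp (2 * a * t))"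
      using powr_of_real[of "exp (- 2 * t)" "- a"] by (simp add: exp_powr_real algebra_simps)
    ultimately show ?thesis by (subst powr_times_real_left) auto
  qed
  also have "exp (- \<omega> * of_real (exp t) - of_real (2 * \<nu> * t)) * (k * p * (of_real (exp (2 * a * t)) * (exp (- \<i> * of_real (pi * a / 2)) * q powr (- of_real a)))) =
    k * (\<omega> * exp (- \<i> * of_real (pi * a / 2))) * (of_real (exp (2 * t)) * exp (- \<omega> * of_real (exp t)) * q powr (- of_real a))"
  proof -
    have 1: "exp (- \<omega> * of_real (exp t) - of_real (2 * \<nu> * t)) = exp (- \<omega> * of_real (exp t)) * complex_of_real (exp (- 2 * \<nu> * t))"
      unfolding exp_of_real[symmetric] exp_add[symmetric] by (rule arg_cong[of _ _ exp]) simp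
    \<comment> \<open>Exponent count: - 2 \<nu> from the kernel, - 1 from p and 2 a = 2 \<nu> + 3
      from the power add up to 2.\<close>
    have 2: "complex_of_real (exp (- 2 * \<nu> * t)) * of_real (exp (- t)) * of_real (exp (2 * a * t)) = of_real (exp (2 * t))"
      unfolding of_real_mult[symmetric] exp_add[symmetric] by (simp add: algebra_simps)
    have "(E * A) * (k * (w * B) * (C * (h * Q))) = k * (w * h) * ((A * B * C) * E * Q)" for E A k w B C h Q :: complex
      by (simp only: mult_ac)
    then show ?thesis unfolding p_def 1 2[symmetric] .
  qed
  finally show ?thesis unfolding k_def q_def .
qed


section \<open>Second exchange: the Gamma integral and the Gaussian integral\<close>

definition U :: "real \<Rightarrow> complex" where
  "U b = (\<integral>t. of_real t * exp (- \<omega> * of_real t + \<i> * of_real (b * t\<^sup>2)) \<partial>halfline)"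

text \<open>Here t stands for exp of the former variable: exp (2 t) dt has become t dt. Integration
  over v restores the power with exponent - a, multiplied by Gamma a.\<close>

definition \<Psi> :: "real \<Rightarrow> real \<Rightarrow> complex" where
  "\<Psi> t v = of_real t * exp (- \<omega> * of_real t) * (of_real (v powr (a - 1)) * exp (- (1 - \<i> * of_real (x\<^sup>2 * t\<^sup>2)) * of_real v))"

lemma a_pos: "a > 0"
  using \<nu> by simp

text \<open>The factor exp (i x^2 t^2 v) has modulus 1, so the norm is a product of a function of t
  and a function of v.\<close>

lemma \<Psi>_integrable: "integrable (halfline \<Otimes>\<^sub>M halfline) (\<lambda>(t, v). \<Psi> t v)"
proof (rule halfline_halfline.Fubini_integrable)
  note [measurable] = fst_halfline_measurable snd_halfline_measurable
  show "(\<lambda>(t, v). \<Psi> t v) \<in> borel_measurable (halfline \<Otimes>\<^sub>M halfline)"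
    unfolding \<Psi>_def split_beta by measurable
  have q: "Re (1 - \<i> * of_real (x\<^sup>2 * t\<^sup>2)) > 0" for t by simp
  have "integrable halfline (\<Psi> t)" for t
    unfolding \<Psi>_def by (intro integrable_mult_right laplace_power(1) a_pos q)
  then show "AE t in halfline. integrable halfline (\<lambda>v. case (t, v) of (t, v) \<Rightarrow> \<Psi> t v)" by simp
  have "norm (\<Psi> t v) = \<bar>t\<bar> * exp (- (1 / sqrt 2) * t) * (v powr (a - 1) * exp (- 1 * v))" for t v
    unfolding \<Psi>_def norm_mult norm_exp_eq_Re by simp
  then have "(\<integral>v. norm (\<Psi> t v) \<partial>halfline) = \<bar>t\<bar> * exp (- (1 / sqrt 2) * t) * Gamma a" for t
    using laplace_power_real(2)[OF a_pos zero_less_one] by (simp only: integral_mult_right_zero) simp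
  moreover have "integrable halfline (\<lambda>t. \<bar>t\<bar> * exp (- (1 / sqrt 2) * t) * Gamma a)"
  proof -
    have "integrable halfline (\<lambda>t. t * exp (- (1 / sqrt 2) * t) * Gamma a)"
      by (intro integrable_mult_left integrable_linear_exp) simp
    then show ?thesis
      by (rule Bochner_Integration.integrable_cong[THEN iffD1, rotated -1]) auto
  qed
  ultimately show "integrable halfline (\<lambda>t. \<integral>v. norm (case (t, v) of (t, v) \<Rightarrow> \<Psi> t v) \<partial>halfline)"
    by simp
qed

lemma \<Psi>_inner_t: "(\<integral>t. \<Psi> t v \<partial>halfline) = of_real (v powr (a - 1) * exp (- v)) * U (v * x\<^sup>2)"
proof -
  have e: "exp (- \<omega> * of_real t) * exp (- (1 - \<i> * of_real (x\<^sup>2 * t\<^sup>2)) * of_real v) =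
      of_real (exp (- v)) * exp (- \<omega> * of_real t + \<i> * of_real (v * x\<^sup>2 * t\<^sup>2))" for t
    unfolding exp_of_real[symmetric] exp_add[symmetric] by (rule arg_cong[of _ _ exp]) (simp add: algebra_simps)
  have "\<Psi> t v = of_real (v powr (a - 1) * exp (- v)) * (of_real t * exp (- \<omega> * of_real t + \<i> * of_real (v * x\<^sup>2 * t\<^sup>2)))" for t
  proof -
    have "\<Psi> t v = of_real t * of_real (v powr (a - 1)) * (exp (- \<omega> * of_real t) * exp (- (1 - \<i> * of_real (x\<^sup>2 * t\<^sup>2)) * of_real v))"
      unfolding \<Psi>_def by (simp only: mult_ac)
    also have "\<dots> = of_real t * of_real (v powr (a - 1)) * (of_real (exp (- v)) * exp (- \<omega> * of_real t + \<i> * of_real (v * x\<^sup>2 * t\<^sup>2)))"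
      by (simp only: e)
    finally show ?thesis by (simp only: of_real_mult mult_ac)
  qed
  then show ?thesis unfolding U_def by (simp only: integral_mult_right_zero)
qed

lemma outer_integral:
  "(\<integral>t. of_real (exp (2 * t)) * exp (- \<omega> * of_real (exp t)) * (1 - \<i> * of_real (x\<^sup>2 * exp (2 * t))) powr (- of_real a) \<partial>lborel) =
   (\<integral>v. of_real (v powr (a - 1) * exp (- v)) * U (v * x\<^sup>2) \<partial>halfline) / of_real (Gamma a)"
proof -
  define f where "f \<tau> = of_real \<tau> * exp (- \<omega> * of_real \<tau>) * (of_real (Gamma a) * (1 - \<i> * of_real (x\<^sup>2 * \<tau>\<^sup>2)) powr (- of_real a))" for \<tau> :: real
  have q: "Re (1 - \<i> * of_real (x\<^sup>2 * t\<^sup>2)) > 0" for t by simp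
  have f: "f t = (\<integral>v. \<Psi> t v \<partial>halfline)" for t
    unfolding f_def \<Psi>_def integral_mult_right_zero laplace_power(2)[OF a_pos q] ..
  have fint: "integrable halfline f"
    unfolding f using halfline_halfline.integrable_fst[OF \<Psi>_integrable] .
  have e2: "exp (2 * t) = exp t * exp t" for t :: real by (simp flip: exp_add)
  have "of_real (Gamma a) * (\<integral>t. of_real (exp (2 * t)) * exp (- \<omega> * of_real (exp t)) * (1 - \<i> * of_real (x\<^sup>2 * exp (2 * t))) powr (- of_real a) \<partial>lborel) =
     (\<integral>t. exp t *\<^sub>R f (exp t) \<partial>lborel)"
    unfolding integral_mult_right_zero[symmetric]
    by (rule Bochner_Integration.integral_cong) (auto simp: f_def e2 power2_eq_square scaleR_conv_of_real)
  also have "\<dots> = (\<integral>t. (\<integral>v. \<Psi> t v \<partial>halfline) \<partial>halfline)"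
    using exp_substitution(2)[OF borel_measurable_integrable[OF fint] fint] f by simp
  also have "\<dots> = (\<integral>v. (\<integral>t. \<Psi> t v \<partial>halfline) \<partial>halfline)"
    using halfline_halfline.Fubini_integral[OF \<Psi>_integrable] ..
  also have "\<dots> = (\<integral>v. of_real (v powr (a - 1) * exp (- v)) * U (v * x\<^sup>2) \<partial>halfline)"
    unfolding \<Psi>_inner_t ..
  finally show ?thesis using Gamma_real_pos[OF a_pos] by (simp add: field_simps)
qed

lemma T_integral:
  "(\<integral>c. T c \<partial>halfline) = of_real (2 powr \<nu> * x powr \<nu> / sqrt pi) *
     (\<integral>v. of_real (v powr (a - 1) * exp (- v)) * U (v * x\<^sup>2) \<partial>halfline)" (is "_ = _ * ?I")
proof -
  \<comment> \<open>(\<nu> + 1) / 2 + 1/4 - (\<nu> + 3/2) / 2 = 0 in multiples of pi * i: the phases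
    in the bracket are chosen to cancel those of the Laplace transform.\<close>
  have phase: "exp (\<i> * of_real ((\<nu> + 1) * pi / 2)) * (\<omega> * exp (- \<i> * of_real (pi * a / 2))) = 1"
    unfolding \<omega>_def exp_add[symmetric] by (simp add: field_simps)
  have "(\<integral>c. T c \<partial>halfline) = of_real ((x / 2) powr \<nu> / 2) * exp (\<i> * of_real ((\<nu> + 1) * pi / 2)) * (\<integral>c. (\<integral>t. \<Phi> t c \<partial>lborel) \<partial>halfline)"
    unfolding T_def integral_mult_right_zero ..
  also have "(\<integral>c. (\<integral>t. \<Phi> t c \<partial>lborel) \<partial>halfline) = (\<integral>t. (\<integral>c. \<Phi> t c \<partial>halfline) \<partial>lborel)"
    by (rule lborel_halfline.Fubini_integral[OF \<Phi>_integrable])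
  also have "\<dots> = of_real (2 powr (2 * \<nu> + 1) * Gamma a / sqrt pi) * (\<omega> * exp (- \<i> * of_real (pi * a / 2))) * (?I / of_real (Gamma a))"
    unfolding inner_integral integral_mult_right_zero outer_integral ..
  also have "of_real ((x / 2) powr \<nu> / 2) * exp (\<i> * of_real ((\<nu> + 1) * pi / 2)) * \<dots> =
     (exp (\<i> * of_real ((\<nu> + 1) * pi / 2)) * (\<omega> * exp (- \<i> * of_real (pi * a / 2)))) *
     of_real ((x / 2) powr \<nu> / 2 * (2 powr (2 * \<nu> + 1) / sqrt pi)) * ?I"
    using Gamma_real_pos[OF a_pos] by simp
  also have "(x / 2) powr \<nu> / 2 * (2 powr (2 * \<nu> + 1) / sqrt pi) = 2 powr \<nu> * x powr \<nu> / sqrt pi"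
  proof -
    have "2 powr (2 * \<nu> + 1) = 2 powr \<nu> * 2 powr \<nu> * (2::real)"
      using powr_add[of 2 "2 * \<nu>" 1] powr_add[of 2 \<nu> \<nu>] by simp
    then show ?thesis using x by (simp add: powr_divide)
  qed
  finally show ?thesis unfolding phase by simp
qed

lemma Bessel_K_halfline:
  "of_real (2 powr (\<nu> - 1) * x powr \<nu>) * (\<integral>v. complex_of_real (v powr (\<nu> - 1) * exp (- v - (1 / (4 * x\<^sup>2)) / v)) \<partial>halfline) =
   Bessel_K \<nu> (1 / of_real x)"
proof -
  define y where "y = 1 / (4 * x\<^sup>2)"
  have y: "y > 0" using x by (simp add: y_def)
  define f where "f v = complex_of_real (v powr (\<nu> - 1) * exp (- v - y / v))" for v
  have meas: "f \<in> borel_measurable halfline"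
    unfolding f_def by (intro measurable_restrict_space1) measurable
  have eq: "exp t *\<^sub>R f (exp t) = exp_kernel 1 (of_real y) (- \<nu>) t" for t
  proof -
    have "exp t * (exp t powr (\<nu> - 1) * exp (- exp t - y / exp t)) = exp (- exp t - y * exp (- t) + \<nu> * t)"
      by (simp add: exp_powr_real exp_minus divide_inverse exp_add[symmetric] mult.assoc[symmetric]) (simp add: algebra_simps)
    then show ?thesis
      unfolding f_def scaleR_conv_of_real of_real_mult[symmetric] by (simp add: exp_kernel_def flip: exp_of_real)
  qed
  have "integrable lborel (exp_kernel 1 (of_real y) (- \<nu>))" using y by (intro integrable_exp_kernel) auto
  then have fint: "integrable halfline f" unfolding exp_substitution(1)[OF meas] eq .
  have "(\<integral>v. f v \<partial>halfline) = exp_kernel_integral 1 (of_real y) (- \<nu>)"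
    using exp_substitution(2)[OF meas fint] unfolding eq exp_kernel_integral_def .
  \<comment> \<open>Translation by ln (1 / (2 x)) balances the parameters 1 and 1 / (4 x^2): both
    become 1 / (2 x), half the argument of K.\<close>
  also have "\<dots> = exp (- of_real (- \<nu> * ln (1 / (2 * x)))) *
     exp_kernel_integral (1 * of_real (exp (ln (1 / (2 * x))))) (of_real y * of_real (exp (- ln (1 / (2 * x))))) (- \<nu>)"
    by (rule exp_kernel_integral_translate)
  also have "complex_of_real y * of_real (exp (- ln (1 / (2 * x)))) = 1 / of_real x / 2"
    using x by (simp add: y_def exp_minus power2_eq_square)
  also have "1 * complex_of_real (exp (ln (1 / (2 * x)))) = 1 / of_real x / 2"
    using x by simp
  also have "exp (- complex_of_real (- \<nu> * ln (1 / (2 * x)))) = of_real ((2 * x) powr (- \<nu>))"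
    using x by (simp add: powr_def ln_div flip: exp_of_real)
  also have "exp_kernel_integral (1 / of_real x / 2) (1 / of_real x / 2) (- \<nu>) = 2 * Bessel_K \<nu> (1 / of_real x)"
  proof -
    have "Re (1 / complex_of_real x) > 0" using x by (simp add: Re_divide_of_real)
    then show ?thesis
      using Bessel_K_eq_integral[of "1 / of_real x" \<nu>] exp_kernel_integral_reflect[of "1 / of_real x / 2" "1 / of_real x / 2" "- \<nu>"]
      by (simp add: mult.commute)
  qed
  finally have "of_real (2 powr (\<nu> - 1) * x powr \<nu>) * (\<integral>v. f v \<partial>halfline) =
     of_real (2 powr (\<nu> - 1) * x powr \<nu> * (2 * x) powr (- \<nu>) * 2) * Bessel_K \<nu> (1 / of_real x)" by simp
  also have "2 powr (\<nu> - 1) * x powr \<nu> * (2 * x) powr (- \<nu>) * 2 = 1"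
    using x by (simp add: powr_diff powr_minus powr_mult field_simps)
  finally show ?thesis by (simp add: f_def y_def)
qed

theorem integrand_integrable: "integrable halfline (Bessel_JK_integrand \<nu> (of_real x))"
proof -
  have "integrable halfline (\<lambda>c. T c + cnj (T c))"
    using T_integrable by simp
  then show ?thesis
    by (rule Bochner_Integration.integrable_cong[THEN iffD1, rotated -1]) (auto simp: integrand_eq)
qed

theorem integrand_integral:
  "(\<integral>c. Bessel_JK_integrand \<nu> (of_real x) c \<partial>halfline) = 1 / of_real x ^ 3 * Bessel_K \<nu> (1 / of_real x)"
proof -
  define P where "P = 2 powr \<nu> * x powr \<nu> / sqrt pi"
  define w where "w v = complex_of_real (v powr (a - 1) * exp (- v))" for v
  have Uint: "integrable halfline (\<lambda>v. w v * U (v * x\<^sup>2))"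
    using halfline_halfline.integrable_snd[OF \<Psi>_integrable] unfolding \<Psi>_inner_t w_def .
  have "(\<integral>c. Bessel_JK_integrand \<nu> (of_real x) c \<partial>halfline) = (\<integral>c. T c + cnj (T c) \<partial>halfline)"
    by (rule Bochner_Integration.integral_cong) (auto simp: integrand_eq)
  also have "\<dots> = (\<integral>c. T c \<partial>halfline) + cnj (\<integral>c. T c \<partial>halfline)"
    using T_integrable by simp
  also have "\<dots> = of_real P * ((\<integral>v. w v * U (v * x\<^sup>2) \<partial>halfline) + (\<integral>v. cnj (w v * U (v * x\<^sup>2)) \<partial>halfline))"
  proof -
    have "(\<integral>v. cnj (w v * U (v * x\<^sup>2)) \<partial>halfline) = cnj (\<integral>v. w v * U (v * x\<^sup>2) \<partial>halfline)"
      by (rule Bochner_Integration.integral_cnj)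
    moreover have "(\<integral>c. T c \<partial>halfline) = of_real P * (\<integral>v. w v * U (v * x\<^sup>2) \<partial>halfline)"
      unfolding T_integral P_def w_def ..
    ultimately show ?thesis by (simp only: distrib_left complex_cnj_mult complex_cnj_complex_of_real)
  qed
  also have "(\<integral>v. w v * U (v * x\<^sup>2) \<partial>halfline) + (\<integral>v. cnj (w v * U (v * x\<^sup>2)) \<partial>halfline) =
     (\<integral>v. w v * U (v * x\<^sup>2) + cnj (w v * U (v * x\<^sup>2)) \<partial>halfline)"
    by (intro Bochner_Integration.integral_add[symmetric] Uint integrable_bounded_linear[OF bounded_linear_cnj Uint])
  also have "\<dots> = (\<integral>v. of_real (sqrt pi / 2 * x powr (- 3)) * complex_of_real (v powr (\<nu> - 1) * exp (- v - (1 / (4 * x\<^sup>2)) / v)) \<partial>halfline)"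
  proof (rule Bochner_Integration.integral_cong[OF refl])
    fix v assume "v \<in> space halfline"
    then have v: "v > 0" by simp
    then have "v * x\<^sup>2 > 0" using x by simp
    from gaussian_rotation_value[OF this]
    have UU: "U (v * x\<^sup>2) + cnj (U (v * x\<^sup>2)) = of_real (sqrt pi / 2 * (v * x\<^sup>2) powr (- 3 / 2) * exp (- 1 / (4 * (v * x\<^sup>2))))"
      by (simp only: U_def)
    have "w v * U (v * x\<^sup>2) + cnj (w v * U (v * x\<^sup>2)) = w v * (U (v * x\<^sup>2) + cnj (U (v * x\<^sup>2)))"
      by (simp add: w_def distrib_left)
    also have "\<dots> = of_real (v powr (a - 1) * exp (- v) * (sqrt pi / 2 * (v * x\<^sup>2) powr (- 3 / 2) * exp (- 1 / (4 * (v * x\<^sup>2)))))"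
      unfolding UU w_def by simp
    \<comment> \<open>The power (v x^2) powr (- 3/2) lowers the exponent a - 1 of v to \<nu> - 1 and
      yields x powr (- 3), the cubic factor of the result.\<close>
    also have "v powr (a - 1) * exp (- v) * (sqrt pi / 2 * (v * x\<^sup>2) powr (- 3 / 2) * exp (- 1 / (4 * (v * x\<^sup>2)))) =
       (sqrt pi / 2 * x powr (- 3)) * (v powr (\<nu> - 1) * exp (- v - (1 / (4 * x\<^sup>2)) / v))"
    proof -
      have 1: "(v * x\<^sup>2) powr (- 3 / 2) = v powr (- 3 / 2) * x powr (- 3)"
        using v x by (simp add: powr_mult powr_powr flip: powr_numeral)
      have 2: "v powr (\<nu> - 1) = v powr (a - 1) * v powr (- 3 / 2)"
        using v by (simp flip: powr_add)
      have 3: "exp (- v - (1 / (4 * x\<^sup>2)) / v) = exp (- v) * exp (- 1 / (4 * (v * x\<^sup>2)))"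
        by (simp add: mult_ac flip: exp_add)
      show ?thesis unfolding 1 2 3 by (simp only: mult_ac)
    qed
    finally show "w v * U (v * x\<^sup>2) + cnj (w v * U (v * x\<^sup>2)) =
       of_real (sqrt pi / 2 * x powr (- 3)) * complex_of_real (v powr (\<nu> - 1) * exp (- v - (1 / (4 * x\<^sup>2)) / v))"
      by (simp only: of_real_mult)
  qed
  also have "\<dots> = of_real (sqrt pi / 2 * x powr (- 3)) * (\<integral>v. complex_of_real (v powr (\<nu> - 1) * exp (- v - (1 / (4 * x\<^sup>2)) / v)) \<partial>halfline)"
    by (rule integral_mult_right_zero)
  also have "of_real P * \<dots> = of_real (x powr (- 3)) * (of_real (2 powr (\<nu> - 1) * x powr \<nu>) *
      (\<integral>v. complex_of_real (v powr (\<nu> - 1) * exp (- v - (1 / (4 * x\<^sup>2)) / v)) \<partial>halfline))"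
  proof -
    have "P * (sqrt pi / 2 * x powr (- 3)) = x powr (- 3) * (2 powr (\<nu> - 1) * x powr \<nu>)"
      by (simp add: P_def powr_diff)
    then show ?thesis by (simp only: mult.assoc[symmetric] of_real_mult[symmetric])
  qed
  also have "\<dots> = 1 / of_real x ^ 3 * Bessel_K \<nu> (1 / of_real x)"
    unfolding Bessel_K_halfline using x by (simp add: powr_minus powr_numeral divide_inverse)
  finally show ?thesis .
qed

end

section \<open>Asymptotics at infinity\<close>

text \<open>The Laplace transform of t powr (- 1/2), already known for complex p, becomes the
  Gaussian integral under squaring of the variable.\<close>

lemma complex_gaussian:
  assumes p: "Re p > 0"
  shows "integrable lborel (\<lambda>t. exp (- p * of_real (t\<^sup>2)))"
    and "(\<integral>t. exp (- p * of_real (t\<^sup>2)) \<partial>lborel) = of_real (Gamma (1 / 2)) * p powr (- 1 / 2)"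
proof -
  have s: "1 / 2 > (0::real)" by simp
  note L = laplace_power[OF s p]
  define g where "g t = of_real (exp (t / 2)) * exp (- p * of_real (exp t))" for t :: real
  have eq: "exp t *\<^sub>R (of_real (exp t powr (1 / 2 - 1)) * exp (- p * of_real (exp t))) = g t" for t
  proof -
    have "exp t * exp t powr (1 / 2 - 1) = exp (t / 2)"
      by (simp add: exp_powr_real flip: exp_add)
    then show ?thesis
      unfolding g_def scaleR_conv_of_real mult.assoc[symmetric] of_real_mult[symmetric] by (rule arg_cong)
  qed
  have g: "integrable lborel g" "(\<integral>t. g t \<partial>lborel) = of_real (Gamma (1 / 2)) * p powr (- 1 / 2)"
    using exp_substitution[OF borel_measurable_integrable[OF L(1)]] L unfolding eq by simp_all
  have eq2: "exp t *\<^sub>R exp (- p * of_real ((exp t)\<^sup>2)) = g (2 * t)" for t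
    by (simp add: g_def exp_double scaleR_conv_of_real)
  have meas: "(\<lambda>t. exp (- p * of_real (t\<^sup>2))) \<in> borel_measurable halfline"
    by (intro measurable_restrict_space1) measurable
  have "integrable lborel (\<lambda>t. g (2 * t))"
    using lborel_integrable_real_affine[OF g(1), of 2 0] by simp
  then have hint: "integrable halfline (\<lambda>t. exp (- p * of_real (t\<^sup>2)))"
    unfolding exp_substitution(1)[OF meas] eq2 .
  have "(\<integral>t. exp (- p * of_real (t\<^sup>2)) \<partial>halfline) = (\<integral>t. g (2 * t) \<partial>lborel)"
    using exp_substitution(2)[OF meas hint] unfolding eq2 .
  also have "\<dots> = (\<integral>t. g t \<partial>lborel) /\<^sub>R 2"
    using lborel_integral_real_affine[of 2 g 0] by simp
  finally have hval: "(\<integral>t. exp (- p * of_real (t\<^sup>2)) \<partial>halfline) = (\<integral>t. g t \<partial>lborel) /\<^sub>R 2" .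
  have "has_bochner_integral lborel (\<lambda>t. indicator {0<..} t *\<^sub>R exp (- p * of_real (t\<^sup>2))) ((\<integral>t. g t \<partial>lborel) /\<^sub>R 2)"
    using hint hval by (simp add: has_bochner_integral_iff integrable_restrict_space integral_restrict_space set_integrable_def)
  then have "has_bochner_integral lborel (\<lambda>t. indicator {0..} t *\<^sub>R exp (- p * of_real (t\<^sup>2))) ((\<integral>t. g t \<partial>lborel) /\<^sub>R 2)"
    by (rule has_bochner_integral_discrete_difference[of "{0}", THEN iffD1, rotated -1])
       (auto simp: indicator_def)
  from has_bochner_integral_even_function[OF this]
  have "has_bochner_integral lborel (\<lambda>t. exp (- p * of_real (t\<^sup>2))) (\<integral>t. g t \<partial>lborel)" by simp
  then show "integrable lborel (\<lambda>t. exp (- p * of_real (t\<^sup>2)))"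
    "(\<integral>t. exp (- p * of_real (t\<^sup>2)) \<partial>lborel) = of_real (Gamma (1 / 2)) * p powr (- 1 / 2)"
    unfolding g(2) by (auto simp: has_bochner_integral_iff)
qed

lemma real_gaussian_integrable:
  assumes "h > 0"
  shows "integrable lborel (\<lambda>t::real. exp (- h * t\<^sup>2))"
proof -
  have "integrable lborel (\<lambda>t. complex_of_real (exp (- h * t\<^sup>2)))"
    using complex_gaussian(1)[of "of_real h"] assms by (simp flip: exp_of_real)
  then show ?thesis by (simp only: complex_of_real_integrable_eq)
qed

text \<open>The first two terms of the cosh series, the remaining ones being nonnegative; it makes
  the exponent of the K-integral at least quadratic, uniformly in the scaling.\<close>

lemma exp_sum_minus_2_ge: "exp s + exp (- s) - 2 \<ge> (s::real)\<^sup>2"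
proof -
  have "(\<Sum>k\<in>{0, 1}. s ^ (2 * k) / fact (2 * k)) \<le> (\<Sum>k. s ^ (2 * k) / fact (2 * k))"
    using sums_summable[OF cosh_even_series[of s]] by (rule sum_le_suminf) auto
  also have "\<dots> = (exp s + exp (- s)) / 2"
    using sums_unique[OF cosh_even_series[of s]] by (simp add: cosh_field_def)
  finally show ?thesis by simp
qed

text \<open>Laplace's method with m = c powr (1/4): after t -> t / m the exponent m^2 (exp (t / m) +
  exp (- t / m) - 2) tends to t^2 and is bounded below by it.\<close>

lemma Bessel_K_asymp:
  assumes p: "Re p > 0"
  shows "((\<lambda>c. of_real (c powr (1 / 4)) * exp (2 * p * of_real (sqrt c)) * Bessel_K \<mu> (2 * p * of_real (sqrt c)))
           \<longlongrightarrow> of_real (Gamma (1 / 2)) * p powr (- 1 / 2) / 2) at_top"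
proof -
  define F where "F m t = exp (- p * of_real (m\<^sup>2 * (exp (t / m) + exp (- (t / m)) - 2)) - of_real (\<mu> * (t / m)))" for m t :: real
  define h where "h = Re p"
  have h: "h > 0" using p by (simp add: h_def)
  have lim: "((\<lambda>m. \<integral>t. F m t \<partial>lborel) \<longlongrightarrow> (\<integral>t. exp (- p * of_real (t\<^sup>2)) \<partial>lborel)) at_top"
  \<comment> \<open>The linear term is absorbed by \<bar>\<mu> t\<bar> \<le> \<mu>^2 / (2 h) + h t^2
    / 2, at the price of half of the Gaussian exponent.\<close>
  proof (rule integral_dominated_convergence_at_top[where w = "\<lambda>t. exp (\<mu>\<^sup>2 / (2 * h)) * exp (- (h / 2) * t\<^sup>2)"])
    show "integrable lborel (\<lambda>t. exp (\<mu>\<^sup>2 / (2 * h)) * exp (- (h / 2) * t\<^sup>2))"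
      using h by (intro integrable_mult_right real_gaussian_integrable) simp
    show "AE t in lborel. ((\<lambda>m. F m t) \<longlongrightarrow> exp (- p * of_real (t\<^sup>2))) at_top"
    proof (rule AE_I2)
      fix t :: real
      have "((\<lambda>m. m\<^sup>2 * (exp (t / m) + exp (- (t / m)) - 2)) \<longlongrightarrow> t * t) at_top" by real_asymp
      then have 1: "((\<lambda>m. m\<^sup>2 * (exp (t / m) + exp (- (t / m)) - 2)) \<longlongrightarrow> t\<^sup>2) at_top"
        unfolding power2_eq_square[of t] .
      have 2: "((\<lambda>m. \<mu> * (t / m)) \<longlongrightarrow> 0) at_top" by real_asymp
      have "((\<lambda>m. F m t) \<longlongrightarrow> exp (- p * of_real (t\<^sup>2) - of_real 0)) at_top"
        unfolding F_def by (intro tendsto_exp tendsto_diff tendsto_mult tendsto_const tendsto_of_real 1 2)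
      then show "((\<lambda>m. F m t) \<longlongrightarrow> exp (- p * of_real (t\<^sup>2))) at_top" by simp
    qed
    show "\<forall>\<^sub>F m in at_top. AE t in lborel. norm (F m t) \<le> exp (\<mu>\<^sup>2 / (2 * h)) * exp (- (h / 2) * t\<^sup>2)"
      using eventually_ge_at_top[of 1]
    proof eventually_elim
      case (elim m)
      show ?case
      proof (rule AE_I2)
        fix t :: real
        have "m\<^sup>2 * (t / m)\<^sup>2 \<le> m\<^sup>2 * (exp (t / m) + exp (- (t / m)) - 2)"
          by (intro mult_left_mono exp_sum_minus_2_ge) auto
        then have "t\<^sup>2 \<le> m\<^sup>2 * (exp (t / m) + exp (- (t / m)) - 2)"
          using elim by (simp add: power_divide)
        then have 1: "h * t\<^sup>2 \<le> h * (m\<^sup>2 * (exp (t / m) + exp (- (t / m)) - 2))"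
          using h by (intro mult_left_mono) auto
        have "0 \<le> (\<bar>\<mu>\<bar> - h * \<bar>t\<bar>)\<^sup>2" by simp
        then have "2 * h * (\<bar>\<mu>\<bar> * \<bar>t\<bar>) \<le> \<mu>\<^sup>2 + h * (h * t\<^sup>2)"
          by (simp add: power2_eq_square algebra_simps)
        then have "\<bar>\<mu>\<bar> * \<bar>t\<bar> \<le> (\<mu>\<^sup>2 + h * (h * t\<^sup>2)) / (2 * h)"
          using h by (simp add: pos_le_divide_eq mult_ac)
        also have "\<dots> = \<mu>\<^sup>2 / (2 * h) + h / 2 * t\<^sup>2" using h by (simp add: field_simps)
        finally have 2: "\<bar>\<mu>\<bar> * \<bar>t\<bar> \<le> \<mu>\<^sup>2 / (2 * h) + h / 2 * t\<^sup>2" .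
        have "- (\<mu> * (t / m)) \<le> \<bar>\<mu> * (t / m)\<bar>" by (rule abs_ge_minus_self)
        also have "\<dots> = \<bar>\<mu>\<bar> * \<bar>t\<bar> / m" using elim by (simp add: abs_mult)
        also have "\<dots> \<le> \<bar>\<mu>\<bar> * \<bar>t\<bar> / 1" using elim by (intro divide_left_mono) auto
        finally have 3: "- (\<mu> * (t / m)) \<le> \<bar>\<mu>\<bar> * \<bar>t\<bar>" by simp
        have "norm (F m t) = exp (- (h * (m\<^sup>2 * (exp (t / m) + exp (- (t / m)) - 2))) - \<mu> * (t / m))"
          unfolding F_def norm_exp_eq_Re h_def by simp
        also have "\<dots> \<le> exp (\<mu>\<^sup>2 / (2 * h) + - (h / 2) * t\<^sup>2)"
          using 1 2 3 by (simp add: algebra_simps)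
        finally show "norm (F m t) \<le> exp (\<mu>\<^sup>2 / (2 * h)) * exp (- (h / 2) * t\<^sup>2)"
          by (simp only: exp_add)
      qed
    qed
  qed (auto simp: F_def)
  have K: "of_real m * exp (2 * p * of_real (m\<^sup>2)) * Bessel_K \<mu> (2 * p * of_real (m\<^sup>2)) = (\<integral>t. F m t \<partial>lborel) / 2" if m: "m > 0" for m
  proof -
    have "Re (2 * p * of_real (m\<^sup>2)) > 0" using p m by simp
    then have "Bessel_K \<mu> (2 * p * of_real (m\<^sup>2)) = exp_kernel_integral (p * of_real (m\<^sup>2)) (p * of_real (m\<^sup>2)) \<mu> / 2"
      using Bessel_K_eq_integral[of "2 * p * of_real (m\<^sup>2)" \<mu>] by simp
    also have "exp_kernel_integral (p * of_real (m\<^sup>2)) (p * of_real (m\<^sup>2)) \<mu> =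
        (\<integral>t. exp_kernel (p * of_real (m\<^sup>2)) (p * of_real (m\<^sup>2)) \<mu> (t / m) \<partial>lborel) / of_real m"
      using lborel_integral_real_affine[of "1 / m" "exp_kernel (p * of_real (m\<^sup>2)) (p * of_real (m\<^sup>2)) \<mu>" 0] m
      unfolding exp_kernel_integral_def by (simp add: scaleR_conv_of_real)
    finally have "of_real m * exp (2 * p * of_real (m\<^sup>2)) * Bessel_K \<mu> (2 * p * of_real (m\<^sup>2)) =
        (\<integral>t. exp (2 * p * of_real (m\<^sup>2)) * exp_kernel (p * of_real (m\<^sup>2)) (p * of_real (m\<^sup>2)) \<mu> (t / m) \<partial>lborel) / 2"
      using m by (simp only: integral_mult_right_zero) simp
    moreover have "exp (2 * p * of_real (m\<^sup>2)) * exp_kernel (p * of_real (m\<^sup>2)) (p * of_real (m\<^sup>2)) \<mu> (t / m) = F m t" for t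
      unfolding exp_kernel_def F_def exp_add[symmetric] by (rule arg_cong[of _ _ exp]) (simp add: algebra_simps)
    ultimately show ?thesis by (simp only:)
  qed
  have "((\<lambda>c. (\<integral>t. F (c powr (1 / 4)) t \<partial>lborel) / 2) \<longlongrightarrow> (\<integral>t. exp (- p * of_real (t\<^sup>2)) \<partial>lborel) / 2) at_top"
  proof -
    have "filterlim (\<lambda>c::real. c powr (1 / 4)) at_top at_top" by real_asymp
    from filterlim_compose[OF lim this] show ?thesis by (intro tendsto_intros) auto
  qed
  then have "((\<lambda>c. of_real (c powr (1 / 4)) * exp (2 * p * of_real (sqrt c)) * Bessel_K \<mu> (2 * p * of_real (sqrt c)))
           \<longlongrightarrow> (\<integral>t. exp (- p * of_real (t\<^sup>2)) \<partial>lborel) / 2) at_top"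
  proof (rule Lim_transform_eventually)
    show "\<forall>\<^sub>F c in at_top. (\<integral>t. F (c powr (1 / 4)) t \<partial>lborel) / 2 =
       of_real (c powr (1 / 4)) * exp (2 * p * of_real (sqrt c)) * Bessel_K \<mu> (2 * p * of_real (sqrt c))"
      using eventually_gt_at_top[of 0]
    proof eventually_elim
      case (elim c)
      have "(c powr (1 / 4))\<^sup>2 = c powr (1 / 4 + 1 / 4)" by (simp only: power2_eq_square powr_add)
      then have "(c powr (1 / 4))\<^sup>2 = sqrt c" using elim by (simp add: powr_half_sqrt)
      moreover have "c powr (1 / 4) > 0" using elim by simp
      ultimately show ?case using K[of "c powr (1 / 4)"] by simp
    qed
  qed
  then show ?thesis by (simp only: complex_gaussian(2)[OF p])
qed

text \<open>Cauchy criterion for the gauge integral: integrals over [- X, X] and [- X, X + 1] have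
  the same limit. Absolute integrability is not assumed, so the criterion also excludes conditional
  convergence.\<close>

lemma integrable_on_halfline_imp_tail:
  fixes f :: "real \<Rightarrow> 'a::banach"
  assumes f: "f integrable_on {0<..}" and X: "filterlim X at_top sequentially"
  shows "(\<lambda>n. integral {X n..X n + 1} f) \<longlonglongrightarrow> 0"
proof (rule LIMSEQ_I)
  fix e :: real assume e: "e > 0"
  define g where "g x = (if x \<in> {0<..} then f x else 0)" for x
  obtain i where i: "(f has_integral i) {0<..}" using f by blast
  have gint: "g integrable_on {a..b}" for a b
    using i unfolding has_integral_alt'[of f] g_def by auto
  obtain B where B: "B > 0" "\<And>a b. ball 0 B \<subseteq> cbox a b \<Longrightarrow> norm (integral (cbox a b) g - i) < e / 2"
    using i e unfolding has_integral_alt'[of f] g_def by (metis half_gt_zero)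
  obtain N where N: "\<And>n. n \<ge> N \<Longrightarrow> X n \<ge> B"
    using X by (auto simp: filterlim_at_top eventually_sequentially)
  have "norm (integral {X n..X n + 1} f) < e" if "n \<ge> N" for n
  proof -
    have XB: "X n \<ge> B" using N[OF that] .
    have sub: "ball 0 B \<subseteq> cbox (- X n) y" if "y \<ge> X n" for y
      using XB that by (auto simp: dist_real_def abs_less_iff)
    have 1: "norm (integral {- X n..X n} g - i) < e / 2"
      using B(2)[OF sub[of "X n"]] by simp
    have 2: "norm (integral {- X n..X n + 1} g - i) < e / 2"
      using B(2)[OF sub[of "X n + 1"]] by simp
    have "integral {- X n..X n} g + integral {X n..X n + 1} g = integral {- X n..X n + 1} g"
      using XB B(1) by (intro Henstock_Kurzweil_Integration.integral_combine gint) auto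
    then have "integral {X n..X n + 1} g = (integral {- X n..X n + 1} g - i) - (integral {- X n..X n} g - i)"
      by (simp add: algebra_simps)
    also have "norm \<dots> < e / 2 + e / 2"
      using norm_triangle_ineq4 1 2 by (meson add_strict_mono le_less_trans)
    also have "integral {X n..X n + 1} g = integral {X n..X n + 1} f"
      using XB B(1) by (intro Henstock_Kurzweil_Integration.integral_cong) (auto simp: g_def)
    finally show ?thesis by simp
  qed
  then show "\<exists>N. \<forall>n\<ge>N. norm (integral {X n..X n + 1} f - 0) < e" by auto
qed

lemma Bessel_J_holomorphic: "Bessel_J \<nu> holomorphic_on (- \<real>\<^sub>\<le>\<^sub>0)"
proof -
  have "z / 2 \<notin> \<real>\<^sub>\<le>\<^sub>0" if "z \<in> - \<real>\<^sub>\<le>\<^sub>0" for z :: complex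
    using that by (auto simp: complex_nonpos_Reals_iff)
  then show ?thesis unfolding Bessel_J_Clifford[abs_def] by (intro holomorphic_intros) auto
qed

lemma Bessel_JK_integrand_alt:
  "Bessel_JK_integrand \<nu> z c = of_real c * Bessel_J \<nu> (of_real c * z) *
     (exp (\<i> * of_real ((\<nu> + 1) * pi / 2)) * Bessel_K (2 * \<nu>) (2 * \<omega> * of_real (sqrt c)) +
      cnj (exp (\<i> * of_real ((\<nu> + 1) * pi / 2))) * Bessel_K (2 * \<nu>) (2 * cnj \<omega> * of_real (sqrt c)))"
proof -
  have "exp (- \<i> * of_real (pi / 4)) = cnj \<omega>" by (simp add: \<omega>_def exp_cnj)
  moreover have "exp (- \<i> * of_real ((\<nu> + 1) * pi / 2)) = cnj (exp (\<i> * of_real ((\<nu> + 1) * pi / 2)))" by (simp add: exp_cnj)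
  ultimately show ?thesis unfolding Bessel_JK_integrand_def \<omega>_def[symmetric] by (simp only:)
qed

lemma Bessel_JK_integrand_continuous:
  assumes z: "z \<notin> \<real>\<^sub>\<le>\<^sub>0"
  shows "continuous_on {0<..} (Bessel_JK_integrand \<nu> z)"
proof -
  have slit: "of_real c * z \<in> - \<real>\<^sub>\<le>\<^sub>0" if "c > 0" for c :: real
    using that z by (auto simp: complex_nonpos_Reals_iff zero_less_mult_iff mult_le_0_iff)
  have J: "continuous_on {0<..} (\<lambda>c. Bessel_J \<nu> (of_real c * z))"
    by (rule continuous_on_compose2[OF holomorphic_on_imp_continuous_on[OF Bessel_J_holomorphic]])
       (use slit in \<open>auto intro!: continuous_intros\<close>)
  have K: "continuous_on {0<..} (\<lambda>c. Bessel_K (2 * \<nu>) (2 * p * of_real (sqrt c)))" if "Re p > 0" for p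
    by (rule continuous_on_compose2[OF holomorphic_on_imp_continuous_on[OF Bessel_K_holomorphic]])
       (use that in \<open>auto intro!: continuous_intros simp: complex_nonpos_Reals_iff mult_le_0_iff\<close>)
  show ?thesis
    unfolding Bessel_JK_integrand_alt by (intro continuous_intros J K) auto
qed

lemma sqrt_shift_tendsto_0:
  assumes "filterlim X at_top sequentially"
  shows "(\<lambda>n. sqrt (2 * (X n + u)) - sqrt (2 * X n)) \<longlonglongrightarrow> 0"
proof -
  have "((\<lambda>a. sqrt (2 * (a + u)) - sqrt (2 * a)) \<longlongrightarrow> 0) at_top" by real_asymp
  from filterlim_compose[OF this assms] show ?thesis .
qed

section \<open>The integral off the real axis\<close>

text \<open>
  Along points \<open>X n\<close> where the oscillating factor of the bracket has modulus one and fixed sign, the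
  integral over \<open>[X n, X n + 1]\<close>, rescaled by the vanishing factor \<open>A n\<close>, has a nonzero limit.
\<close>

theorem Bessel_JK_integrand_not_integrable:
  assumes \<nu>: "\<nu> \<ge> - 1 / 2" and z: "Im z \<noteq> 0"
  shows "\<not> Bessel_JK_integrand \<nu> z integrable_on {0<..}"
proof
  assume int: "Bessel_JK_integrand \<nu> z integrable_on {0<..}"
  define f where "f = Bessel_JK_integrand \<nu> z"
  obtain \<eta> L where \<eta>: "Re \<eta> > 0" and L: "L \<noteq> 0"
    and Jlim: "((\<lambda>c. of_real (c powr (1 / 2)) * exp (- of_real c * \<eta>) * Bessel_J \<nu> (of_real c * z)) \<longlongrightarrow> L) at_top"
    using Bessel_J_growth[OF \<nu> z] by blast
  define j where "j c = of_real (c powr (1 / 2)) * exp (- of_real c * \<eta>) * Bessel_J \<nu> (of_real c * z)" for c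
  define E where "E = exp (\<i> * of_real ((\<nu> + 1) * pi / 2))"
  define k where "k p c = of_real (c powr (1 / 4)) * exp (2 * p * of_real (sqrt c)) * Bessel_K (2 * \<nu>) (2 * p * of_real (sqrt c))" for p c
  define \<zeta> where "\<zeta> = of_real (Gamma (1 / 2)) * \<omega> powr (- 1 / 2) / 2"
  have \<zeta>: "\<zeta> \<noteq> 0" by (simp add: \<zeta>_def Gamma_one_half_real)
  have k1: "(k \<omega> \<longlongrightarrow> \<zeta>) at_top"
    using Bessel_K_asymp[of \<omega> "2 * \<nu>"] unfolding k_def \<zeta>_def by simp
  have k2: "(k (cnj \<omega>) \<longlongrightarrow> cnj \<zeta>) at_top"
  proof -
    have "\<forall>\<^sub>F c in at_top. cnj (k \<omega> c) = k (cnj \<omega>) c"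
      using eventually_gt_at_top[of 0]
    proof eventually_elim
      case (elim c)
      have "Bessel_K (2 * \<nu>) (cnj (2 * \<omega> * of_real (sqrt c))) = cnj (Bessel_K (2 * \<nu>) (2 * \<omega> * of_real (sqrt c)))"
        using elim by (intro Bessel_K_cnj) simp
      then show ?case by (simp add: k_def exp_cnj)
    qed
    with tendsto_cnj[OF k1] show ?thesis by (rule Lim_transform_eventually)
  qed
  define \<xi> where "\<xi> = E * \<zeta>"
  have \<xi>: "\<xi> \<noteq> 0" using \<zeta> by (simp add: \<xi>_def E_def)
  define \<theta> where "\<theta> = Arg \<xi>"
  \<comment> \<open>Chosen so that sqrt (2 X) equals Arg \<xi> modulo 2 pi: the two conjugate
    oscillating terms then become equal and positive in the limit, and cannot cancel. Since
    \<bar>\<theta>\<bar> \<le> pi, the shift n + 1 keeps the root nonnegative for every n.\<close>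
  define X where "X n = (\<theta> + 2 * pi * real (n + 1))\<^sup>2 / 2" for n :: nat
  have \<theta>: "\<bar>\<theta>\<bar> \<le> pi" unfolding \<theta>_def using Arg_bounded[of \<xi>] by auto
  have Xs: "sqrt (2 * X n) = \<theta> + 2 * pi * real (n + 1)" for n
  proof -
    have "2 * pi * 1 \<le> 2 * pi * real (n + 1)" by (intro mult_left_mono) auto
    then have "\<theta> + 2 * pi * real (n + 1) \<ge> 0" using \<theta> pi_gt_zero by linarith
    then show ?thesis by (simp add: X_def)
  qed
  have Xlim: "filterlim X at_top sequentially" unfolding X_def by real_asymp
  define \<beta> where "\<beta> c = E * k \<omega> c * exp (- \<i> * of_real (sqrt (2 * c))) + cnj E * k (cnj \<omega>) c * exp (\<i> * of_real (sqrt (2 * c)))" for c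
  have fc: "f c = of_real (c powr (1 / 4)) * exp (of_real c * \<eta>) * of_real (exp (- sqrt (2 * c))) * (j c * \<beta> c)" if c: "c > 0" for c
  proof -
    have r2: "sqrt (2 * c) = sqrt 2 * sqrt c" by (rule real_sqrt_mult)
    \<comment> \<open>2 \<omega> sqrt c = (1 + i) sqrt (2 c), so decay rate and phase of the K-terms
      are both sqrt (2 c).\<close>
    have w: "2 * \<omega> * of_real (sqrt c) = of_real (sqrt (2 * c)) + \<i> * of_real (sqrt (2 * c))"
      "2 * cnj \<omega> * of_real (sqrt c) = of_real (sqrt (2 * c)) - \<i> * of_real (sqrt (2 * c))"
      unfolding r2 by (simp_all add: complex_eq_iff real_div_sqrt)
    have p14: "complex_of_real (c powr (- 1 / 4)) * of_real (c powr (1 / 4)) = 1"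
      using c unfolding of_real_mult[symmetric] powr_add[symmetric] by simp
    have p12: "complex_of_real (c powr (- 1 / 2)) * of_real (c powr (1 / 2)) = 1"
      using c unfolding of_real_mult[symmetric] powr_add[symmetric] by simp
    have Kk: "Bessel_K (2 * \<nu>) (2 * q * of_real (sqrt c)) = of_real (c powr (- 1 / 4)) * exp (- (2 * q * of_real (sqrt c))) * k q c" for q
    proof -
      have "of_real (c powr (- 1 / 4)) * exp (- (2 * q * of_real (sqrt c))) * k q c =
         (of_real (c powr (- 1 / 4)) * of_real (c powr (1 / 4))) * (exp (- (2 * q * of_real (sqrt c))) * exp (2 * q * of_real (sqrt c))) *
         Bessel_K (2 * \<nu>) (2 * q * of_real (sqrt c))"
        unfolding k_def by (simp only: mult_ac)
      also have "exp (- (2 * q * of_real (sqrt c))) * exp (2 * q * of_real (sqrt c)) = 1"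
        unfolding exp_add[symmetric] by simp
      finally show ?thesis unfolding p14 by simp
    qed
    have Jj: "Bessel_J \<nu> (of_real c * z) = of_real (c powr (- 1 / 2)) * exp (of_real c * \<eta>) * j c"
    proof -
      have "of_real (c powr (- 1 / 2)) * exp (of_real c * \<eta>) * j c =
         (of_real (c powr (- 1 / 2)) * of_real (c powr (1 / 2))) * (exp (of_real c * \<eta>) * exp (- of_real c * \<eta>)) * Bessel_J \<nu> (of_real c * z)"
        unfolding j_def by (simp only: mult_ac)
      also have "exp (of_real c * \<eta>) * exp (- of_real c * \<eta>) = 1"
        unfolding exp_add[symmetric] by simp
      finally show ?thesis unfolding p12 by simp
    qed
    have e: "exp (- (of_real (sqrt (2 * c)) + \<i> * of_real (sqrt (2 * c)))) = of_real (exp (- sqrt (2 * c))) * exp (- \<i> * of_real (sqrt (2 * c)))"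
      "exp (- (of_real (sqrt (2 * c)) - \<i> * of_real (sqrt (2 * c)))) = of_real (exp (- sqrt (2 * c))) * exp (\<i> * of_real (sqrt (2 * c)))"
      unfolding exp_of_real[symmetric] exp_add[symmetric] by (simp_all add: algebra_simps)
    have K1: "Bessel_K (2 * \<nu>) (2 * \<omega> * of_real (sqrt c)) =
        of_real (c powr (- 1 / 4)) * (of_real (exp (- sqrt (2 * c))) * exp (- \<i> * of_real (sqrt (2 * c)))) * k \<omega> c"
      using Kk[of \<omega>] by (simp only: w e)
    have K2: "Bessel_K (2 * \<nu>) (2 * cnj \<omega> * of_real (sqrt c)) =
        of_real (c powr (- 1 / 4)) * (of_real (exp (- sqrt (2 * c))) * exp (\<i> * of_real (sqrt (2 * c)))) * k (cnj \<omega>) c"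
      using Kk[of "cnj \<omega>"] by (simp only: w e)
    have "f c = (of_real c * of_real (c powr (- 1 / 2)) * of_real (c powr (- 1 / 4))) * exp (of_real c * \<eta>) * of_real (exp (- sqrt (2 * c))) * (j c * \<beta> c)"
      unfolding f_def Bessel_JK_integrand_alt E_def[symmetric] Jj K1 K2 \<beta>_def by (simp add: algebra_simps)
    also have "complex_of_real c * of_real (c powr (- 1 / 2)) * of_real (c powr (- 1 / 4)) = of_real (c powr (1 / 4))"
    proof -
      have "c powr 1 * c powr (- 1 / 2) * c powr (- 1 / 4) = c powr (1 / 4)"
        unfolding powr_add[symmetric] by simp
      then show ?thesis using c by (simp flip: of_real_mult)
    qed
    finally show ?thesis .
  qed
  define g where "g n u = of_real (((X n + u) / X n) powr (1 / 4)) * exp (of_real u * \<eta>) *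
     of_real (exp (sqrt (2 * X n) - sqrt (2 * (X n + u)))) * (j (X n + u) * \<beta> (X n + u))" for n u
  define A where "A n = of_real (X n powr (- 1 / 4)) * exp (- of_real (X n) * \<eta>) * complex_of_real (exp (sqrt (2 * X n)))" for n
  have gf: "g n u = A n * f (X n + u)" if X: "X n > 0" and u: "u \<ge> 0" for n u
  proof -
    have c: "X n + u > 0" using X u by simp
    have "((X n + u) / X n) powr (1 / 4) = X n powr (- 1 / 4) * (X n + u) powr (1 / 4)"
    proof -
      have "((X n + u) / X n) powr (1 / 4) = (X n + u) powr (1 / 4) / X n powr (1 / 4)"
        by (rule powr_divide)
      moreover have "X n powr (- 1 / 4) = 1 / X n powr (1 / 4)"
        using powr_minus_divide[of "X n" "1 / 4"] by simp
      ultimately show ?thesis by simp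
    qed
    moreover have "exp (of_real u * \<eta>) = exp (- of_real (X n) * \<eta>) * exp (of_real (X n + u) * \<eta>)"
      unfolding exp_add[symmetric] by (simp add: algebra_simps)
    moreover have "exp (sqrt (2 * X n) - sqrt (2 * (X n + u))) = exp (sqrt (2 * X n)) * exp (- sqrt (2 * (X n + u)))"
      unfolding exp_add[symmetric] by simp
    ultimately show ?thesis
      unfolding g_def A_def fc[OF c] by (simp only: of_real_mult mult_ac)
  qed
  have glim: "(\<lambda>n. g n u) \<longlonglongrightarrow> exp (of_real u * \<eta>) * (L * of_real (2 * norm \<xi>))" if u: "u \<ge> 0" for u
  proof -
    have Y: "filterlim (\<lambda>n. X n + u) at_top sequentially"
      using filterlim_tendsto_add_at_top[OF tendsto_const[of u] Xlim] by (simp add: add.commute)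
    have ratio: "(\<lambda>n. ((X n + u) / X n) powr (1 / 4)) \<longlonglongrightarrow> 1"
    proof -
      have "((\<lambda>a. ((a + u) / a) powr (1 / 4)) \<longlongrightarrow> 1) at_top" by real_asymp
      from filterlim_compose[OF this Xlim] show ?thesis .
    qed
    \<comment> \<open>Over a unit interval sqrt (2 c) changes by an amount tending to 0, so the
      phase fixed at the left endpoint persists across the interval.\<close>
    have diff: "(\<lambda>n. sqrt (2 * (X n + u)) - sqrt (2 * X n)) \<longlonglongrightarrow> 0" by (rule sqrt_shift_tendsto_0[OF Xlim])
    have e: "(\<lambda>n. exp (sqrt (2 * X n) - sqrt (2 * (X n + u)))) \<longlonglongrightarrow> exp (- 0)"
      using tendsto_exp[OF tendsto_minus[OF diff]] by simp
    have ph: "(\<lambda>n. exp (\<i> * of_real (sqrt (2 * (X n + u))))) \<longlonglongrightarrow> exp (\<i> * of_real \<theta>)"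
    proof -
      have "exp (\<i> * of_real (sqrt (2 * (X n + u)))) = exp (\<i> * of_real (sqrt (2 * (X n + u)) - sqrt (2 * X n))) * exp (\<i> * of_real \<theta>)" for n
      proof -
        have "exp (\<i> * of_real (sqrt (2 * X n))) = exp (\<i> * of_real \<theta>) * exp (\<i> * of_real (2 * pi * real (n + 1)))"
          unfolding Xs exp_add[symmetric] by (simp add: algebra_simps)
        also have "exp (\<i> * of_real (2 * pi * real (n + 1))) = 1"
          using exp_integer_2pi[of "of_nat (n + 1)"] by (simp add: mult_ac)
        finally have "exp (\<i> * of_real (sqrt (2 * X n))) = exp (\<i> * of_real \<theta>)" by simp
        moreover have "exp (\<i> * of_real (sqrt (2 * (X n + u)))) =
            exp (\<i> * of_real (sqrt (2 * (X n + u)) - sqrt (2 * X n))) * exp (\<i> * of_real (sqrt (2 * X n)))"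
          unfolding exp_add[symmetric] by (simp add: algebra_simps)
        ultimately show ?thesis by (simp only:)
      qed
      moreover have "(\<lambda>n. exp (\<i> * of_real (sqrt (2 * (X n + u)) - sqrt (2 * X n))) * exp (\<i> * of_real \<theta>)) \<longlonglongrightarrow>
          exp (\<i> * of_real 0) * exp (\<i> * of_real \<theta>)"
        by (intro tendsto_intros diff)
      ultimately show ?thesis by simp
    qed
    have ph': "(\<lambda>n. exp (- \<i> * of_real (sqrt (2 * (X n + u))))) \<longlonglongrightarrow> exp (- \<i> * of_real \<theta>)"
      using tendsto_cnj[OF ph] by (simp add: exp_cnj)
    have "(\<lambda>n. \<beta> (X n + u)) \<longlonglongrightarrow> E * \<zeta> * exp (- \<i> * of_real \<theta>) + cnj E * cnj \<zeta> * exp (\<i> * of_real \<theta>)"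
      unfolding \<beta>_def by (intro tendsto_intros filterlim_compose[OF k1 Y] filterlim_compose[OF k2 Y] ph ph')
    also have "E * \<zeta> * exp (- \<i> * of_real \<theta>) + cnj E * cnj \<zeta> * exp (\<i> * of_real \<theta>) = of_real (2 * norm \<xi>)"
    proof -
      have x: "\<xi> = of_real (norm \<xi>) * exp (\<i> * of_real \<theta>)" unfolding \<theta>_def using Arg_eq[OF \<xi>] .
      have "\<xi> * exp (- \<i> * of_real \<theta>) = of_real (norm \<xi>)"
        by (subst x) (simp add: mult.assoc exp_add[symmetric])
      moreover have "cnj \<xi> * exp (\<i> * of_real \<theta>) = cnj (\<xi> * exp (- \<i> * of_real \<theta>))" by (simp add: exp_cnj)
      ultimately show ?thesis unfolding \<xi>_def[symmetric] complex_cnj_mult[symmetric] by simp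
    qed
    finally have b: "(\<lambda>n. \<beta> (X n + u)) \<longlonglongrightarrow> of_real (2 * norm \<xi>)" .
    have "(\<lambda>n. g n u) \<longlonglongrightarrow> of_real 1 * exp (of_real u * \<eta>) * of_real (exp (- 0)) * (L * of_real (2 * norm \<xi>))"
      unfolding g_def using Jlim by (intro tendsto_intros ratio e b filterlim_compose[OF _ Y]) (simp add: j_def[abs_def])
    then show ?thesis by simp
  qed
  have "\<forall>\<^sub>F c in at_top. norm (j c) \<le> norm L + 1 \<and> norm (k \<omega> c) \<le> norm \<zeta> + 1 \<and> norm (k (cnj \<omega>) c) \<le> norm \<zeta> + 1 \<and> c \<ge> 1"
  proof (intro eventually_conj eventually_ge_at_top)
    have b: "\<forall>\<^sub>F c in at_top. norm (h c) \<le> norm l + 1" if "(h \<longlongrightarrow> l) at_top" for h :: "real \<Rightarrow> complex" and l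
      using order_tendstoD(2)[OF tendsto_norm[OF that], of "norm l + 1"] by (auto elim: eventually_mono)
    show "\<forall>\<^sub>F c in at_top. norm (j c) \<le> norm L + 1" by (rule b) (use Jlim in \<open>simp add: j_def[abs_def]\<close>)
    show "\<forall>\<^sub>F c in at_top. norm (k \<omega> c) \<le> norm \<zeta> + 1" by (rule b[OF k1])
    show "\<forall>\<^sub>F c in at_top. norm (k (cnj \<omega>) c) \<le> norm \<zeta> + 1" using b[OF k2] by simp
  qed
  then obtain C0 where C0: "\<And>c. c \<ge> C0 \<Longrightarrow> norm (j c) \<le> norm L + 1 \<and> norm (k \<omega> c) \<le> norm \<zeta> + 1 \<and> norm (k (cnj \<omega>) c) \<le> norm \<zeta> + 1 \<and> c \<ge> 1"
    by (auto simp: eventually_at_top_linorder)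
  have "\<forall>\<^sub>F n in sequentially. max C0 1 \<le> X n"
    using Xlim unfolding filterlim_at_top by blast
  then obtain N where N: "\<And>n. n \<ge> N \<Longrightarrow> X n \<ge> max C0 1"
    unfolding eventually_sequentially by blast
  define M where "M = 2 * exp (Re \<eta>) * ((norm L + 1) * (2 * (norm \<zeta> + 1)))"
  have bound: "norm (g n u) \<le> M" if n: "n \<ge> N" and u: "u \<in> {0..1}" for n u
  proof -
    have X1: "X n \<ge> C0" "X n \<ge> 1" using N[OF n] by auto
    have C: "norm (j (X n + u)) \<le> norm L + 1" "norm (k \<omega> (X n + u)) \<le> norm \<zeta> + 1" "norm (k (cnj \<omega>) (X n + u)) \<le> norm \<zeta> + 1"
      using C0[of "X n + u"] X1 u by auto
    have "(X n + u) / X n \<le> 2" using X1 u by (simp add: field_simps)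
    then have "((X n + u) / X n) powr (1 / 4) \<le> 2 powr (1 / 4)" using X1 u by (intro powr_mono2) auto
    also have "\<dots> \<le> 2 powr 1" by (intro powr_mono) auto
    finally have 1: "((X n + u) / X n) powr (1 / 4) \<le> 2" by simp
    have 2: "exp (u * Re \<eta>) \<le> exp (Re \<eta>)" using u \<eta> by simp
    have 3: "exp (sqrt (2 * X n) - sqrt (2 * (X n + u))) \<le> 1" using u by simp
    have nE: "norm E = 1" by (simp add: E_def norm_exp_eq_Re)
    have "norm (\<beta> (X n + u)) \<le> norm (k \<omega> (X n + u)) + norm (k (cnj \<omega>) (X n + u))"
      unfolding \<beta>_def by (rule norm_triangle_le) (simp add: norm_mult nE norm_exp_eq_Re)
    then have 4: "norm (\<beta> (X n + u)) \<le> 2 * (norm \<zeta> + 1)" using C by simp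
    have "norm (g n u) = ((X n + u) / X n) powr (1 / 4) * exp (u * Re \<eta>) * exp (sqrt (2 * X n) - sqrt (2 * (X n + u))) *
        (norm (j (X n + u)) * norm (\<beta> (X n + u)))"
      unfolding g_def norm_mult norm_exp_eq_Re by simp
    also have "\<dots> \<le> 2 * exp (Re \<eta>) * 1 * ((norm L + 1) * (2 * (norm \<zeta> + 1)))"
      by (intro mult_mono 1 2 3 4 C(1) mult_nonneg_nonneg) auto
    finally show ?thesis by (simp add: M_def)
  qed
  have cont: "continuous_on {0..1} (g n)" if n: "n \<ge> N" for n
  proof -
    have X1: "X n > 0" using N[OF n] by simp
    have "z \<notin> \<real>\<^sub>\<le>\<^sub>0" using z by (auto simp: complex_nonpos_Reals_iff)
    then have "continuous_on {0<..} f" unfolding f_def by (rule Bessel_JK_integrand_continuous)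
    then have "continuous_on {0..1} (\<lambda>u. f (X n + u))"
      by (rule continuous_on_compose2) (use X1 in \<open>auto intro!: continuous_intros\<close>)
    then have "continuous_on {0..1} (\<lambda>u. A n * f (X n + u))" by (intro continuous_intros)
    then show ?thesis by (rule continuous_on_eq) (use gf X1 in auto)
  qed
  have lim1: "(\<lambda>n. integral {0..1} (g (n + N))) \<longlonglongrightarrow> integral {0..1} (\<lambda>u. exp (of_real u * \<eta>) * (L * of_real (2 * norm \<xi>)))"
  proof (rule dominated_convergence(2)[where h = "\<lambda>_. M"])
    show "g (n + N) integrable_on {0..1}" for n using cont[of "n + N"] integrable_continuous_interval by simp
    show "norm (g (n + N) u) \<le> M" if "u \<in> {0..1}" for n u using bound[of "n + N" u] that by simp
    show "(\<lambda>n. g (n + N) u) \<longlonglongrightarrow> exp (of_real u * \<eta>) * (L * of_real (2 * norm \<xi>))" if "u \<in> {0..1}" for u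
      using LIMSEQ_ignore_initial_segment[OF glim[of u]] that by simp
  qed (rule integrable_const_ivl)
  have lim2: "(\<lambda>n. integral {0..1} (g (n + N))) \<longlonglongrightarrow> 0"
  proof -
    have "integral {0..1} (g n) = A n * integral {X n..X n + 1} f" if n: "n \<ge> N" for n
    proof -
      have "integral {0..1} (g n) = integral {0..1} (\<lambda>u. A n * f (X n + u))"
        using gf N[OF n] by (intro Henstock_Kurzweil_Integration.integral_cong) auto
      also have "\<dots> = A n * integral {0..1} (f \<circ> (+) (X n))" by (simp add: o_def)
      finally show ?thesis by (simp add: integral_shift_Icc_real add.commute)
    qed
    moreover have "(\<lambda>n. A n * integral {X n..X n + 1} f) \<longlonglongrightarrow> 0 * 0"
    proof (intro tendsto_mult)
      show "(\<lambda>n. integral {X n..X n + 1} f) \<longlonglongrightarrow> 0"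
        by (rule integrable_on_halfline_imp_tail[OF _ Xlim]) (use int in \<open>simp add: f_def\<close>)
      \<comment> \<open>The scaling factor tends to 0 because exp (- a Re \<eta>) beats exp (sqrt (2
        a)). Vanishing tail integrals would then force the limit of the rescaled integrals to be
        0.\<close>
      have "((\<lambda>a. a powr (- 1 / 4) * exp (- a * Re \<eta>) * exp (sqrt (2 * a))) \<longlongrightarrow> 0) at_top" using \<eta> by real_asymp
      from filterlim_compose[OF this Xlim]
      have "(\<lambda>n. norm (A n)) \<longlonglongrightarrow> 0" by (simp add: A_def norm_mult)
      then show "A \<longlonglongrightarrow> 0" by (rule tendsto_norm_zero_cancel)
    qed
    then have "(\<lambda>n. A (n + N) * integral {X (n + N)..X (n + N) + 1} f) \<longlonglongrightarrow> 0" using LIMSEQ_ignore_initial_segment by auto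
    ultimately show ?thesis by simp
  qed
  have "((\<lambda>u. exp (of_real u * \<eta>) * (L * of_real (2 * norm \<xi>))) has_integral
      exp (of_real 1 * \<eta>) / \<eta> * (L * of_real (2 * norm \<xi>)) - exp (of_real 0 * \<eta>) / \<eta> * (L * of_real (2 * norm \<xi>))) {0..1}"
    using \<eta> by (intro fundamental_theorem_of_calculus)
       (auto intro!: derivative_eq_intros has_vector_derivative_real_field)
  then have "integral {0..1} (\<lambda>u. exp (of_real u * \<eta>) * (L * of_real (2 * norm \<xi>))) =
      exp (of_real 1 * \<eta>) / \<eta> * (L * of_real (2 * norm \<xi>)) - exp (of_real 0 * \<eta>) / \<eta> * (L * of_real (2 * norm \<xi>))"
    by (rule integral_unique)
  also have "\<dots> = (exp \<eta> - 1) / \<eta> * (L * of_real (2 * norm \<xi>))"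
    by (simp add: algebra_simps diff_divide_distrib)
  finally have "integral {0..1} (\<lambda>u. exp (of_real u * \<eta>) * (L * of_real (2 * norm \<xi>))) =
      (exp \<eta> - 1) / \<eta> * (L * of_real (2 * norm \<xi>))" .
  then have "(exp \<eta> - 1) / \<eta> * (L * of_real (2 * norm \<xi>)) = 0"
    using LIMSEQ_unique[OF lim1 lim2] by (rule trans[OF sym])
  \<comment> \<open>That limit is (exp \<eta> - 1) / \<eta> times a nonzero constant; it vanishes
    only if exp \<eta> = 1, which Re \<eta> > 0 forbids.\<close>
  then have "exp \<eta> = 1" using L \<xi> \<eta> by auto
  then have "exp (Re \<eta>) = 1" by (metis norm_exp_eq_Re norm_one)
  then show False using \<eta> by simp
qed

text \<open>The existential in the last conjunct leaves no freedom: the slit plane is connected, so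
  F is determined by its values on the positive axis and F z is the analytic continuation of the
  integral.\<close>

theorem theorem16:
  fixes \<nu> :: real and z :: complex
  assumes "- 1 / 2 \<le> \<nu>" and "\<nu> < 5 / 2" and "z \<notin> \<real>\<^sub>\<le>\<^sub>0"
  shows "(Bessel_JK_integrand \<nu> z integrable_on {0<..} \<longrightarrow>
           integral {0<..} (Bessel_JK_integrand \<nu> z) = 1 / z ^ 3 * Bessel_K \<nu> (1 / z))
       \<and> (z \<in> \<real> \<longrightarrow> Bessel_JK_integrand \<nu> z absolutely_integrable_on {0<..})
       \<and> (\<exists>F. F holomorphic_on (- \<real>\<^sub>\<le>\<^sub>0)
            \<and> (\<forall>x::real. x > 0 \<longrightarrow>
                 F (of_real x) = integral {0<..} (Bessel_JK_integrand \<nu> (of_real x)))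
            \<and> F z = 1 / z ^ 3 * Bessel_K \<nu> (1 / z))"
proof -
  have pos: "Bessel_JK_integrand \<nu> (of_real x) absolutely_integrable_on {0<..}"
    "integral {0<..} (Bessel_JK_integrand \<nu> (of_real x)) = 1 / of_real x ^ 3 * Bessel_K \<nu> (1 / of_real x)"
    if x: "x > 0" for x
  proof -
    interpret Bessel_JK \<nu> x using assms(1) x by unfold_locales
    note m = borel_measurable_integrable[OF integrand_integrable]
    show "Bessel_JK_integrand \<nu> (of_real x) absolutely_integrable_on {0<..}"
      using halfline_absolutely_integrable(1)[OF m] integrand_integrable by blast
    show "integral {0<..} (Bessel_JK_integrand \<nu> (of_real x)) = 1 / of_real x ^ 3 * Bessel_K \<nu> (1 / of_real x)"
      using halfline_absolutely_integrable(2)[OF m integrand_integrable] integrand_integral by simp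
  qed
  \<comment> \<open>The right-hand side itself serves as the continuation; its holomorphy rests on
    that of K and on the invariance of the slit plane under inversion.\<close>
  define F where "F w = 1 / w ^ 3 * Bessel_K \<nu> (1 / w)" for w
  have slit: "1 / w \<in> - \<real>\<^sub>\<le>\<^sub>0" if "w \<in> - \<real>\<^sub>\<le>\<^sub>0" for w :: complex
  proof
    assume "1 / w \<in> \<real>\<^sub>\<le>\<^sub>0"
    then obtain r where r: "r \<le> 0" "1 / w = of_real r" by (auto elim!: nonpos_Reals_cases)
    then have "w = of_real (1 / r)" by (metis divide_divide_eq_right div_by_1 of_real_1 of_real_divide mult_1 inverse_eq_divide inverse_inverse_eq)
    moreover have "1 / r \<le> 0" using r by simp
    ultimately show False using that by (metis ComplD nonpos_Reals_of_real_iff)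
  qed
  have "(\<lambda>w. Bessel_K \<nu> (1 / w)) holomorphic_on (- \<real>\<^sub>\<le>\<^sub>0)"
  proof -
    have "(\<lambda>w::complex. 1 / w) holomorphic_on (- \<real>\<^sub>\<le>\<^sub>0)" by (intro holomorphic_intros) auto
    from holomorphic_on_compose_gen[OF this Bessel_K_holomorphic] show ?thesis
      using slit by (auto simp: o_def)
  qed
  then have hol: "F holomorphic_on (- \<real>\<^sub>\<le>\<^sub>0)"
    unfolding F_def by (intro holomorphic_intros) auto
  have zreal: "\<exists>x>0. z = of_real x" if "Im z = 0"
    using that assms(3) by (intro exI[of _ "Re z"]) (auto simp: complex_nonpos_Reals_iff complex_eq_iff)
  show ?thesis
  proof (intro conjI impI exI[of _ F] allI)
    assume i: "Bessel_JK_integrand \<nu> z integrable_on {0<..}"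
    \<comment> \<open>Integrability fails off the real axis, so in the first conjunct only positive
      real z remain.\<close>
    have "Im z = 0" using Bessel_JK_integrand_not_integrable[of \<nu> z] assms(1) i by auto
    then show "integral {0<..} (Bessel_JK_integrand \<nu> z) = 1 / z ^ 3 * Bessel_K \<nu> (1 / z)"
      using zreal pos(2) by auto
  next
    assume "z \<in> \<real>"
    then show "Bessel_JK_integrand \<nu> z absolutely_integrable_on {0<..}"
      using zreal pos(1) by (auto simp: complex_is_Real_iff)
  qed (use hol pos(2) in \<open>auto simp: F_def\<close>)
qed

end
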